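(* Let $H$ be a free abelian group and let $k\ge 1$. The homomorphism $\eta'_k$ from $\mathcal A_k^t(H)$, regarded as a map $\eta'_k:\mathcal A_k^t(H)\to \mathsf D'_k(H)$, is a split surjection of abelian groups. If $k$ is even, $\ker\eta'_k$ is the torsion subgroup of $\mathcal A_k^t(H)$. If $k$ is odd, $\ker\eta'_k$ is the odd torsion subgroup of $\mathcal A_k^t(H)$ (the subgroup of elements of finite odd order). In either case $$(k+2)\,\ker\eta'_k=0 .$$
   Context: Quasi-Lie algebras. A quasi-Lie algebra (over $\mathbb Z$) is an abelian group with a bilinear bracket satisfying anti-symmetry $[x,y]+[y,x]=0$ and the Jacobi identity $[[x,y],z]+[[y,z],x]+[[z,x],y]=0$ for all $x,y,z$ (one does not require $[x,x]=0$). $L'(H)$ is the free quasi-Lie algebra over the free abelian group $H$, i.e. the quotient of the free non-associative (magma) ring on $H$ by the two-sided ideal generated by the anti-symmetry and Jacobi relations; it is graded with $L'_1(H)=H$, and $L'_k(H)$ is its degree $k$ part. The bracket map $\beta'_k:H\otimes L'_{k+1}(H)\to L'_{k+2}(H)$ is $\beta'_k(h\otimes\alpha)=[h,\alpha]$, and $\mathsf D'_k(H)=\ker\beta'_k$. Trees. $\mathcal A_k^t(H)$ is the abelian group generated by finite trees all of whose vertices are univalent or trivalent, with exactly $k$ trivalent vertices (hence $k+2$ univalent vertices, called leaves), equipped with a cyclic ordering of the three edges at each trivalent vertex and a label in $H$ on each leaf, taken up to isomorphism, modulo: (i) anti-symmetry: reversing the cyclic order at one trivalent vertex multiplies the tree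 by $-1$; (ii) IHX: for subtrees $A,B,C,D$, let $T(A,B;C,D)$ be the tree with an internal edge $e$ whose endpoints have cyclic orders $(A,B,e)$ and $(e,C,D)$; then $T(A,B;C,D)+T(B,C;A,D)+T(C,A;B,D)=0$; (iii) linearity: the tree is additive in each label. The map $\eta'_k$. Given a tree $T$ that is one of the generators of $\mathcal A_k^t(H)$ (a finite tree with $k$ trivalent and $k+2$ univalent vertices, a cyclic ordering of the edges at each trivalent vertex, and a label in $H$ on each leaf) and a leaf $w$ with label $h_w\in H$, designate $w$ as root; the remaining rooted tree determines a bracket $b_w(T)\in L'_{k+1}(H)$ recursively: a leaf labelled $h$ gives $h$, and a trivalent vertex with cyclic order (edge towards the root, subtree $A$, subtree $B$) gives $[a,b]$, where $a,b$ are the brackets of $A,B$. Define the homomorphism $\eta'_k:\mathcal A_k^t(H)\to H\otimes L'_{k+1}(H)$ by $\eta'_k(T)=\sum_w h_w\otimes b_w(T)$, the sum over all leaves $w$ of $T$. Its image lies in $\mathsf D'_k(H)$. *)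

theory Defs
  imports "HOL-Algebra.Free_Abelian_Groups" "HOL-Algebra.Multiplicative_Group"
begin

text \<open>
  All abelian groups are commutative groups in the sense of HOL-Algebra, so they are written
  multiplicatively: the sum of \<open>x\<close> and \<open>y\<close> is \<open>x \<otimes> y\<close>, zero is \<open>\<one>\<close>, and \<open>n x\<close> is \<open>x [^] n\<close>.
  Elements of a free abelian group are finitely supported integer-valued functions, whose
  group operation is \<open>+\<close>.
\<close>

section \<open>Abelian groups given by generators and relations\<close>

definition presented :: "'a set \<Rightarrow> ('a \<Rightarrow>\<^sub>0 int) set \<Rightarrow> ('a \<Rightarrow>\<^sub>0 int) set monoid" where
  "presented S R = free_Abelian_group S Mod generate (free_Abelian_group S) R"

definition gen_class :: "'a set \<Rightarrow> ('a \<Rightarrow>\<^sub>0 int) set \<Rightarrow> 'a \<Rightarrow> ('a \<Rightarrow>\<^sub>0 int) set" where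
  "gen_class S R a =
     generate (free_Abelian_group S) R #>\<^bsub>free_Abelian_group S\<^esub> frag_of a"

definition free_hom :: "('g, 'm) monoid_scheme \<Rightarrow> ('a \<Rightarrow> 'g) \<Rightarrow> ('a \<Rightarrow>\<^sub>0 int) \<Rightarrow> 'g" where
  "free_hom G f c =
     finprod G (\<lambda>a. f a [^]\<^bsub>G\<^esub> Poly_Mapping.lookup c a) (Poly_Mapping.keys c)"

text \<open>
  The homomorphism out of a presented group that sends the class of each generator \<open>a\<close> to \<open>f a\<close>.
  It is meaningful when \<open>free_hom G f\<close> kills the relations, so that it is constant on cosets.
\<close>

definition induced_hom ::
    "('g, 'm) monoid_scheme \<Rightarrow> ('a \<Rightarrow> 'g) \<Rightarrow> ('a \<Rightarrow>\<^sub>0 int) set \<Rightarrow> 'g" where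
  "induced_hom G f X = the_elem (free_hom G f ` X)"


section \<open>Tensor product over the integers\<close>

definition tensor_rels ::
    "('a, 'm) monoid_scheme \<Rightarrow> ('b, 'n) monoid_scheme \<Rightarrow> ('a \<times> 'b \<Rightarrow>\<^sub>0 int) set" where
  "tensor_rels G K =
     {frag_of (x \<otimes>\<^bsub>G\<^esub> y, z) - frag_of (x, z) - frag_of (y, z) | x y z.
        x \<in> carrier G \<and> y \<in> carrier G \<and> z \<in> carrier K} \<union>
     {frag_of (x, y \<otimes>\<^bsub>K\<^esub> z) - frag_of (x, y) - frag_of (x, z) | x y z.
        x \<in> carrier G \<and> y \<in> carrier K \<and> z \<in> carrier K}"

definition tensor ::
    "('a, 'm) monoid_scheme \<Rightarrow> ('b, 'n) monoid_scheme \<Rightarrow> ('a \<times> 'b \<Rightarrow>\<^sub>0 int) set monoid" where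
  "tensor G K = presented (carrier G \<times> carrier K) (tensor_rels G K)"

definition pure_tensor ::
    "('a, 'm) monoid_scheme \<Rightarrow> ('b, 'n) monoid_scheme \<Rightarrow> 'a \<Rightarrow> 'b \<Rightarrow> ('a \<times> 'b \<Rightarrow>\<^sub>0 int) set" where
  "pure_tensor G K x y = gen_class (carrier G \<times> carrier K) (tensor_rels G K) (x, y)"


section \<open>The free quasi-Lie algebra\<close>

datatype 'h word = Letter 'h | Bracket "'h word" "'h word"

primrec word_degree :: "'h word \<Rightarrow> nat" where
  "word_degree (Letter h) = 1"
| "word_degree (Bracket s t) = word_degree s + word_degree t"

definition words :: "('h, 'm) monoid_scheme \<Rightarrow> 'h word set" where
  "words H = {t. set_word t \<subseteq> carrier H}"

abbreviation magma_ring :: "('h, 'm) monoid_scheme \<Rightarrow> ('h word \<Rightarrow>\<^sub>0 int) monoid" where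
  "magma_ring H \<equiv> free_Abelian_group (words H)"

definition magma_mult :: "('h word \<Rightarrow>\<^sub>0 int) \<Rightarrow> ('h word \<Rightarrow>\<^sub>0 int) \<Rightarrow> ('h word \<Rightarrow>\<^sub>0 int)" where
  "magma_mult p q = frag_extend (\<lambda>s. frag_extend (\<lambda>t. frag_of (Bracket s t)) q) p"

text \<open>
  A two-sided ideal of the magma ring on the underlying set of \<open>H\<close>. Rule \<open>additive\<close> makes the
  letters additive in \<open>H\<close>, i.e. it passes to the free non-associative ring on the abelian group
  \<open>H\<close>; without it the degree one part would not be \<open>H\<close>.
\<close>

inductive_set quasi_lie_ideal :: "('h, 'm) monoid_scheme \<Rightarrow> ('h word \<Rightarrow>\<^sub>0 int) set"
  for H :: "('h, 'm) monoid_scheme" where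
  additive: "\<lbrakk>g \<in> carrier H; h \<in> carrier H\<rbrakk> \<Longrightarrow>
     frag_of (Letter (g \<otimes>\<^bsub>H\<^esub> h)) - frag_of (Letter g) - frag_of (Letter h) \<in> quasi_lie_ideal H"
| antisymmetry: "\<lbrakk>x \<in> carrier (magma_ring H); y \<in> carrier (magma_ring H)\<rbrakk> \<Longrightarrow>
     magma_mult x y + magma_mult y x \<in> quasi_lie_ideal H"
| jacobi: "\<lbrakk>x \<in> carrier (magma_ring H); y \<in> carrier (magma_ring H); z \<in> carrier (magma_ring H)\<rbrakk> \<Longrightarrow>
     magma_mult (magma_mult x y) z + magma_mult (magma_mult y z) x + magma_mult (magma_mult z x) y
       \<in> quasi_lie_ideal H"
| zero: "0 \<in> quasi_lie_ideal H"
| diff: "\<lbrakk>p \<in> quasi_lie_ideal H; q \<in> quasi_lie_ideal H\<rbrakk> \<Longrightarrow> p - q \<in> quasi_lie_ideal H"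
| mult_left: "\<lbrakk>x \<in> carrier (magma_ring H); p \<in> quasi_lie_ideal H\<rbrakk> \<Longrightarrow>
     magma_mult x p \<in> quasi_lie_ideal H"
| mult_right: "\<lbrakk>p \<in> quasi_lie_ideal H; x \<in> carrier (magma_ring H)\<rbrakk> \<Longrightarrow>
     magma_mult p x \<in> quasi_lie_ideal H"

definition quasi_lie_class ::
    "('h, 'm) monoid_scheme \<Rightarrow> ('h word \<Rightarrow>\<^sub>0 int) \<Rightarrow> ('h word \<Rightarrow>\<^sub>0 int) set" where
  "quasi_lie_class H p = quasi_lie_ideal H #>\<^bsub>magma_ring H\<^esub> p"

definition quasi_lie :: "('h, 'm) monoid_scheme \<Rightarrow> ('h word \<Rightarrow>\<^sub>0 int) set monoid" where
  "quasi_lie H = magma_ring H Mod quasi_lie_ideal H"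

definition quasi_lie_bracket ::
    "('h, 'm) monoid_scheme \<Rightarrow> ('h word \<Rightarrow>\<^sub>0 int) set \<Rightarrow> ('h word \<Rightarrow>\<^sub>0 int) set
      \<Rightarrow> ('h word \<Rightarrow>\<^sub>0 int) set" where
  "quasi_lie_bracket H X Y = (\<Union>x\<in>X. \<Union>y\<in>Y. quasi_lie_class H (magma_mult x y))"

definition quasi_lie_deg :: "('h, 'm) monoid_scheme \<Rightarrow> nat \<Rightarrow> ('h word \<Rightarrow>\<^sub>0 int) set monoid" where
  "quasi_lie_deg H k = (quasi_lie H)
     \<lparr>carrier := quasi_lie_class H ` carrier (free_Abelian_group {t \<in> words H. word_degree t = k})\<rparr>"

abbreviation H_tensor_L ::
    "('h, 'm) monoid_scheme \<Rightarrow> nat \<Rightarrow> ('h \<times> ('h word \<Rightarrow>\<^sub>0 int) set \<Rightarrow>\<^sub>0 int) set monoid" where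
  "H_tensor_L H k \<equiv> tensor H (quasi_lie_deg H (k + 1))"

definition bracket_map ::
    "('h, 'm) monoid_scheme \<Rightarrow> nat \<Rightarrow> ('h \<times> ('h word \<Rightarrow>\<^sub>0 int) set \<Rightarrow>\<^sub>0 int) set
      \<Rightarrow> ('h word \<Rightarrow>\<^sub>0 int) set" where
  "bracket_map H k = induced_hom (quasi_lie_deg H (k + 2))
     (\<lambda>(h, \<alpha>). quasi_lie_bracket H (quasi_lie_class H (frag_of (Letter h))) \<alpha>)"

definition D_group ::
    "('h, 'm) monoid_scheme \<Rightarrow> nat \<Rightarrow> ('h \<times> ('h word \<Rightarrow>\<^sub>0 int) set \<Rightarrow>\<^sub>0 int) set monoid" where
  "D_group H k = (H_tensor_L H k)
     \<lparr>carrier := kernel (H_tensor_L H k) (quasi_lie_deg H (k + 2)) (bracket_map H k)\<rparr>"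


section \<open>Labelled uni-trivalent trees\<close>

text \<open>
  A graph is a set of half-edges together with the involution \<open>opp\<close> that exchanges the two halves
  of an edge, and the map \<open>rot\<close> that sends a half-edge to the next one in the cyclic order at its
  vertex. Vertices are the orbits of \<open>rot\<close>, so univalent vertices are the fixed points of \<open>rot\<close>
  and trivalent vertices its orbits of size three. Labels matter only at univalent vertices.
  Half-edges are natural numbers, so that every finite tree occurs up to isomorphism.
\<close>

record 'h half_edge_graph =
  half_edges :: "nat set"
  opp :: "nat \<Rightarrow> nat"
  rot :: "nat \<Rightarrow> nat"
  lab :: "nat \<Rightarrow> 'h"

definition vertex_of :: "('h, 'z) half_edge_graph_scheme \<Rightarrow> nat \<Rightarrow> nat set" where
  "vertex_of T x = {x, rot T x, rot T (rot T x)}"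

definition leaves :: "('h, 'z) half_edge_graph_scheme \<Rightarrow> nat set" where
  "leaves T = {x \<in> half_edges T. rot T x = x}"

definition trivalent_vertices :: "('h, 'z) half_edge_graph_scheme \<Rightarrow> nat set set" where
  "trivalent_vertices T = vertex_of T ` (half_edges T - leaves T)"

definition unitrivalent_graph :: "('h, 'z) half_edge_graph_scheme \<Rightarrow> bool" where
  "unitrivalent_graph T \<longleftrightarrow> finite (half_edges T) \<and>
     (\<forall>x\<in>half_edges T. opp T x \<in> half_edges T \<and> opp T x \<noteq> x \<and> opp T (opp T x) = x) \<and>
     (\<forall>x\<in>half_edges T. rot T x \<in> half_edges T \<and> rot T (rot T (rot T x)) = x)"

definition connected_graph :: "('h, 'z) half_edge_graph_scheme \<Rightarrow> bool" where
  "connected_graph T \<longleftrightarrow> half_edges T \<noteq> {} \<and>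
     (\<forall>x\<in>half_edges T. \<forall>y\<in>half_edges T.
        (x, y) \<in> ({(u, opp T u) | u. u \<in> half_edges T} \<union> {(u, rot T u) | u. u \<in> half_edges T})\<^sup>*)"

text \<open>
  One step of a walk without backtracking: traverse the edge that starts with the half-edge \<open>x\<close>,
  and leave the vertex reached along a different half-edge \<open>y\<close>. A finite graph, possibly with
  loops and multiple edges, has no cycle iff no such walk closes up.
\<close>

definition walk_step :: "('h, 'z) half_edge_graph_scheme \<Rightarrow> (nat \<times> nat) set" where
  "walk_step T =
     {(x, y). x \<in> half_edges T \<and> y \<in> vertex_of T (opp T x) \<and> y \<noteq> opp T x}"

definition trees :: "('h, 'm) monoid_scheme \<Rightarrow> nat \<Rightarrow> 'h half_edge_graph set" where
  "trees H k = {T. unitrivalent_graph T \<and> connected_graph T \<and> acyclic (walk_step T) \<and>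
     card (trivalent_vertices T) = k \<and> (\<forall>w\<in>leaves T. lab T w \<in> carrier H)}"

definition tree_iso :: "'h half_edge_graph \<Rightarrow> 'h half_edge_graph \<Rightarrow> bool" where
  "tree_iso T T' \<longleftrightarrow> (\<exists>f. bij_betw f (half_edges T) (half_edges T') \<and>
     (\<forall>x\<in>half_edges T. f (opp T x) = opp T' (f x) \<and> f (rot T x) = rot T' (f x)) \<and>
     (\<forall>w\<in>leaves T. lab T' (f w) = lab T w))"

definition flip_at :: "nat \<Rightarrow> 'h half_edge_graph \<Rightarrow> 'h half_edge_graph" where
  "flip_at x T = (let y = rot T x; z = rot T y in
     T\<lparr>rot := (rot T)(x := z, z := y, y := x)\<rparr>)"

text \<open>
  \<open>regraft T e (a, b) (c, d)\<close> has the half-edges, edges and labels of \<open>T\<close>, with the cyclic order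
  at the two ends of the edge \<open>e\<close> replaced by \<open>(a, b, e)\<close> and \<open>(opp T e, c, d)\<close>. A half-edge at an
  end of \<open>e\<close> stands for the subtree attached through it.
\<close>

definition regraft ::
    "'h half_edge_graph \<Rightarrow> nat \<Rightarrow> nat \<times> nat \<Rightarrow> nat \<times> nat \<Rightarrow> 'h half_edge_graph" where
  "regraft T e = (\<lambda>(a, b) (c, d).
     T\<lparr>rot := (rot T)(a := b, b := e, e := a, opp T e := c, c := d, d := opp T e)\<rparr>)"

definition iso_rels :: "('h, 'm) monoid_scheme \<Rightarrow> nat \<Rightarrow> ('h half_edge_graph \<Rightarrow>\<^sub>0 int) set" where
  "iso_rels H k = {frag_of T - frag_of T' | T T'. T \<in> trees H k \<and> T' \<in> trees H k \<and> tree_iso T T'}"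

definition antisymmetry_rels ::
    "('h, 'm) monoid_scheme \<Rightarrow> nat \<Rightarrow> ('h half_edge_graph \<Rightarrow>\<^sub>0 int) set" where
  "antisymmetry_rels H k =
     {frag_of T + frag_of (flip_at x T) | T x. T \<in> trees H k \<and> x \<in> half_edges T - leaves T}"

definition IHX_rels :: "('h, 'm) monoid_scheme \<Rightarrow> nat \<Rightarrow> ('h half_edge_graph \<Rightarrow>\<^sub>0 int) set" where
  "IHX_rels H k =
     {frag_of (regraft T e (a, b) (c, d)) + frag_of (regraft T e (b, c) (a, d)) +
        frag_of (regraft T e (c, a) (b, d)) | T e a b c d.
        T \<in> trees H k \<and> e \<in> half_edges T - leaves T \<and> opp T e \<notin> leaves T \<and>
        a = rot T e \<and> b = rot T a \<and> c = rot T (opp T e) \<and> d = rot T c}"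

definition linearity_rels :: "('h, 'm) monoid_scheme \<Rightarrow> nat \<Rightarrow> ('h half_edge_graph \<Rightarrow>\<^sub>0 int) set" where
  "linearity_rels H k =
     {frag_of (T\<lparr>lab := (lab T)(w := g \<otimes>\<^bsub>H\<^esub> h)\<rparr>) - frag_of (T\<lparr>lab := (lab T)(w := g)\<rparr>) -
        frag_of (T\<lparr>lab := (lab T)(w := h)\<rparr>) | T w g h.
        T \<in> trees H k \<and> w \<in> leaves T \<and> g \<in> carrier H \<and> h \<in> carrier H}"

definition tree_group ::
    "('h, 'm) monoid_scheme \<Rightarrow> nat \<Rightarrow> ('h half_edge_graph \<Rightarrow>\<^sub>0 int) set monoid" where
  "tree_group H k = presented (trees H k)
     (iso_rels H k \<union> antisymmetry_rels H k \<union> IHX_rels H k \<union> linearity_rels H k)"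


section \<open>The map from trees to the tensor product\<close>

text \<open>
  \<open>branch T x t\<close>: the rooted tree found after traversing the edge that starts with the half-edge
  \<open>x\<close> reads as the bracketed word \<open>t\<close>. If the vertex reached is trivalent, its half-edges in cyclic
  order are \<open>opp T x\<close>, which points to the root, and then those leading to the two subtrees.
\<close>

inductive branch :: "'h half_edge_graph \<Rightarrow> nat \<Rightarrow> 'h word \<Rightarrow> bool" for T where
  leaf: "rot T (opp T x) = opp T x \<Longrightarrow> branch T x (Letter (lab T (opp T x)))"
| node: "\<lbrakk>rot T (opp T x) \<noteq> opp T x; branch T (rot T (opp T x)) s;
     branch T (rot T (rot T (opp T x))) t\<rbrakk> \<Longrightarrow> branch T x (Bracket s t)"

definition rooted_bracket ::
    "('h, 'm) monoid_scheme \<Rightarrow> 'h half_edge_graph \<Rightarrow> nat \<Rightarrow> ('h word \<Rightarrow>\<^sub>0 int) set" where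
  "rooted_bracket H T w = quasi_lie_class H (frag_of (THE t. branch T w t))"

definition eta ::
    "('h, 'm) monoid_scheme \<Rightarrow> nat \<Rightarrow> ('h half_edge_graph \<Rightarrow>\<^sub>0 int) set
      \<Rightarrow> ('h \<times> ('h word \<Rightarrow>\<^sub>0 int) set \<Rightarrow>\<^sub>0 int) set" where
  "eta H k = induced_hom (H_tensor_L H k)
     (\<lambda>T. finprod (H_tensor_L H k)
        (\<lambda>w. pure_tensor H (quasi_lie_deg H (k + 1)) (lab T w) (rooted_bracket H T w)) (leaves T))"


section \<open>Split surjections and torsion\<close>

definition split_surjection ::
    "('a, 'm) monoid_scheme \<Rightarrow> ('b, 'n) monoid_scheme \<Rightarrow> ('a \<Rightarrow> 'b) \<Rightarrow> bool" where
  "split_surjection G K f \<longleftrightarrow> f \<in> epi G K \<and> (\<exists>s \<in> hom K G. \<forall>y \<in> carrier K. f (s y) = y)"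

text \<open>Elements of infinite order have \<open>group.ord\<close> equal to \<open>0\<close>, which is even.\<close>

definition torsion_subgroup :: "('a, 'm) monoid_scheme \<Rightarrow> 'a set" where
  "torsion_subgroup G = {x \<in> carrier G. group.ord G x > 0}"

definition odd_torsion_subgroup :: "('a, 'm) monoid_scheme \<Rightarrow> 'a set" where
  "odd_torsion_subgroup G = {x \<in> carrier G. odd (group.ord G x)}"

end

theory Submission
  imports Defs
begin

text \<open>
  Let \<open>F s t\<close> be the sum of \<open>h \<otimes> b\<close> over the leaves of the rooted tree \<open>s\<close>, where \<open>h\<close> is the label
  of the leaf and \<open>b\<close> is the bracket obtained by rooting at that leaf the tree that arises from
  \<open>s\<close> and \<open>t\<close> by joining their roots. It satisfies \<open>F [x, y] z = F x [y, z] + F y [z, x]\<close>, so it is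
  well defined on the free quasi-Lie algebra \<open>L'\<close>, and \<open>\<eta> T = F s t + F t s\<close> whenever some edge cuts the
  tree \<open>T\<close> into \<open>s\<close> and \<open>t\<close>. Hence \<open>\<eta>\<close> is well defined. Modulo its image \<open>F\<close> is antisymmetric,
  therefore factors through the bracket of \<open>L'\<close>, and as \<open>F h \<alpha> = h \<otimes> \<alpha>\<close> this inverts the bracket map on
  the cokernel of \<open>\<eta>\<close>: the image of \<open>\<eta>\<close> is the kernel of the bracket map.

  Reading \<open>h \<otimes> \<alpha>\<close> as a tree gives a map \<open>\<rho>\<close> with \<open>\<rho> \<circ> \<eta> = k + 2\<close>, so \<open>k + 2\<close> kills the kernel of \<open>\<eta>\<close>.
  Lyndon trees, together with the squares \<open>[x, x]\<close>, span \<open>L'\<close> and have independent images in the free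
  associative ring. So the kernel of the map \<open>\<theta>\<close> from \<open>H \<otimes> L'\<close> to that ring is killed by \<open>2\<close>, and it is
  zero when \<open>k\<close> is even. This gives the statements on torsion. The image of \<open>\<theta> \<circ> \<eta>\<close> is free, and a
  section of \<open>\<eta>\<close> arises from one of \<open>\<theta> \<circ> \<eta>\<close> by a correction with \<open>\<rho>\<close>.
\<close>

section \<open>Additive subsets of groups of finitely supported functions\<close>

text \<open>The parity of \<open>k\<close> enters through the squares. They live in even degrees,
  and the second tensor factor has degree \<open>k + 1\<close>, so for even \<open>k\<close> the
  group \<open>H_tensor_L H k\<close> is torsion-free, while for odd \<open>k\<close> it may contain
  elements of order two. In the odd case a tree element of even order may have such an element as
  its image, so only odd torsion is forced into the kernel; and since \<open>k + 2\<close> is then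
  odd, the kernel has no other torsion. The same elements may keep \<open>D_group H k\<close> from
  being free, so the splitting does not follow from freeness alone. The correction works because it
  multiplies the defect by \<open>k + 1\<close>, which is even exactly when a defect can remain.

  Antisymmetry and Jacobi are multilinear, so every map can be given on words or on trees, and being
  well defined means carrying one set of relations into another. Trees enter the algebra only
  through the two words read on the two sides of an edge, which determine the tree up to
  isomorphism.\<close>

definition additive_subset :: "'a::ab_group_add set \<Rightarrow> bool" where
  "additive_subset N \<longleftrightarrow> 0 \<in> N \<and> (\<forall>p\<in>N. \<forall>q\<in>N. p - q \<in> N)"

lemma additive_subset_zero: "additive_subset N \<Longrightarrow> 0 \<in> N"
  and additive_subset_diff: "additive_subset N \<Longrightarrow> p \<in> N \<Longrightarrow> q \<in> N \<Longrightarrow> p - q \<in> N"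
  by (auto simp: additive_subset_def)

lemma additive_subset_minus: "additive_subset N \<Longrightarrow> p \<in> N \<Longrightarrow> - p \<in> N"
  using additive_subset_diff[of N 0 p] additive_subset_zero by auto

lemma additive_subset_add: "additive_subset N \<Longrightarrow> p \<in> N \<Longrightarrow> q \<in> N \<Longrightarrow> p + q \<in> N"
  using additive_subset_diff[of N p "- q"] additive_subset_minus by auto

lemma additive_subset_minus_iff: "additive_subset N \<Longrightarrow> - p \<in> N \<longleftrightarrow> p \<in> N"
  using additive_subset_minus[of N p] additive_subset_minus[of N "- p"] by auto

lemma additive_subset_sum:
  "additive_subset N \<Longrightarrow> (\<And>i. i \<in> J \<Longrightarrow> p i \<in> N) \<Longrightarrow> sum p J \<in> N"
  by (induction J rule: infinite_finite_induct)
    (auto intro: additive_subset_zero additive_subset_add)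

lemma additive_subset_cmul:
  fixes N :: "('a \<Rightarrow>\<^sub>0 int) set"
  assumes N: "additive_subset N" and p: "p \<in> N"
  shows "frag_cmul n p \<in> N"
proof (rule frag_closure_minus_cmul[where P = "\<lambda>q. q \<in> N"])
qed (use additive_subset_zero additive_subset_diff N p in auto)

lemma additive_subset_frag_extend:
  fixes N :: "('b \<Rightarrow>\<^sub>0 int) set"
  assumes "additive_subset N" "\<And>a. a \<in> Poly_Mapping.keys p \<Longrightarrow> f a \<in> N"
  shows "frag_extend f p \<in> N"
  unfolding frag_extend_def
  by (intro additive_subset_sum additive_subset_cmul) (use assms in auto)

lemma additive_subset_vimage_frag_extend:
  fixes N :: "('b \<Rightarrow>\<^sub>0 int) set"
  assumes "additive_subset N"
  shows "additive_subset {p. frag_extend f p \<in> N}"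
  using assms by (auto simp: additive_subset_def frag_extend_diff)

lemma additive_subset_carrier: "additive_subset (carrier (free_Abelian_group S))"
  using keys_diff by (fastforce simp: additive_subset_def)

lemma frag_induct [case_names zero one diff]:
  fixes c :: "'a \<Rightarrow>\<^sub>0 int"
  assumes "P 0" "\<And>x. P (frag_of x)" "\<And>a b. P a \<Longrightarrow> P b \<Longrightarrow> P (a - b)"
  shows "P c"
  using subset_UNIV by (rule frag_induction) (use assms in auto)

lemma frag_extend_diff_fun: "frag_extend (\<lambda>a. f a - g a) p = frag_extend f p - frag_extend g p"
  by (induction p rule: frag_induct) (auto simp: frag_extend_diff algebra_simps)

lemma frag_extend_add_fun: "frag_extend (\<lambda>a. f a + g a) p = frag_extend f p + frag_extend g p"
  by (induction p rule: frag_induct) (auto simp: frag_extend_diff algebra_simps)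

lemma frag_extend_frag_extend:
  "frag_extend f (frag_extend g p) = frag_extend (\<lambda>a. frag_extend f (g a)) p"
  by (induction p rule: frag_induct) (auto simp: frag_extend_diff)

lemma frag_extend_swap:
  "frag_extend (\<lambda>a. frag_extend (\<lambda>b. f a b) q) p = frag_extend (\<lambda>b. frag_extend (\<lambda>a. f a b) p) q"
  by (induction p rule: frag_induct)
    (auto simp: frag_extend_diff frag_extend_diff_fun frag_extend_eq_0)

text \<open>Serves to expand an expression that is additive in one argument over the generators of
  that argument, without unfolding the products inside it.\<close>

lemma additive_eq_frag_extend:
  fixes g :: "('a \<Rightarrow>\<^sub>0 int) \<Rightarrow> ('b \<Rightarrow>\<^sub>0 int)"
  assumes "\<And>a b. g (a - b) = g a - g b"
  shows "g p = frag_extend (\<lambda>a. g (frag_of a)) p"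
proof (induction p rule: frag_induct)
  case zero
  then show ?case using assms[of 0 0] by simp
qed (simp_all add: assms frag_extend_diff)

lemma frag_extend_single: "frag_extend frag_of p = p"
  using frag_expansion[of p] by simp

section \<open>The relations of the free quasi-Lie algebra\<close>

definition word_mult_left :: "'h word \<Rightarrow> ('h word \<Rightarrow>\<^sub>0 int) \<Rightarrow> ('h word \<Rightarrow>\<^sub>0 int)" where
  "word_mult_left s = frag_extend (\<lambda>t. frag_of (Bracket s t))"

definition word_mult_right :: "'h word \<Rightarrow> ('h word \<Rightarrow>\<^sub>0 int) \<Rightarrow> ('h word \<Rightarrow>\<^sub>0 int)" where
  "word_mult_right s = frag_extend (\<lambda>t. frag_of (Bracket t s))"

lemma word_mult_simps [simp]:
  "word_mult_left s 0 = 0" "word_mult_left s (frag_of t) = frag_of (Bracket s t)"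
  "word_mult_left s (p + q) = word_mult_left s p + word_mult_left s q"
  "word_mult_left s (p - q) = word_mult_left s p - word_mult_left s q"
  "word_mult_right s 0 = 0" "word_mult_right s (frag_of t) = frag_of (Bracket t s)"
  "word_mult_right s (p + q) = word_mult_right s p + word_mult_right s q"
  "word_mult_right s (p - q) = word_mult_right s p - word_mult_right s q"
  by (simp_all add: word_mult_left_def word_mult_right_def frag_extend_add frag_extend_diff)

lemma magma_mult_left: "magma_mult p q = frag_extend (\<lambda>s. word_mult_left s q) p"
  by (simp add: magma_mult_def word_mult_left_def)

lemma magma_mult_right: "magma_mult p q = frag_extend (\<lambda>t. word_mult_right t p) q"
  unfolding magma_mult_def word_mult_right_def by (rule frag_extend_swap)

lemma magma_mult_of_left: "magma_mult (frag_of s) q = word_mult_left s q"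
  by (simp add: magma_mult_left)

lemma magma_mult_of_right: "magma_mult p (frag_of t) = word_mult_right t p"
  by (simp add: magma_mult_right)

lemma magma_mult_diff_left: "magma_mult (p - p') q = magma_mult p q - magma_mult p' q"
  by (simp add: magma_mult_left frag_extend_diff)

lemma magma_mult_diff_right: "magma_mult p (q - q') = magma_mult p q - magma_mult p q'"
  by (simp add: magma_mult_right frag_extend_diff)

lemma word_degree_pos: "0 < word_degree t"
  by (induction t) auto

lemma words_simps [simp]:
  "Letter h \<in> words H \<longleftrightarrow> h \<in> carrier H"
  "Bracket s t \<in> words H \<longleftrightarrow> s \<in> words H \<and> t \<in> words H"
  by (auto simp: words_def)

lemma magma_mult_closed:
  "p \<in> carrier (magma_ring H) \<Longrightarrow> q \<in> carrier (magma_ring H) \<Longrightarrow>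
   magma_mult p q \<in> carrier (magma_ring H)"
  unfolding magma_mult_def
  by (intro additive_subset_frag_extend additive_subset_carrier) (auto simp: keys_frag_of)

text \<open>The same ideal with smaller rules: relations between words, and multiplication by one
  word at a time. Inductions then treat words instead of arbitrary ring elements;
  \<open>quasi_lie_ideal_eq\<close> identifies the two sets.\<close>

inductive_set word_relations :: "('h, 'm) monoid_scheme \<Rightarrow> ('h word \<Rightarrow>\<^sub>0 int) set"
  for H :: "('h, 'm) monoid_scheme" where
  letter: "\<lbrakk>g \<in> carrier H; h \<in> carrier H\<rbrakk> \<Longrightarrow>
     frag_of (Letter (g \<otimes>\<^bsub>H\<^esub> h)) - frag_of (Letter g) - frag_of (Letter h) \<in> word_relations H"
| antisym: "\<lbrakk>s \<in> words H; t \<in> words H\<rbrakk> \<Longrightarrow>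
     frag_of (Bracket s t) + frag_of (Bracket t s) \<in> word_relations H"
| jacobi: "\<lbrakk>s \<in> words H; t \<in> words H; u \<in> words H\<rbrakk> \<Longrightarrow>
     frag_of (Bracket (Bracket s t) u) + frag_of (Bracket (Bracket t u) s) +
     frag_of (Bracket (Bracket u s) t) \<in> word_relations H"
| zero: "0 \<in> word_relations H"
| diff: "\<lbrakk>p \<in> word_relations H; q \<in> word_relations H\<rbrakk> \<Longrightarrow> p - q \<in> word_relations H"
| left: "\<lbrakk>s \<in> words H; p \<in> word_relations H\<rbrakk> \<Longrightarrow> word_mult_left s p \<in> word_relations H"
| right: "\<lbrakk>s \<in> words H; p \<in> word_relations H\<rbrakk> \<Longrightarrow> word_mult_right s p \<in> word_relations H"

lemma additive_word_relations: "additive_subset (word_relations H)"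
  by (auto simp: additive_subset_def intro: word_relations.intros)

lemma word_relations_mult:
  assumes x: "x \<in> carrier (magma_ring H)" and p: "p \<in> word_relations H"
  shows "magma_mult x p \<in> word_relations H" "magma_mult p x \<in> word_relations H"
  unfolding magma_mult_left[of x] magma_mult_right[of p]
  using x by (auto intro!: additive_subset_frag_extend additive_word_relations
      word_relations.left[OF _ p] word_relations.right[OF _ p])

text \<open>All relations are multilinear, \<open>[x, y] + [y, x] = 0\<close> included, whereas
  \<open>[x, x] = 0\<close> would be quadratic. So the relations between words imply those between
  all elements.\<close>

lemma quasi_lie_ideal_eq:
  fixes H :: "('h, 'm) monoid_scheme" (structure)
  assumes "monoid H"
  shows "quasi_lie_ideal H = word_relations H"
proof
  have ext: "p \<in> word_relations H"
    if "p = frag_extend f x" "x \<in> carrier (magma_ring H)"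
      "\<And>s. s \<in> words H \<Longrightarrow> f s \<in> word_relations H" for p f x
    using that by (auto intro!: additive_subset_frag_extend additive_word_relations)
  show "quasi_lie_ideal H \<subseteq> word_relations H"
  proof
    fix p assume "p \<in> quasi_lie_ideal H"
    then show "p \<in> word_relations H"
    proof induction
      case (antisymmetry x y)
      have "word_mult_left s y + word_mult_right s y \<in> word_relations H"
        if s: "s \<in> words H" for s
        by (rule ext[OF _ antisymmetry(2), of _ "\<lambda>t. frag_of (Bracket s t) + frag_of (Bracket t s)"])
          (use s in \<open>auto simp: frag_extend_add_fun word_mult_left_def word_mult_right_def
            intro: word_relations.antisym\<close>)
      note * = this
      show ?case
        by (rule ext[OF _ antisymmetry(1), of _ "\<lambda>s. word_mult_left s y + word_mult_right s y"])
          (use * in \<open>auto simp: frag_extend_add_fun magma_mult_left[of x] magma_mult_right[of y x]\<close>)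
    next
      case (jacobi x y z)
      \<comment> \<open>The Jacobi expression is expanded in one argument after the other: first in
        \<open>z\<close> with words \<open>s\<close> and \<open>t\<close>, then in \<open>y\<close>,
        then in \<open>x\<close>.\<close>
      have 1: "magma_mult (word_mult_left s (frag_of t)) z + magma_mult (magma_mult (frag_of t) z) (frag_of s)
          + magma_mult (magma_mult z (frag_of s)) (frag_of t) \<in> word_relations H"
        if st: "s \<in> words H" "t \<in> words H" for s t
        by (rule ext[OF _ jacobi(3), of _ "\<lambda>u. frag_of (Bracket (Bracket s t) u) +
              frag_of (Bracket (Bracket t u) s) + frag_of (Bracket (Bracket u s) t)"])
          (use st in \<open>auto simp: frag_extend_add_fun magma_mult_of_left magma_mult_of_right
            word_mult_left_def word_mult_right_def frag_extend_frag_extend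
            intro: word_relations.jacobi\<close>)
      have 2: "magma_mult (word_mult_left s y) z + magma_mult (magma_mult y z) (frag_of s)
          + magma_mult (magma_mult z (frag_of s)) y \<in> word_relations H"
        if s: "s \<in> words H" for s
      proof (rule ext[OF _ jacobi(2), of _ "\<lambda>t. magma_mult (word_mult_left s (frag_of t)) z +
          magma_mult (magma_mult (frag_of t) z) (frag_of s) + magma_mult (magma_mult z (frag_of s)) (frag_of t)"])
        show "magma_mult (word_mult_left s y) z + magma_mult (magma_mult y z) (frag_of s)
          + magma_mult (magma_mult z (frag_of s)) y = frag_extend (\<lambda>t. magma_mult (word_mult_left s (frag_of t)) z +
          magma_mult (magma_mult (frag_of t) z) (frag_of s) + magma_mult (magma_mult z (frag_of s)) (frag_of t)) y"
          by (rule additive_eq_frag_extend) (simp add: magma_mult_diff_left magma_mult_diff_right algebra_simps)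
      qed (use 1 s in auto)
      show ?case
      proof (rule ext[OF _ jacobi(1), of _ "\<lambda>s. magma_mult (word_mult_left s y) z +
          magma_mult (magma_mult y z) (frag_of s) + magma_mult (magma_mult z (frag_of s)) y"])
        show "magma_mult (magma_mult x y) z + magma_mult (magma_mult y z) x + magma_mult (magma_mult z x) y
          = frag_extend (\<lambda>s. magma_mult (word_mult_left s y) z +
          magma_mult (magma_mult y z) (frag_of s) + magma_mult (magma_mult z (frag_of s)) y) x"
          unfolding magma_mult_of_left[symmetric]
          by (rule additive_eq_frag_extend) (simp add: magma_mult_diff_left magma_mult_diff_right algebra_simps)
      qed (use 2 in auto)
    qed (auto intro: word_relations.intros word_relations_mult)
  qed
  show "word_relations H \<subseteq> quasi_lie_ideal H"
  proof
    fix p assume "p \<in> word_relations H"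
    then show "p \<in> quasi_lie_ideal H"
    proof induction
      case (antisym s t)
      then show ?case
        using quasi_lie_ideal.antisymmetry[of "frag_of s" H "frag_of t"]
        by (simp add: magma_mult_of_left)
    next
      case (jacobi s t u)
      then show ?case
        using quasi_lie_ideal.jacobi[of "frag_of s" H "frag_of t" "frag_of u"]
        by (simp add: magma_mult_of_left)
    next
      case (left s p)
      then show ?case
        using quasi_lie_ideal.mult_left[of "frag_of s" H p] by (simp add: magma_mult_of_left)
    next
      case (right s p)
      then show ?case
        using quasi_lie_ideal.mult_right[of p H "frag_of s"] by (simp add: magma_mult_of_right)
    qed (auto intro: quasi_lie_ideal.intros)
  qed
qed

lemma word_relations_carrier:
  assumes "monoid H"
  shows "word_relations H \<subseteq> carrier (magma_ring H)"
proof
  fix p assume "p \<in> word_relations H"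
  then show "p \<in> carrier (magma_ring H)"
  proof induction
    case (letter g h)
    then show ?case
      using monoid.m_closed[OF assms]
      by (intro additive_subset_diff[OF additive_subset_carrier]) simp_all
  next
    case (antisym s t)
    then show ?case
      by (intro additive_subset_add[OF additive_subset_carrier]) simp_all
  next
    case (jacobi s t u)
    then show ?case
      by (intro additive_subset_add[OF additive_subset_carrier]) simp_all
  next
    case (diff p q)
    then show ?case
      using additive_subset_diff[OF additive_subset_carrier] by blast
  next
    case (left s p)
    then show ?case
      using magma_mult_closed[of "frag_of s" H p] by (simp add: magma_mult_of_left)
  next
    case (right s p)
    then show ?case
      using magma_mult_closed[of p H "frag_of s"] by (simp add: magma_mult_of_right)
  qed simp
qed

section \<open>The grading of the ideal of relations\<close>

definition homogeneous_part :: "nat \<Rightarrow> ('h word \<Rightarrow>\<^sub>0 int) \<Rightarrow> ('h word \<Rightarrow>\<^sub>0 int)" where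
  "homogeneous_part n = frag_extend (\<lambda>t. if word_degree t = n then frag_of t else 0)"

lemma homogeneous_part_simps [simp]:
  "homogeneous_part n 0 = 0"
  "homogeneous_part n (frag_of t) = (if word_degree t = n then frag_of t else 0)"
  "homogeneous_part n (p + q) = homogeneous_part n p + homogeneous_part n q"
  "homogeneous_part n (p - q) = homogeneous_part n p - homogeneous_part n q"
  by (simp_all add: homogeneous_part_def frag_extend_add frag_extend_diff)

lemma homogeneous_part_word_mult:
  "homogeneous_part n (word_mult_left s p) =
    (if word_degree s \<le> n then word_mult_left s (homogeneous_part (n - word_degree s) p) else 0)"
  "homogeneous_part n (word_mult_right s p) =
    (if word_degree s \<le> n then word_mult_right s (homogeneous_part (n - word_degree s) p) else 0)"
proof -
  show "homogeneous_part n (word_mult_left s p) =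
    (if word_degree s \<le> n then word_mult_left s (homogeneous_part (n - word_degree s) p) else 0)"
    by (induction p rule: frag_induct) auto
  show "homogeneous_part n (word_mult_right s p) =
    (if word_degree s \<le> n then word_mult_right s (homogeneous_part (n - word_degree s) p) else 0)"
    by (induction p rule: frag_induct) auto
qed

text \<open>Each generating relation is homogeneous and multiplication by a word shifts the degree,
  so the ideal is graded. \<open>F_right\<close> uses this to cut a relation down to degree
  \<open>k + 1\<close>.\<close>

lemma homogeneous_part_relations:
  "p \<in> word_relations H \<Longrightarrow> homogeneous_part n p \<in> word_relations H"
proof (induction arbitrary: n rule: word_relations.induct)
  case (letter g h)
  then show ?case by (auto intro: word_relations.intros)
next
  case (antisym s t)
  then show ?case
    by (cases "word_degree s + word_degree t = n") (auto simp: add.commute intro: word_relations.intros)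
next
  case (jacobi s t u)
  show ?case
    using word_relations.jacobi[OF jacobi]
    by (cases "word_degree s + word_degree t + word_degree u = n")
      (simp_all add: ac_simps word_relations.zero)
qed (auto simp: homogeneous_part_word_mult intro: word_relations.intros)

section \<open>The free associative ring\<close>

text \<open>A copy of lists with concatenation as \<open>+\<close>: the convolution product of
  finitely supported functions on it is the product of the free associative ring.\<close>

datatype 'a monomial = Monomial "'a list"

instantiation monomial :: (type) monoid_add
begin

definition zero_monomial :: "'a monomial" where
  "zero_monomial = Monomial []"

fun plus_monomial :: "'a monomial \<Rightarrow> 'a monomial \<Rightarrow> 'a monomial" where
  "plus_monomial (Monomial x) (Monomial y) = Monomial (x @ y)"

instance
proof
  fix a b c :: "'a monomial"
  show "a + b + c = a + (b + c)" by (cases a; cases b; cases c) simp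
  show "0 + a = a" "a + 0 = a" by (cases a; simp add: zero_monomial_def)+
qed

end

primrec commutator :: "('h \<Rightarrow> 'r::ring) \<Rightarrow> 'h word \<Rightarrow> 'r" where
  "commutator \<kappa> (Letter h) = \<kappa> h"
| "commutator \<kappa> (Bracket s t) =
    commutator \<kappa> s * commutator \<kappa> t - commutator \<kappa> t * commutator \<kappa> s"

lemma commutator_cong:
  "(\<And>h. h \<in> set_word t \<Longrightarrow> \<kappa> h = \<kappa>' h) \<Longrightarrow> commutator \<kappa> t = commutator \<kappa>' t"
  by (induction t) auto

lemma frag_extend_commutator_mult:
  fixes \<kappa> :: "'h \<Rightarrow> ('a::monoid_add \<Rightarrow>\<^sub>0 int)"
  shows "frag_extend (commutator \<kappa>) (word_mult_left s p) =
      commutator \<kappa> s * frag_extend (commutator \<kappa>) p - frag_extend (commutator \<kappa>) p * commutator \<kappa> s"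
    and "frag_extend (commutator \<kappa>) (word_mult_right s p) =
      frag_extend (commutator \<kappa>) p * commutator \<kappa> s - commutator \<kappa> s * frag_extend (commutator \<kappa>) p"
proof -
  show "frag_extend (commutator \<kappa>) (word_mult_left s p) =
      commutator \<kappa> s * frag_extend (commutator \<kappa>) p - frag_extend (commutator \<kappa>) p * commutator \<kappa> s"
    by (induction p rule: frag_induct)
      (simp_all add: frag_extend_diff, simp (no_asm) add: algebra_simps)
  show "frag_extend (commutator \<kappa>) (word_mult_right s p) =
      frag_extend (commutator \<kappa>) p * commutator \<kappa> s - commutator \<kappa> s * frag_extend (commutator \<kappa>) p"
    by (induction p rule: frag_induct)
      (simp_all add: frag_extend_diff, simp (no_asm) add: algebra_simps)
qed

text \<open>In an associative ring the commutator is a Lie bracket, so \<open>commutator\<close>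
  descends to L'. It also kills \<open>[x, x]\<close>, which need not vanish in L';
  \<open>commutator_kernel\<close> bounds what it kills.\<close>

lemma commutator_relations:
  fixes H (structure) and \<kappa> :: "'h \<Rightarrow> ('a::monoid_add \<Rightarrow>\<^sub>0 int)"
  assumes "\<And>g h. g \<in> carrier H \<Longrightarrow> h \<in> carrier H \<Longrightarrow> \<kappa> (g \<otimes> h) = \<kappa> g + \<kappa> h"
    and "p \<in> word_relations H"
  shows "frag_extend (commutator \<kappa>) p = 0"
  using assms(2)
proof induction
  case (letter g h)
  then show ?case by (simp add: frag_extend_diff assms(1))
qed (simp_all add: frag_extend_diff frag_extend_add frag_extend_commutator_mult algebra_simps)

section \<open>Lyndon trees\<close>

primrec foliage :: "'h word \<Rightarrow> 'h list" where
  "foliage (Letter h) = [h]"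
| "foliage (Bracket s t) = foliage s @ foliage t"

lemma length_foliage: "length (foliage t) = word_degree t"
  by (induction t) auto

lemma foliage_nonempty [simp]: "foliage t \<noteq> []"
  by (induction t) auto

lemma lexord_elim [consumes 1, case_names prefix differ]:
  assumes "(x, y) \<in> lexord r"
  obtains a z where "y = x @ a # z" | w a b u v where "x = w @ a # u" "y = w @ b # v" "(a, b) \<in> r"
  using assms unfolding lexord_def by blast

text \<open>On lists of all lengths the order is not well founded: for letters \<open>a\<close>
  below \<open>b\<close> the lists \<open>b\<close>, \<open>ab\<close>, \<open>aab\<close>, ...
  descend forever. With bounded length, splitting off the head lowers the bound.\<close>

lemma wf_lexord_bounded:
  assumes "wf r"
  shows "wf {(x, y). (x, y) \<in> lexord r \<and> length x \<le> n \<and> length y \<le> n}"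
proof (induction n)
  case 0
  have "{(x, y). (x, y) \<in> lexord r \<and> length x \<le> 0 \<and> length y \<le> 0} = {}"
    by auto
  then show ?case by (simp add: wf_def)
next
  case (Suc n)
  let ?R = "{(x, y). (x, y) \<in> lexord r \<and> length x \<le> n \<and> length y \<le> n}"
  let ?f = "\<lambda>x. (if x = [] then 0 else Suc 0, hd x, tl x)"
  have "wf (inv_image (less_than <*lex*> r <*lex*> ?R) ?f)"
    using Suc.IH assms by (intro wf_inv_image wf_lex_prod) auto
  moreover have "{(x, y). (x, y) \<in> lexord r \<and> length x \<le> Suc n \<and> length y \<le> Suc n}
      \<subseteq> inv_image (less_than <*lex*> r <*lex*> ?R) ?f"
  proof clarify
    fix x y assume xy: "(x, y) \<in> lexord r" "length x \<le> Suc n" "length y \<le> Suc n"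
    then show "(x, y) \<in> inv_image (less_than <*lex*> r <*lex*> ?R) ?f"
      by (cases x; cases y) (auto simp: in_inv_image)
  qed
  ultimately show ?case by (rule wf_subset)
qed

text \<open>The alphabet may be infinite and the inductions below descend lexicographically, hence a
  well-order of the letters and not merely a linear one.\<close>

locale lyndon_order =
  fixes r :: "('h \<times> 'h) set"
  assumes wf_r: "wf r" and trans_r: "trans r" and total_r: "total r"
begin

abbreviation lex_less (infix "\<prec>\<^sub>L" 50) where
  "x \<prec>\<^sub>L y \<equiv> (x, y) \<in> lexord r"

lemma irrefl_r: "(a, a) \<notin> r"
  using wf_r by simp

lemma lex_irrefl: "\<not> x \<prec>\<^sub>L x"
  by (rule lexord_irreflexive) (simp add: irrefl_r)

lemma lex_trans: "x \<prec>\<^sub>L y \<Longrightarrow> y \<prec>\<^sub>L z \<Longrightarrow> x \<prec>\<^sub>L z"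
  using lexord_trans trans_r by blast

lemma lex_asym: "x \<prec>\<^sub>L y \<Longrightarrow> \<not> y \<prec>\<^sub>L x"
  using lex_trans lex_irrefl by blast

lemma lex_total: "x \<prec>\<^sub>L y \<or> x = y \<or> y \<prec>\<^sub>L x"
  using total_lexord[OF total_r] by (auto simp: total_on_def)

lemma lex_append: "y \<noteq> [] \<Longrightarrow> x \<prec>\<^sub>L x @ y"
  by (rule lexord_append_rightI) (auto simp: neq_Nil_conv)

text \<open>The last condition selects the standard bracketing of a Lyndon word, where the right
  factor is the least proper suffix; so a Lyndon word carries a single tree
  (\<open>foliage_inj\<close>).\<close>

inductive lyndon :: "'h word \<Rightarrow> bool" where
  lyndon_Letter: "lyndon (Letter h)"
| lyndon_Bracket: "\<lbrakk>lyndon s; lyndon t; foliage s \<prec>\<^sub>L foliage t;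
     \<And>s1 s2. s = Bracket s1 s2 \<Longrightarrow> \<not> foliage s2 \<prec>\<^sub>L foliage t\<rbrakk> \<Longrightarrow> lyndon (Bracket s t)"

text \<open>The two claims are proved together. A proper suffix that reaches into \<open>s\<close>
  exceeds a suffix of \<open>s\<close>, which is at least the right factor of \<open>s\<close> and
  hence at least \<open>foliage t\<close>; so no proper suffix is below \<open>foliage t\<close>. As
  the whole word is below \<open>foliage t\<close>, it is below every proper suffix.\<close>

lemma lyndon_suffix:
  assumes "lyndon t" "foliage t = x @ y" "x \<noteq> []" "y \<noteq> []"
  shows "foliage t \<prec>\<^sub>L y \<and> (\<forall>a b. t = Bracket a b \<longrightarrow> \<not> y \<prec>\<^sub>L foliage b)"
  using assms
proof (induction t arbitrary: x y rule: lyndon.induct)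
  case (lyndon_Letter h)
  then show ?case by (cases x) auto
next
  case (lyndon_Bracket s t)
  let ?u = "foliage s" and ?v = "foliage t"
  \<comment> \<open>If \<open>?v\<close> extends \<open>?u\<close>, its remaining part is a proper
    suffix of \<open>?v\<close> and therefore larger than \<open>?v\<close>; prepend
    \<open>?u\<close> to both. Otherwise the lists differ at a letter, and appending does not
    matter.\<close>
  have uv: "?u @ ?v \<prec>\<^sub>L ?v"
    using lyndon_Bracket.hyps(3)
  proof (cases rule: lexord_elim)
    case (prefix a z)
    then have "?v \<prec>\<^sub>L a # z" using lyndon_Bracket.IH(2)[of ?u "a # z"] by simp
    then have "?u @ ?v \<prec>\<^sub>L ?u @ a # z" by (rule lexord_append_leftI)
    then show ?thesis using prefix by simp
  next
    case (differ w a b u' v')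
    then have "?u @ ?v = w @ a # (u' @ ?v)" by simp
    then show ?thesis
      using differ(2,3) by (metis lexord_append_left_rightI)
  qed
  have y: "\<not> y \<prec>\<^sub>L ?v"
  proof -
    from lyndon_Bracket.prems(1) consider us where "x = ?u @ us" "?v = us @ y"
      | us where "?u = x @ us" "y = us @ ?v" "us \<noteq> []"
      by (force simp: append_eq_append_conv2)
    then show ?thesis
    proof cases
      case (1 us)
      then show ?thesis
        using lyndon_Bracket.IH(2)[of us y] lyndon_Bracket.prems lex_asym lex_irrefl
        by (cases "us = []") auto
    next
      case (2 us)
      then obtain s1 s2 where s: "s = Bracket s1 s2"
        using lyndon_Bracket.prems(2) by (cases s) (auto simp: append_eq_Cons_conv Cons_eq_append_conv)
      have "\<not> us \<prec>\<^sub>L foliage s2"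
        using lyndon_Bracket.IH(1)[OF 2(1)] lyndon_Bracket.prems 2 s by blast
      moreover have "\<not> foliage s2 \<prec>\<^sub>L ?v"
        using lyndon_Bracket.hyps(4) s by blast
      moreover have "us \<prec>\<^sub>L y"
        using 2 lex_append by simp
      ultimately show ?thesis
        using lex_trans lex_total by blast
    qed
  qed
  have "?u @ ?v \<prec>\<^sub>L y"
    using uv y lex_total[of y ?v] lex_trans by blast
  then show ?case using y by simp
qed

lemma lyndon_Bracket_less:
  assumes "lyndon (Bracket s t)"
  shows "foliage (Bracket s t) \<prec>\<^sub>L foliage t"
  using lyndon_suffix[OF assms, of "foliage s" "foliage t"] by simp

text \<open>By \<open>lyndon_suffix\<close> the foliage of the right factor is the least proper
  suffix, so the foliage alone determines where it is cut.\<close>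

lemma foliage_inj:
  "lyndon s \<Longrightarrow> lyndon t \<Longrightarrow> foliage s = foliage t \<Longrightarrow> s = t"
proof (induction s arbitrary: t rule: lyndon.induct)
  case (lyndon_Letter h)
  then show ?case by (cases t) (auto simp: Cons_eq_append_conv)
next
  case (lyndon_Bracket a b)
  obtain a' b' where t: "t = Bracket a' b'"
    using lyndon_Bracket.prems(2) by (cases t) (auto simp: append_eq_Cons_conv)
  have s: "lyndon (Bracket a b)"
    using lyndon_Bracket.hyps by (rule lyndon.lyndon_Bracket)
  have "\<not> foliage b' \<prec>\<^sub>L foliage b"
    using lyndon_suffix[OF s, of "foliage a'" "foliage b'"] lyndon_Bracket.prems(2) t by auto
  moreover have "\<not> foliage b \<prec>\<^sub>L foliage b'"
    using lyndon_suffix[OF lyndon_Bracket.prems(1), of "foliage a" "foliage b"]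
      lyndon_Bracket.prems(2) t by auto
  ultimately have b: "foliage b = foliage b'" using lex_total by blast
  then have "foliage a = foliage a'" using lyndon_Bracket.prems(2) t by simp
  moreover have "lyndon a'" "lyndon b'"
    using lyndon_Bracket.prems(1) t by (auto elim: lyndon.cases)
  ultimately show ?case using b lyndon_Bracket.IH t by blast
qed

section \<open>Leading terms of the commutators of Lyndon trees\<close>

abbreviation letter_poly :: "'h \<Rightarrow> ('h monomial \<Rightarrow>\<^sub>0 int)" where
  "letter_poly h \<equiv> frag_of (Monomial [h])"

text \<open>Equal length excludes that \<open>u\<close> is a prefix of \<open>x\<close>. The two
  then differ at a letter, and the inequality survives multiplication on the right by
  anything.\<close>

definition greater_polys :: "'h list \<Rightarrow> ('h monomial \<Rightarrow>\<^sub>0 int) set" where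
  "greater_polys u = carrier (free_Abelian_group {Monomial x | x. length x = length u \<and> u \<prec>\<^sub>L x})"

lemma additive_greater_polys: "additive_subset (greater_polys u)"
  unfolding greater_polys_def by (rule additive_subset_carrier)

lemma greater_polys_mult:
  assumes "a \<in> greater_polys u" "b \<in> greater_polys v"
  shows "a * b \<in> greater_polys (u @ v)" "frag_of (Monomial u) * b \<in> greater_polys (u @ v)"
    "a * frag_of (Monomial v) \<in> greater_polys (u @ v)"
proof -
  have *: "p * q \<in> greater_polys (u @ v)"
    if "Poly_Mapping.keys p \<subseteq> {Monomial x | x. length x = length u \<and> (x = u \<or> u \<prec>\<^sub>L x)}"
      "Poly_Mapping.keys q \<subseteq> {Monomial x | x. length x = length v \<and> (x = v \<or> v \<prec>\<^sub>L x)}"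
      "Poly_Mapping.keys p \<subseteq> {Monomial x | x. u \<prec>\<^sub>L x} \<or> Poly_Mapping.keys q \<subseteq> {Monomial x | x. v \<prec>\<^sub>L x}"
    for p q
  proof -
    have "k \<in> {Monomial x | x. length x = length (u @ v) \<and> u @ v \<prec>\<^sub>L x}"
      if "k \<in> Poly_Mapping.keys (p * q)" for k
    proof -
      from that keys_mult obtain k1 k2 where k: "k = k1 + k2" "k1 \<in> Poly_Mapping.keys p"
        "k2 \<in> Poly_Mapping.keys q" by blast
      then obtain x y where x: "k1 = Monomial x" "length x = length u" "x = u \<or> u \<prec>\<^sub>L x"
        and y: "k2 = Monomial y" "length y = length v" "y = v \<or> v \<prec>\<^sub>L y"
        using \<open>Poly_Mapping.keys p \<subseteq> {Monomial x | x. length x = length u \<and> (x = u \<or> u \<prec>\<^sub>L x)}\<close>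
          \<open>Poly_Mapping.keys q \<subseteq> {Monomial x | x. length x = length v \<and> (x = v \<or> v \<prec>\<^sub>L x)}\<close>
        by blast
      have "u \<prec>\<^sub>L x \<or> v \<prec>\<^sub>L y"
        using k x(1) y(1) \<open>_ \<or> _ \<subseteq> _\<close> by blast
      then have "u @ v \<prec>\<^sub>L x @ y"
        using x y lexord_sufI[of u x r v y] lexord_append_leftI[of v y r u] by auto
      then show ?thesis using k x y by auto
    qed
    then show ?thesis by (auto simp: greater_polys_def)
  qed
  have a: "Poly_Mapping.keys a \<subseteq> {Monomial x | x. length x = length u \<and> u \<prec>\<^sub>L x}"
    and b: "Poly_Mapping.keys b \<subseteq> {Monomial x | x. length x = length v \<and> v \<prec>\<^sub>L x}"
    using assms by (simp_all add: greater_polys_def)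
  show "a * b \<in> greater_polys (u @ v)"
    by (rule *) (use a b in blast)+
  show "frag_of (Monomial u) * b \<in> greater_polys (u @ v)"
    by (rule *) (use b in \<open>auto simp: keys_frag_of\<close>)
  show "a * frag_of (Monomial v) \<in> greater_polys (u @ v)"
    by (rule *) (use a in \<open>auto simp: keys_frag_of\<close>)
qed

text \<open>With leading words \<open>u\<close> and \<open>v\<close> of the factors, the two
  products of the commutator lead with \<open>u @ v\<close> and \<open>v @ u\<close>, and the first
  is the smaller one; so it cannot cancel.\<close>

lemma lyndon_leading_term:
  "lyndon t \<Longrightarrow> commutator letter_poly t - frag_of (Monomial (foliage t)) \<in> greater_polys (foliage t)"
proof (induction rule: lyndon.induct)
  case (lyndon_Letter h)
  then show ?case using additive_subset_zero[OF additive_greater_polys] by simp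
next
  case (lyndon_Bracket s t)
  define u v R S where "u = foliage s" and "v = foliage t"
    and "R = commutator letter_poly s - frag_of (Monomial u)"
    and "S = commutator letter_poly t - frag_of (Monomial v)"
  have R: "R \<in> greater_polys u" and S: "S \<in> greater_polys v"
    using lyndon_Bracket.IH by (simp_all add: R_def S_def u_def v_def)
  have "u @ v \<prec>\<^sub>L v"
    using lyndon_Bracket_less[OF lyndon.lyndon_Bracket[OF lyndon_Bracket.hyps]]
    by (simp add: u_def v_def)
  \<comment> \<open>\<open>v\<close> is shorter than \<open>u @ v\<close>, so these two differ at a
    letter and the comparison persists when \<open>u\<close> is appended to
    \<open>v\<close>.\<close>
  then have less: "u @ v \<prec>\<^sub>L v @ u"
  proof (cases rule: lexord_elim)
    case (prefix a z)
    then have "length v = length ((u @ v) @ a # z)" by simp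
    then show ?thesis by simp
  next
    case (differ w a b u' v')
    then have "v @ u = w @ b # (v' @ u)" by simp
    then show ?thesis
      using differ(1,3) by (metis lexord_append_left_rightI)
  qed
  then have swap: "p \<in> greater_polys (u @ v)" if "p \<in> greater_polys (v @ u)" for p
    using that lex_trans[OF less] by (auto simp: greater_polys_def)
  have vu: "frag_of (Monomial (v @ u)) \<in> greater_polys (u @ v)"
    using less by (auto simp: greater_polys_def keys_frag_of)
  note clos = additive_subset_add[OF additive_greater_polys] additive_subset_diff[OF additive_greater_polys]
  have mono: "frag_of (Monomial x) * frag_of (Monomial y) = frag_of (Monomial (x @ y))" for x y :: "'h list"
    by (simp add: mult_single)
  have cs: "commutator letter_poly s = frag_of (Monomial u) + R"
    and ct: "commutator letter_poly t = frag_of (Monomial v) + S"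
    by (simp_all add: R_def S_def)
  have eq: "commutator letter_poly (Bracket s t) - frag_of (Monomial (u @ v)) =
      (frag_of (Monomial u) * S + R * frag_of (Monomial v) + R * S) -
      (frag_of (Monomial (v @ u)) + (frag_of (Monomial v) * R + S * frag_of (Monomial u) + S * R))"
    by (simp only: commutator.simps cs ct mono[symmetric]) (simp add: algebra_simps)
  have rest: "frag_of (Monomial v) * R + S * frag_of (Monomial u) + S * R \<in> greater_polys (u @ v)"
    by (intro clos swap greater_polys_mult[OF S R])
  note gp = greater_polys_mult[OF R S]
  show ?case
    unfolding foliage.simps u_def[symmetric] v_def[symmetric] eq
    by (rule clos(2)[OF clos(1)[OF clos(1)[OF gp(2,3)] gp(1)] clos(1)[OF vu rest]])
qed

text \<open>Triangularity: among the trees that occur, the one with the least foliage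
  \<open>v\<close> is alone in contributing to the monomial \<open>v\<close>, and it does so with
  coefficient one.\<close>

lemma lyndon_independent:
  assumes q: "Poly_Mapping.keys q \<subseteq> {t. lyndon t \<and> word_degree t = n}"
    and zero: "frag_extend (commutator letter_poly) q = 0"
  shows "q = 0"
proof (rule ccontr)
  assume "q \<noteq> 0"
  then have ne: "foliage ` Poly_Mapping.keys q \<noteq> {}" by simp
  obtain v where v: "v \<in> foliage ` Poly_Mapping.keys q"
    and min: "\<And>w. (w, v) \<in> {(x, y). x \<prec>\<^sub>L y \<and> length x \<le> n \<and> length y \<le> n} \<Longrightarrow>
      w \<notin> foliage ` Poly_Mapping.keys q"
    using wfE_min'[OF wf_lexord_bounded[OF wf_r, of n] ne] by blast
  then obtain t where t: "t \<in> Poly_Mapping.keys q" "v = foliage t" by blast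
  have "Poly_Mapping.lookup (commutator letter_poly u) (Monomial v) = (if u = t then 1 else 0)"
    if u: "u \<in> Poly_Mapping.keys q" for u
  proof -
    have ly: "lyndon u" "lyndon t" "word_degree u = n" "word_degree t = n" using u t q by auto
    have "\<not> foliage u \<prec>\<^sub>L v"
      using min[of "foliage u"] u t ly by (auto simp: length_foliage)
    then have "Monomial v \<notin> Poly_Mapping.keys (commutator letter_poly u - frag_of (Monomial (foliage u)))"
      using lyndon_leading_term[OF ly(1)] by (auto simp: greater_polys_def)
    then have "Poly_Mapping.lookup (commutator letter_poly u) (Monomial v) =
        Poly_Mapping.lookup (frag_of (Monomial (foliage u))) (Monomial v)"
      by (simp add: in_keys_iff lookup_minus)
    then show ?thesis
      using foliage_inj[OF ly(1,2)] t by auto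
  qed
  then have "Poly_Mapping.lookup (frag_extend (commutator letter_poly) q) (Monomial v) =
      (\<Sum>u\<in>Poly_Mapping.keys q. Poly_Mapping.lookup q u * (if u = t then 1 else 0))"
    unfolding frag_extend_def lookup_sum by simp
  also have "\<dots> = Poly_Mapping.lookup q t"
    using t(1) by (simp add: sum.delta if_distrib cong: if_cong)
  finally show False
    using zero t(1) by (simp add: in_keys_iff)
qed

end

section \<open>Lyndon trees span the free quasi-Lie algebra up to squares\<close>

text \<open>
  The squares \<open>[x, x]\<close> of a quasi-Lie algebra have order two and are central, and they only occur
  in even degrees.
\<close>

definition square_part :: "('h, 'm) monoid_scheme \<Rightarrow> nat \<Rightarrow> ('h word \<Rightarrow>\<^sub>0 int) set" where
  "square_part H n = {z. frag_cmul 2 z \<in> word_relations H \<and>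
     (\<forall>s\<in>words H. word_mult_left s z \<in> word_relations H \<and> word_mult_right s z \<in> word_relations H) \<and>
     (odd n \<longrightarrow> z \<in> word_relations H)}"

lemma frag_cmul_diff_distrib2: "frag_cmul c (a - b) = frag_cmul c a - frag_cmul c b"
  by (metis (no_types, lifting) add_diff_cancel_right' diff_add_cancel frag_cmul_distrib2)

lemma additive_square_part: "additive_subset (square_part H n)"
  using additive_word_relations[of H]
  by (auto simp: additive_subset_def square_part_def frag_cmul_diff_distrib2)

lemma relations_square_part: "p \<in> word_relations H \<Longrightarrow> p \<in> square_part H n"
  by (auto simp: square_part_def additive_subset_cmul[OF additive_word_relations]
      intro: word_relations.intros)

text \<open>Jacobi for \<open>t\<close>, \<open>t\<close>, \<open>u\<close> reads
  \<open>[[t, t], u] + [[t, u], t] + [[u, t], t] = 0\<close>, and the last two terms cancel by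
  antisymmetry. \<open>square_part\<close> records just the properties of squares that the spanning
  argument relies on; the clause for odd degree holds here because the degree is even.\<close>

lemma square_in_square_part:
  assumes t: "t \<in> words H"
  shows "frag_of (Bracket t t) \<in> square_part H (word_degree t + word_degree t)"
proof -
  note add = additive_subset_add[OF additive_word_relations[of H]]
    and diff = additive_subset_diff[OF additive_word_relations[of H]]
  have right: "frag_of (Bracket (Bracket t t) u) \<in> word_relations H" if u: "u \<in> words H" for u
  proof -
    have "word_mult_right t (frag_of (Bracket t u) + frag_of (Bracket u t)) \<in> word_relations H"
      using t u by (intro word_relations.right word_relations.antisym)
    from diff[OF word_relations.jacobi[OF t t u] this] show ?thesis by simp
  qed
  have "frag_of (Bracket u (Bracket t t)) \<in> word_relations H" if u: "u \<in> words H" for u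
    using diff[OF word_relations.antisym[of "Bracket t t" H u] right[OF u]] t u by simp
  moreover have "frag_cmul 2 (frag_of (Bracket t t)) = frag_of (Bracket t t) + frag_of (Bracket t t)"
    using frag_cmul_distrib[of 1 1 "frag_of (Bracket t t)"] by simp
  ultimately show ?thesis
    using right word_relations.antisym[OF t t] by (auto simp: square_part_def)
qed

text \<open>\<open>E\<close> is a basis of \<open>H\<close> inside \<open>H\<close>, so that words
  in basis elements are words over \<open>H\<close>, and \<open>\<kappa>\<close> gives the
  coordinates. The last assumption ties the coordinates to the additivity of letters.\<close>

locale based_group = lyndon_order r for r :: "('h \<times> 'h) set" +
  fixes H :: "('h, 'm) monoid_scheme" (structure) and E :: "'h set"
    and \<kappa> :: "'h \<Rightarrow> ('h \<Rightarrow>\<^sub>0 int)"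
  assumes basis_closed: "E \<subseteq> carrier H"
    and coords_mult: "\<And>g h. g \<in> carrier H \<Longrightarrow> h \<in> carrier H \<Longrightarrow> \<kappa> (g \<otimes> h) = \<kappa> g + \<kappa> h"
    and coords_basis: "\<And>e. e \<in> E \<Longrightarrow> \<kappa> e = frag_of e"
    and coords_keys: "\<And>h. h \<in> carrier H \<Longrightarrow> Poly_Mapping.keys (\<kappa> h) \<subseteq> E"
    and letter_expand: "\<And>h. h \<in> carrier H \<Longrightarrow>
      frag_of (Letter h) - frag_extend (\<lambda>e. frag_of (Letter e)) (\<kappa> h) \<in> word_relations H"
begin

definition lyndon_basis :: "nat \<Rightarrow> 'h word set" where
  "lyndon_basis n = {t. lyndon t \<and> set_word t \<subseteq> E \<and> word_degree t = n}"

definition lyndon_below :: "nat \<Rightarrow> 'h list \<Rightarrow> 'h word set" where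
  "lyndon_below n v = {t \<in> lyndon_basis n. foliage t \<prec>\<^sub>L v}"

definition span :: "nat \<Rightarrow> 'h word set \<Rightarrow> ('h word \<Rightarrow>\<^sub>0 int) set" where
  "span n A = {p. \<exists>q. Poly_Mapping.keys q \<subseteq> A \<and> p - q \<in> square_part H n}"

lemma additive_span: "additive_subset (span n A)"
  unfolding additive_subset_def
proof (intro conjI ballI)
  show "0 \<in> span n A"
    unfolding span_def using additive_subset_zero[OF additive_square_part] by (auto intro!: exI[of _ 0])
  fix p p' assume "p \<in> span n A" "p' \<in> span n A"
  then obtain q q' where q: "Poly_Mapping.keys q \<subseteq> A" "Poly_Mapping.keys q' \<subseteq> A"
    "p - q \<in> square_part H n" "p' - q' \<in> square_part H n"
    by (auto simp: span_def)
  have "(p - p') - (q - q') = (p - q) - (p' - q')" by simp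
  then have "(p - p') - (q - q') \<in> square_part H n"
    using additive_subset_diff[OF additive_square_part] q by metis
  moreover have "Poly_Mapping.keys (q - q') \<subseteq> A"
    using keys_diff[of q q'] q(1,2) by blast
  ultimately show "p - p' \<in> span n A"
    unfolding span_def by (intro CollectI exI[of _ "q - q'"] conjI)
qed

lemma span_square_part: "p \<in> square_part H n \<Longrightarrow> p \<in> span n A"
  unfolding span_def by (auto intro!: exI[of _ 0])

lemma span_relations: "p \<in> word_relations H \<Longrightarrow> p \<in> span n A"
  by (intro span_square_part relations_square_part)

lemma span_gen: "t \<in> A \<Longrightarrow> frag_of t \<in> span n A"
  unfolding span_def using additive_subset_zero[OF additive_square_part]
  by (auto intro!: exI[of _ "frag_of t"] simp: keys_frag_of)

lemma span_mono: "p \<in> span n A \<Longrightarrow> A \<subseteq> A' \<Longrightarrow> p \<in> span n A'"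
  unfolding span_def by blast

text \<open>The error term is in the square part, which multiplication by a word turns into
  relations; so it fits any degree \<open>n\<close> of the result.\<close>

lemma span_bracket:
  assumes p: "p \<in> span m A" and s: "s \<in> words H"
  shows "(\<And>u. u \<in> A \<Longrightarrow> frag_of (Bracket u s) \<in> span n A') \<Longrightarrow> word_mult_right s p \<in> span n A'"
    and "(\<And>u. u \<in> A \<Longrightarrow> frag_of (Bracket s u) \<in> span n A') \<Longrightarrow> word_mult_left s p \<in> span n A'"
proof -
  obtain q where q: "Poly_Mapping.keys q \<subseteq> A" "p - q \<in> square_part H m"
    using p by (auto simp: span_def)
  have z: "word_mult_right s (p - q) \<in> span n A'" "word_mult_left s (p - q) \<in> span n A'"
    using q(2) s by (auto simp: square_part_def simp del: word_mult_simps intro!: span_relations)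
  {
    assume *: "\<And>u. u \<in> A \<Longrightarrow> frag_of (Bracket u s) \<in> span n A'"
    have "word_mult_right s q \<in> span n A'"
      unfolding word_mult_right_def
      by (rule additive_subset_frag_extend[OF additive_span]) (use * q(1) in blast)
    then show "word_mult_right s p \<in> span n A'"
      using additive_subset_add[OF additive_span z(1)] by fastforce
  }
  {
    assume *: "\<And>u. u \<in> A \<Longrightarrow> frag_of (Bracket s u) \<in> span n A'"
    have "word_mult_left s q \<in> span n A'"
      unfolding word_mult_left_def
      by (rule additive_subset_frag_extend[OF additive_span]) (use * q(1) in blast)
    then show "word_mult_left s p \<in> span n A'"
      using additive_subset_add[OF additive_span z(2)] by fastforce
  }
qed

lemma span_antisym:
  assumes "s \<in> words H" "t \<in> words H" "frag_of (Bracket t s) \<in> span n A"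
  shows "frag_of (Bracket s t) \<in> span n A"
  using additive_subset_diff[OF additive_span span_relations[OF word_relations.antisym[OF assms(1,2)]] assms(3)]
  by simp

lemma lyndon_basis_words: "t \<in> lyndon_basis n \<Longrightarrow> t \<in> words H"
  using basis_closed by (auto simp: lyndon_basis_def words_def)

text \<open>Induction on the total degree and, within it, on \<open>foliage t\<close>. If
  \<open>Bracket s t\<close> is not itself a Lyndon tree, then \<open>s\<close> is
  \<open>[s1, s2]\<close> with \<open>s2\<close> below \<open>t\<close>, and Jacobi replaces the
  bracket by \<open>[[s2, t], s1]\<close> and \<open>[[t, s1], s2]\<close>. The inner brackets have
  smaller degree and reduce to Lyndon trees below \<open>t\<close>; what remains are brackets of two
  trees that are both below \<open>t\<close>.\<close>

lemma lyndon_basis_bracket: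
  "\<lbrakk>s \<in> lyndon_basis m; t \<in> lyndon_basis n; foliage s \<prec>\<^sub>L foliage t\<rbrakk> \<Longrightarrow>
   frag_of (Bracket s t) \<in> span (m + n) (lyndon_below (m + n) (foliage t))"
proof (induction "m + n" arbitrary: m n s t rule: less_induct)
  case less
  define N where "N = m + n"
  have IH: "frag_of (Bracket s t) \<in> span (m + n) (lyndon_below (m + n) (foliage t))"
    if "m + n < N" "s \<in> lyndon_basis m" "t \<in> lyndon_basis n" "foliage s \<prec>\<^sub>L foliage t" for m n s t
    using less.hyps that unfolding N_def by blast
  have "frag_of (Bracket s t) \<in> span N (lyndon_below N v)"
    if "N = m + n" "v = foliage t" "s \<in> lyndon_basis m" "t \<in> lyndon_basis n" "foliage s \<prec>\<^sub>L foliage t"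
    for m n s t v
    using wf_lexord_bounded[OF wf_r, of N] that
  proof (induction v arbitrary: m n s t rule: wf_induct_rule)
    case (less v)
    note N = less.prems(1) and v = less.prems(2)
    have deg: "word_degree s = m" "word_degree t = n" and ly: "lyndon s" "lyndon t"
      using less.prems by (auto simp: lyndon_basis_def)
    \<comment> \<open>Two factors below \<open>v\<close>: the larger one takes the place of
      \<open>t\<close> in the inner induction, and equal factors give a square.\<close>
    have pair: "frag_of (Bracket a b) \<in> span N (lyndon_below N v)"
      if ab: "a \<in> lyndon_basis i" "b \<in> lyndon_basis j" "i + j = N" "foliage a \<prec>\<^sub>L v" "foliage b \<prec>\<^sub>L v"
      for a b i j
    proof -
      have ij: "word_degree a = i" "word_degree b = j" using ab by (auto simp: lyndon_basis_def)
      have len: "length (foliage a) \<le> N" "length (foliage b) \<le> N" "length v \<le> N"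
        using ij ab(3) v deg N by (auto simp: length_foliage)
      have words: "a \<in> words H" "b \<in> words H" using ab lyndon_basis_words by auto
      have sub: "lyndon_below N w \<subseteq> lyndon_below N v" if "w \<prec>\<^sub>L v" for w
        using that lex_trans by (auto simp: lyndon_below_def)
      consider "foliage a \<prec>\<^sub>L foliage b" | "foliage a = foliage b" | "foliage b \<prec>\<^sub>L foliage a"
        using lex_total by blast
      then show ?thesis
      proof cases
        case 1
        have "(foliage b, v) \<in> {(x, y). x \<prec>\<^sub>L y \<and> length x \<le> N \<and> length y \<le> N}"
          using ab(5) len by simp
        from less.IH[OF this ab(3)[symmetric] refl ab(1,2) 1] show ?thesis
          by (rule span_mono[OF _ sub[OF ab(5)]])
      next
        case 2
        then have "a = b" using foliage_inj ab by (auto simp: lyndon_basis_def)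
        then show ?thesis
          using span_square_part[OF square_in_square_part[OF words(1)]] ij ab(3) by simp
      next
        case 3
        have "(foliage a, v) \<in> {(x, y). x \<prec>\<^sub>L y \<and> length x \<le> N \<and> length y \<le> N}"
          using ab(4) len by simp
        moreover have "N = j + i" using ab(3) by simp
        ultimately have "frag_of (Bracket b a) \<in> span N (lyndon_below N (foliage a))"
          using less.IH[OF _ _ refl ab(2,1) 3] by blast
        then have "frag_of (Bracket b a) \<in> span N (lyndon_below N v)"
          by (rule span_mono[OF _ sub[OF ab(4)]])
        then show ?thesis by (rule span_antisym[OF words])
      qed
    qed
    show ?case
    proof (cases "\<exists>s1 s2. s = Bracket s1 s2 \<and> foliage s2 \<prec>\<^sub>L foliage t")
      case False
      then have "lyndon (Bracket s t)"
        using ly less.prems(5) by (auto intro: lyndon_Bracket)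
      then have "Bracket s t \<in> lyndon_below N v"
        using lyndon_Bracket_less less.prems deg by (auto simp: lyndon_below_def lyndon_basis_def)
      then show ?thesis by (rule span_gen)
    next
      case True
      then obtain s1 s2 where s: "s = Bracket s1 s2" and s2: "foliage s2 \<prec>\<^sub>L v"
        using v by blast
      define i j where "i = word_degree s1" and "j = word_degree s2"
      have ly12: "lyndon s1" "lyndon s2" "foliage s1 \<prec>\<^sub>L foliage s2"
        using ly(1) s by (auto elim: lyndon.cases)
      have s1: "foliage s1 \<prec>\<^sub>L v" using ly12(3) s2 by (rule lex_trans)
      have b12: "s1 \<in> lyndon_basis i" "s2 \<in> lyndon_basis j" and ij: "i + j = m"
        using less.prems(3) s ly12 by (auto simp: lyndon_basis_def i_def j_def)
      have w: "s1 \<in> words H" "s2 \<in> words H" "t \<in> words H"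
        using b12 less.prems(4) lyndon_basis_words by auto
      have pos: "0 < i" "0 < j" using word_degree_pos by (auto simp: i_def j_def)
      \<comment> \<open>The outer induction applies because \<open>s1\<close> has positive degree;
        \<open>pair\<close> then takes care of the brackets of the resulting trees with
        \<open>s1\<close>.\<close>
      have "frag_of (Bracket s2 t) \<in> span (j + n) (lyndon_below (j + n) v)"
        using IH[of j n s2 t] b12 less.prems s2 v ij pos by simp
      then have A: "word_mult_right s1 (frag_of (Bracket s2 t)) \<in> span N (lyndon_below N v)"
        by (rule span_bracket(1)[OF _ w(1)])
          (use pair[OF _ b12(1), of _ "j + n"] s1 ij N in \<open>auto simp: lyndon_below_def\<close>)
      have "frag_of (Bracket s1 t) \<in> span (i + n) (lyndon_below (i + n) v)"
        using IH[of i n s1 t] b12 less.prems s1 v ij pos by simp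
      then have "frag_of (Bracket t s1) \<in> span (i + n) (lyndon_below (i + n) v)"
        by (rule span_antisym[OF w(3,1)])
      then have B: "word_mult_right s2 (frag_of (Bracket t s1)) \<in> span N (lyndon_below N v)"
        by (rule span_bracket(1)[OF _ w(2)])
          (use pair[OF _ b12(2), of _ "i + n"] s2 ij N in \<open>auto simp: lyndon_below_def\<close>)
      have "frag_of (Bracket (Bracket s1 s2) t) + frag_of (Bracket (Bracket s2 t) s1) +
          frag_of (Bracket (Bracket t s1) s2) \<in> span N (lyndon_below N v)"
        by (rule span_relations[OF word_relations.jacobi[OF w]])
      from additive_subset_diff[OF additive_span this additive_subset_add[OF additive_span A B]]
      show ?thesis by (simp add: s)
    qed
  qed
  then show ?case using less.prems N_def by blast
qed

lemma lyndon_basis_bracket':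
  assumes "s \<in> lyndon_basis m" "t \<in> lyndon_basis n"
  shows "frag_of (Bracket s t) \<in> span (m + n) (lyndon_basis (m + n))"
proof -
  have words: "s \<in> words H" "t \<in> words H" using assms lyndon_basis_words by auto
  have sub: "lyndon_below k v \<subseteq> lyndon_basis k" for k v by (auto simp: lyndon_below_def)
  consider "foliage s \<prec>\<^sub>L foliage t" | "foliage s = foliage t" | "foliage t \<prec>\<^sub>L foliage s"
    using lex_total by blast
  then show ?thesis
  proof cases
    case 1
    then show ?thesis using lyndon_basis_bracket[OF assms] span_mono sub by blast
  next
    case 2
    then have "s = t" "word_degree t = n" "m = n"
      using foliage_inj assms by (auto simp: lyndon_basis_def)
    then show ?thesis
      using span_square_part[OF square_in_square_part[OF words(2)]] by simp
  next
    case 3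
    then have "frag_of (Bracket t s) \<in> span (m + n) (lyndon_basis (m + n))"
      using lyndon_basis_bracket[OF assms(2,1)] span_mono sub by (metis add.commute)
    then show ?thesis by (rule span_antisym[OF words])
  qed
qed

lemma word_in_span:
  "t \<in> words H \<Longrightarrow> frag_of t \<in> span (word_degree t) (lyndon_basis (word_degree t))"
proof (induction t)
  case (Letter h)
  let ?q = "frag_extend (\<lambda>e. frag_of (Letter e)) (\<kappa> h)"
  have "?q \<in> span 1 (lyndon_basis 1)"
    by (rule additive_subset_frag_extend[OF additive_span])
      (use coords_keys[of h] Letter in \<open>auto intro!: span_gen simp: lyndon_basis_def lyndon_Letter\<close>)
  moreover have "frag_of (Letter h) - ?q \<in> span 1 (lyndon_basis 1)"
    using letter_expand Letter by (intro span_relations) simp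
  ultimately show ?case
    using additive_subset_add[OF additive_span] by fastforce
next
  case (Bracket s t)
  then have st: "s \<in> words H" "t \<in> words H" by auto
  have 1: "frag_of (Bracket u t) \<in> span (m + word_degree t) (lyndon_basis (m + word_degree t))"
    if u: "u \<in> lyndon_basis m" for u m
    using span_bracket(2)[OF Bracket.IH(2)[OF st(2)] lyndon_basis_words[OF u]
        lyndon_basis_bracket'[OF u]] by simp
  show ?case
    using span_bracket(1)[OF Bracket.IH(1)[OF st(1)] st(2) 1] by simp
qed

definition poly_of :: "'h \<Rightarrow> ('h monomial \<Rightarrow>\<^sub>0 int)" where
  "poly_of h = frag_extend letter_poly (\<kappa> h)"

lemma poly_of_mult: "g \<in> carrier H \<Longrightarrow> h \<in> carrier H \<Longrightarrow> poly_of (g \<otimes> h) = poly_of g + poly_of h"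
  by (simp add: poly_of_def coords_mult frag_extend_add)

lemma poly_of_basis: "e \<in> E \<Longrightarrow> poly_of e = letter_poly e"
  by (simp add: poly_of_def coords_basis)

text \<open>Modulo the square part, which the commutator kills, \<open>p\<close> is a combination of
  Lyndon trees over \<open>E\<close>, and these have independent images.\<close>

theorem commutator_kernel:
  assumes p: "p \<in> carrier (free_Abelian_group {t \<in> words H. word_degree t = n})"
    and zero: "frag_extend (commutator poly_of) p = 0"
  shows "p \<in> square_part H n"
proof -
  have "p \<in> span n (lyndon_basis n)"
    using additive_subset_frag_extend[OF additive_span, of p frag_of n "lyndon_basis n"] p word_in_span
    by (fastforce simp: frag_extend_single)
  then obtain q where q: "Poly_Mapping.keys q \<subseteq> lyndon_basis n" "p - q \<in> square_part H n"
    by (auto simp: span_def)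
  \<comment> \<open>The ring is torsion-free, so it suffices that twice \<open>p - q\<close> is a
    relation.\<close>
  have "frag_cmul 2 (frag_extend (commutator poly_of) (p - q)) =
      frag_extend (commutator poly_of) (frag_cmul 2 (p - q))"
    by (simp add: frag_extend_cmul)
  also have "\<dots> = 0"
    by (rule commutator_relations[OF poly_of_mult]) (use q(2) in \<open>auto simp: square_part_def\<close>)
  finally have "frag_extend (commutator poly_of) q = 0"
    using zero by (simp add: frag_extend_diff)
  moreover have "frag_extend (commutator poly_of) q = frag_extend (commutator letter_poly) q"
    by (intro frag_extend_eq commutator_cong poly_of_basis)
      (use q(1) in \<open>auto simp: lyndon_basis_def\<close>)
  ultimately have "q = 0"
    using lyndon_independent[of q n] q(1) by (auto simp: lyndon_basis_def)
  then show ?thesis using q by simp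
qed

end

section \<open>Walks in uni-trivalent trees\<close>

locale uni_graph =
  fixes T :: "'h half_edge_graph"
  assumes unitrivalent: "unitrivalent_graph T"
begin

lemma finite_half_edges: "finite (half_edges T)"
  and opp_closed [simp]: "x \<in> half_edges T \<Longrightarrow> opp T x \<in> half_edges T"
  and opp_neq [simp]: "x \<in> half_edges T \<Longrightarrow> opp T x \<noteq> x"
  and opp_opp [simp]: "x \<in> half_edges T \<Longrightarrow> opp T (opp T x) = x"
  and rot_closed [simp]: "x \<in> half_edges T \<Longrightarrow> rot T x \<in> half_edges T"
  and rot_rot_rot [simp]: "x \<in> half_edges T \<Longrightarrow> rot T (rot T (rot T x)) = x"
  using unitrivalent by (auto simp: unitrivalent_graph_def)

lemma opp_inj: "x \<in> half_edges T \<Longrightarrow> y \<in> half_edges T \<Longrightarrow> opp T x = opp T y \<longleftrightarrow> x = y"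
  by (metis opp_opp)

lemma rot_inj: "x \<in> half_edges T \<Longrightarrow> y \<in> half_edges T \<Longrightarrow> rot T x = rot T y \<longleftrightarrow> x = y"
  by (metis rot_rot_rot)

lemma rot_rot_neq:
  assumes "x \<in> half_edges T" "rot T x \<noteq> x"
  shows "rot T (rot T x) \<noteq> x" "rot T (rot T x) \<noteq> rot T x"
  using assms by (metis rot_rot_rot)+

lemma vertex_of_closed: "x \<in> half_edges T \<Longrightarrow> y \<in> vertex_of T x \<Longrightarrow> y \<in> half_edges T"
  by (auto simp: vertex_of_def)

lemma vertex_of_eq: "x \<in> half_edges T \<Longrightarrow> y \<in> vertex_of T x \<Longrightarrow> vertex_of T y = vertex_of T x"
  by (auto simp: vertex_of_def)

lemma self_in_vertex_of: "x \<in> vertex_of T x"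
  by (simp add: vertex_of_def)

lemma leaf_vertex_of: "x \<in> leaves T \<Longrightarrow> vertex_of T x = {x}"
  by (auto simp: vertex_of_def leaves_def)

lemma walk_step_closed:
  "(x, y) \<in> walk_step T \<Longrightarrow> x \<in> half_edges T \<and> y \<in> half_edges T"
  by (auto simp: walk_step_def intro: vertex_of_closed[OF opp_closed])

lemma walk_closed:
  "(x, y) \<in> (walk_step T)\<^sup>* \<Longrightarrow> x \<in> half_edges T \<Longrightarrow> y \<in> half_edges T"
  by (induction rule: rtrancl_induct) (auto dest: walk_step_closed)

lemma walk_step_reverse:
  assumes "(x, y) \<in> walk_step T"
  shows "(opp T y, opp T x) \<in> walk_step T"
proof -
  from assms have xy: "x \<in> half_edges T" "y \<in> half_edges T"
    using walk_step_closed by auto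
  from assms have "y \<in> vertex_of T (opp T x)" "y \<noteq> opp T x"
    by (auto simp: walk_step_def)
  then have "opp T x \<in> vertex_of T y"
    using vertex_of_eq[OF opp_closed[OF xy(1)]] self_in_vertex_of by metis
  with xy \<open>y \<noteq> opp T x\<close> show ?thesis
    by (auto simp: walk_step_def)
qed

lemma walk_reverse:
  "(x, y) \<in> (walk_step T)\<^sup>* \<Longrightarrow> (opp T y, opp T x) \<in> (walk_step T)\<^sup>*"
  by (induction rule: rtrancl_induct)
    (auto intro: walk_step_reverse converse_rtrancl_into_rtrancl)

lemma walk_step_iff:
  assumes "x \<in> half_edges T"
  shows "(x, y) \<in> walk_step T \<longleftrightarrow> rot T (opp T x) \<noteq> opp T x \<and>
    (y = rot T (opp T x) \<or> y = rot T (rot T (opp T x)))"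
  using assms rot_rot_neq[OF opp_closed[OF assms]]
  by (auto simp: walk_step_def vertex_of_def)

lemma walk_step_vertex:
  assumes "u \<in> half_edges T" "v \<in> vertex_of T u" "u \<noteq> v"
  shows "(opp T u, v) \<in> walk_step T"
  using assms by (auto simp: walk_step_def)

text \<open>In a tree this picks one half of every edge in the branch that \<open>x\<close> leads
  into, \<open>x\<close> included: the half directed away from the start.\<close>

definition beyond :: "nat \<Rightarrow> nat set" where
  "beyond x = {y. (x, y) \<in> (walk_step T)\<^sup>*}"

lemma self_beyond [simp]: "x \<in> beyond x"
  by (simp add: beyond_def)

lemma beyond_closed: "x \<in> half_edges T \<Longrightarrow> beyond x \<subseteq> half_edges T"
  by (auto simp: beyond_def dest: walk_closed)

lemma finite_beyond: "x \<in> half_edges T \<Longrightarrow> finite (beyond x)"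
  using beyond_closed finite_half_edges finite_subset by blast

lemma beyond_unfold: "beyond x = insert x (\<Union>y \<in> {y. (x, y) \<in> walk_step T}. beyond y)"
  by (auto simp: beyond_def intro: converse_rtrancl_into_rtrancl elim: converse_rtranclE)

lemma beyond_leaf:
  "x \<in> half_edges T \<Longrightarrow> rot T (opp T x) = opp T x \<Longrightarrow> beyond x = {x}"
  by (subst beyond_unfold) (auto simp: walk_step_iff)

lemma beyond_node:
  "x \<in> half_edges T \<Longrightarrow> rot T (opp T x) \<noteq> opp T x \<Longrightarrow>
   beyond x = insert x (beyond (rot T (opp T x)) \<union> beyond (rot T (rot T (opp T x))))"
  by (subst beyond_unfold) (auto simp: walk_step_iff)

end

locale conn_graph = uni_graph +
  assumes connected: "connected_graph T"
begin

lemma half_edge_induct [consumes 2, case_names base opp rot]: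
  assumes "e \<in> half_edges T" "x \<in> half_edges T" "P e"
    and "\<And>x. x \<in> half_edges T \<Longrightarrow> P x \<Longrightarrow> P (opp T x)"
    and "\<And>x. x \<in> half_edges T \<Longrightarrow> P x \<Longrightarrow> P (rot T x)"
  shows "P x"
proof -
  have "(e, x) \<in> ({(u, opp T u) | u. u \<in> half_edges T} \<union> {(u, rot T u) | u. u \<in> half_edges T})\<^sup>*"
    using connected assms(1,2) by (auto simp: connected_graph_def)
  then show ?thesis
    by (induction rule: rtrancl_induct) (use assms in auto)
qed

text \<open>Carried along \<open>opp\<close> and \<open>rot\<close> by connectedness: walks from the
  two halves of one edge traverse every edge in some direction.\<close>

lemma beyond_cover:
  assumes "x \<in> half_edges T" "y \<in> half_edges T"
  shows "y \<in> beyond x \<union> beyond (opp T x) \<or> opp T y \<in> beyond x \<union> beyond (opp T x)"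
  using assms
proof (induction rule: half_edge_induct)
  case base
  then show ?case by simp
next
  case (opp y)
  then show ?case by auto
next
  case (rot y)
  \<comment> \<open>Here \<open>y\<close> is directed away from \<open>e\<close>. Then
    \<open>rot T y\<close> is another continuation of the walk or the half-edge by which the walk
    arrived; at \<open>y = e\<close> it is reached from \<open>opp T e\<close> instead.\<close>
  have ext: "rot T y \<in> beyond e \<or> opp T (rot T y) \<in> beyond e \<or> rot T y \<in> beyond (opp T e)"
    if e: "e \<in> half_edges T" and y: "y \<in> beyond e" for e
  proof (cases "y = e")
    case True
    show ?thesis
    proof (cases "rot T e = e")
      case False
      then have "(opp T e, rot T e) \<in> walk_step T"
        using e by (simp add: walk_step_iff)
      then show ?thesis using True by (auto simp: beyond_def)
    qed (use True in simp)
  next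
    case False
    with y obtain p where p: "p \<in> beyond e" "(p, y) \<in> walk_step T"
      by (auto simp: beyond_def elim: rtranclE)
    then have ph: "p \<in> half_edges T" and yv: "y \<in> vertex_of T (opp T p)"
      by (auto simp: walk_step_def)
    have "rot T y \<in> vertex_of T y"
      by (simp add: vertex_of_def)
    then have r: "rot T y \<in> vertex_of T (opp T p)"
      using vertex_of_eq[OF _ yv] ph by simp
    show ?thesis
    proof (cases "rot T y = opp T p")
      case True
      then show ?thesis using p ph by simp
    next
      case False
      then have "(p, rot T y) \<in> walk_step T"
        using ph r by (auto simp: walk_step_def)
      with p(1) show ?thesis
        by (simp add: beyond_def rtrancl_into_rtrancl)
    qed
  qed
  \<comment> \<open>Here the walk arrives at the vertex of \<open>y\<close> along
    \<open>opp T y\<close>, and it can go on with \<open>rot T y\<close> unless \<open>y\<close> is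
    a leaf.\<close>
  have bwd: "rot T y \<in> beyond e \<or> opp T (rot T y) \<in> beyond e"
    if e: "e \<in> half_edges T" and y: "opp T y \<in> beyond e" for e
  proof (cases "rot T y = y")
    case False
    then have "(opp T y, rot T y) \<in> walk_step T"
      using rot.hyps by (simp add: walk_step_iff)
    with y show ?thesis by (simp add: beyond_def rtrancl_into_rtrancl)
  qed (use y in simp)
  have oe: "opp T x \<in> half_edges T" "opp T (opp T x) = x"
    using assms(1) by auto
  from rot show ?case
    using ext[OF assms(1)] ext[OF oe(1)] bwd[OF assms(1)] bwd[OF oe(1)] oe(2)
    by auto
qed

end

text \<open>Connectedness is stated by directed steps; paths back to \<open>e\<close> exist because
  \<open>opp\<close> is an involution and \<open>rot\<close> has order dividing three.\<close>

lemma (in uni_graph) connectedI: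
  assumes "e \<in> half_edges T"
    and "\<And>P x. x \<in> half_edges T \<Longrightarrow> P e \<Longrightarrow> (\<And>x. x \<in> half_edges T \<Longrightarrow> P x \<Longrightarrow> P (opp T x)) \<Longrightarrow>
      (\<And>x. x \<in> half_edges T \<Longrightarrow> P x \<Longrightarrow> P (rot T x)) \<Longrightarrow> P x"
  shows "connected_graph T"
proof -
  let ?C = "{(u, opp T u) | u. u \<in> half_edges T} \<union> {(u, rot T u) | u. u \<in> half_edges T}"
  have to: "(e, x) \<in> ?C\<^sup>*" if "x \<in> half_edges T" for x
    using that
  proof (rule assms(2))
    show "(e, opp T x) \<in> ?C\<^sup>*" if "x \<in> half_edges T" "(e, x) \<in> ?C\<^sup>*" for x
      using that by (auto intro: rtrancl_into_rtrancl)
    show "(e, rot T x) \<in> ?C\<^sup>*" if "x \<in> half_edges T" "(e, x) \<in> ?C\<^sup>*" for x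
      using that by (auto intro: rtrancl_into_rtrancl)
  qed simp
  have bwd: "(x, e) \<in> ?C\<^sup>*" if "x \<in> half_edges T" for x
    using that
  proof (rule assms(2))
    show "(opp T x, e) \<in> ?C\<^sup>*" if x: "x \<in> half_edges T" "(x, e) \<in> ?C\<^sup>*" for x
    proof -
      have "(opp T x, opp T (opp T x)) \<in> ?C"
        using opp_closed[OF x(1)] by blast
      then have "(opp T x, x) \<in> ?C"
        using x(1) by simp
      then show ?thesis using x(2) by (rule converse_rtrancl_into_rtrancl)
    qed
    show "(rot T x, e) \<in> ?C\<^sup>*" if x: "x \<in> half_edges T" "(x, e) \<in> ?C\<^sup>*" for x
    proof -
      have 1: "(rot T x, rot T (rot T x)) \<in> ?C" "(rot T (rot T x), rot T (rot T (rot T x))) \<in> ?C"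
        using x(1) rot_closed by blast+
      then have "(rot T (rot T x), x) \<in> ?C"
        using x(1) by simp
      with 1(1) x(2) show ?thesis
        by (meson converse_rtrancl_into_rtrancl)
    qed
  qed simp
  have "(x, y) \<in> ?C\<^sup>*" if "x \<in> half_edges T" "y \<in> half_edges T" for x y
    using bwd[OF that(1)] to[OF that(2)] by (rule rtrancl_trans)
  then show ?thesis
    using assms(1) unfolding connected_graph_def by blast
qed

locale tree_graph = conn_graph +
  assumes acyclic_walk: "acyclic (walk_step T)"
begin

lemma no_cycle: "(x, x) \<notin> (walk_step T)\<^sup>+"
  using acyclic_walk by (auto simp: acyclic_def)

text \<open>Removing the first and the last step leaves a walk from \<open>p\<close> to
  \<open>q\<close>, where \<open>p\<close> and \<open>opp T q\<close> lie at the vertex across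
  \<open>x\<close>. If they coincide, this is a shorter walk of the same kind; otherwise
  \<open>q\<close> can be followed by \<open>p\<close>, which closes a cycle.\<close>

lemma no_return: "x \<in> half_edges T \<Longrightarrow> (x, opp T x) \<notin> (walk_step T)\<^sup>*"
proof
  assume "x \<in> half_edges T" "(x, opp T x) \<in> (walk_step T)\<^sup>*"
  then obtain n where "(x, opp T x) \<in> walk_step T ^^ n"
    by (auto simp: rtrancl_power)
  then show False
    using \<open>x \<in> half_edges T\<close>
  proof (induction n arbitrary: x rule: less_induct)
    case (less n)
    consider "n = 0" | "n = 1" | m where "n = Suc (Suc m)"
      by (metis One_nat_def not0_implies_Suc)
    then show False
    proof cases
      case 1
      with less.prems show False by simp (metis opp_neq)
    next
      case 2
      with less.prems show False by (auto simp: walk_step_def)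
    next
      case 3
      with less.prems(1) obtain p q where
        p: "(x, p) \<in> walk_step T" and pq: "(p, q) \<in> walk_step T ^^ m"
        and q: "(q, opp T x) \<in> walk_step T"
        by (metis relpow_Suc_D2 relpow_Suc_E)
      have h: "p \<in> half_edges T" "q \<in> half_edges T"
        using p q walk_step_closed by auto
      have v: "p \<in> vertex_of T (opp T x)" "opp T q \<in> vertex_of T (opp T x)"
        "opp T q \<noteq> opp T x"
        using p walk_step_reverse[OF q] less.prems(2) by (auto simp: walk_step_def)
      show False
      proof (cases "p = opp T q")
        case True
        then have "q = opp T p" using h by simp
        with pq less.IH[of m p] 3 h show False by simp
      next
        case False
        have "p \<in> vertex_of T (opp T q)"
          using v less.prems(2) vertex_of_eq[OF opp_closed] by blast
        with False h have "(q, p) \<in> walk_step T"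
          by (auto simp: walk_step_def)
        moreover have "(p, q) \<in> (walk_step T)\<^sup>*"
          using pq by (auto simp: rtrancl_power)
        ultimately show False
          using no_cycle by (meson rtrancl_into_trancl2)
      qed
    qed
  qed
qed

text \<open>If both walks reached \<open>z\<close>, going back along the first, across the vertex
  and along the second would lead from \<open>opp T z\<close> to \<open>z\<close>.\<close>

lemma beyond_disjoint:
  assumes "u \<in> half_edges T" "v \<in> vertex_of T u" "u \<noteq> v"
  shows "beyond u \<inter> beyond v = {}"
proof (rule ccontr)
  assume "beyond u \<inter> beyond v \<noteq> {}"
  then obtain z where z: "(u, z) \<in> (walk_step T)\<^sup>*" "(v, z) \<in> (walk_step T)\<^sup>*"
    by (auto simp: beyond_def)
  have "(opp T z, opp T u) \<in> (walk_step T)\<^sup>*"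
    using walk_reverse[OF z(1)] .
  also have "(opp T u, v) \<in> (walk_step T)\<^sup>*"
    using walk_step_vertex[OF assms] by auto
  also note z(2)
  finally show False
    using no_return[of "opp T z"] walk_closed[OF z(1) assms(1)] by simp
qed

lemma beyond_opp_disjoint:
  assumes "x \<in> half_edges T"
  shows "beyond x \<inter> beyond (opp T x) = {}"
proof (rule ccontr)
  assume "beyond x \<inter> beyond (opp T x) \<noteq> {}"
  then obtain z where z: "(x, z) \<in> (walk_step T)\<^sup>*" "(opp T x, z) \<in> (walk_step T)\<^sup>*"
    by (auto simp: beyond_def)
  have "(opp T z, x) \<in> (walk_step T)\<^sup>*"
    using walk_reverse[OF z(2)] assms by simp
  also note z(1)
  finally show False
    using no_return[of "opp T z"] walk_closed[OF z(1) assms(1)] by simp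
qed

lemma finite_walk_step: "finite (walk_step T)"
  by (rule finite_subset[of _ "half_edges T \<times> half_edges T"])
    (auto simp: finite_half_edges dest: walk_step_closed)

lemma walk_induct [consumes 1, case_names leaf node]:
  assumes "x \<in> half_edges T"
    and leaf: "\<And>x. x \<in> half_edges T \<Longrightarrow> rot T (opp T x) = opp T x \<Longrightarrow> P x"
    and node: "\<And>x. x \<in> half_edges T \<Longrightarrow> rot T (opp T x) \<noteq> opp T x \<Longrightarrow>
      P (rot T (opp T x)) \<Longrightarrow> P (rot T (rot T (opp T x))) \<Longrightarrow> P x"
  shows "P x"
proof -
  have "wf ((walk_step T)\<inverse>)"
    by (rule finite_acyclic_wf_converse[OF finite_walk_step acyclic_walk])
  then show ?thesis
    using assms(1)
  proof (induction x rule: wf_induct_rule)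
    case (less x)
    show ?case
    proof (cases "rot T (opp T x) = opp T x")
      case False
      then show ?thesis
        using node less by (auto simp: walk_step_iff)
    qed (use leaf less in auto)
  qed
qed

end

section \<open>The words read from a tree\<close>

lemma branch_unique: "branch T x s \<Longrightarrow> branch T x t \<Longrightarrow> s = t"
proof (induction arbitrary: t rule: branch.induct)
  case (leaf x)
  from leaf.prems show ?case
    by cases (use leaf.hyps in auto)
next
  case (node x s u)
  from node.prems show ?case
    by cases (use node.hyps(1) in blast, metis node.IH)
qed

definition word_at :: "'h half_edge_graph \<Rightarrow> nat \<Rightarrow> 'h word" where
  "word_at T x = (THE t. branch T x t)"

lemma word_at_eqI: "branch T x t \<Longrightarrow> word_at T x = t"
  unfolding word_at_def by (blast intro: branch_unique)

context tree_graph
begin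

lemma branch_word_at: "x \<in> half_edges T \<Longrightarrow> branch T x (word_at T x)"
proof -
  assume "x \<in> half_edges T"
  then have "\<exists>t. branch T x t"
    by (induction rule: walk_induct) (auto intro: branch.intros)
  then show ?thesis
    by (metis word_at_eqI)
qed

lemma word_at_leaf:
  "rot T (opp T x) = opp T x \<Longrightarrow> word_at T x = Letter (lab T (opp T x))"
  by (intro word_at_eqI branch.leaf)

lemma word_at_node:
  "x \<in> half_edges T \<Longrightarrow> rot T (opp T x) \<noteq> opp T x \<Longrightarrow>
   word_at T x = Bracket (word_at T (rot T (opp T x))) (word_at T (rot T (rot T (opp T x))))"
  by (intro word_at_eqI branch.node branch_word_at) auto

lemma word_at_opp:
  "x \<in> half_edges T \<Longrightarrow> rot T x \<noteq> x \<Longrightarrow>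
   word_at T (opp T x) = Bracket (word_at T (rot T x)) (word_at T (rot T (rot T x)))"
  using word_at_node[of "opp T x"] by simp

end

text \<open>
  The sum of \<open>f h t\<close> over the leaves of \<open>s\<close>, where \<open>h\<close> is the label of the leaf and \<open>t\<close> is the word
  obtained by rooting at that leaf the tree which arises by joining the roots of \<open>s\<close> and \<open>t\<close>.
\<close>

primrec leaf_sum :: "('h \<Rightarrow> 'h word \<Rightarrow> 'c::comm_monoid_add) \<Rightarrow> 'h word \<Rightarrow> 'h word \<Rightarrow> 'c" where
  "leaf_sum f (Letter h) t = f h t"
| "leaf_sum f (Bracket s u) t = leaf_sum f s (Bracket u t) + leaf_sum f u (Bracket t s)"

lemma leaf_sum_one: "leaf_sum (\<lambda>_ _. Suc 0) s t = word_degree s"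
  by (induction s arbitrary: t) auto

section \<open>Sums over the leaves of a tree\<close>

context tree_graph
begin

definition leaves_beyond :: "nat \<Rightarrow> nat set" where
  "leaves_beyond x = {w \<in> leaves T. opp T w \<in> beyond x}"

lemma finite_leaves: "finite (leaves T)"
  using finite_half_edges by (simp add: leaves_def)

lemma leaf_closed: "w \<in> leaves T \<Longrightarrow> w \<in> half_edges T"
  by (simp add: leaves_def)

text \<open>\<open>leaf_sum\<close> follows the cyclic order. At a vertex with order
  \<open>(opp T x, y, z)\<close>, a root on the side of \<open>y\<close> sees \<open>z\<close> and
  then the side of \<open>x\<close>, and a root on the side of \<open>z\<close> sees the side of
  \<open>x\<close> and then \<open>y\<close>.\<close>

lemma sum_leaves_beyond:
  assumes "x \<in> half_edges T"
  shows "(\<Sum>w\<in>leaves_beyond x. f (lab T w) (word_at T w)) =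
    leaf_sum f (word_at T x) (word_at T (opp T x))"
  using assms
proof (induction rule: walk_induct)
  case (leaf x)
  then have "leaves_beyond x = {opp T x}"
    by (auto simp: leaves_beyond_def beyond_leaf leaves_def)
  then show ?case
    using leaf by (simp add: word_at_leaf)
next
  case (node x)
  define y z where "y = rot T (opp T x)" and "z = rot T y"
  have h: "y \<in> half_edges T" "z \<in> half_edges T"
    using node by (auto simp: y_def z_def)
  have ne: "y \<noteq> opp T x" "z \<noteq> opp T x" "z \<noteq> y"
    using node rot_rot_neq[of "opp T x"] by (auto simp: y_def z_def)
  have rz: "rot T z = opp T x"
    using node by (simp add: y_def z_def)
  have "x \<noteq> opp T w" if "w \<in> leaves T" for w
    using that node leaf_closed[OF that] by (auto simp: leaves_def)
  then have split: "leaves_beyond x = leaves_beyond y \<union> leaves_beyond z"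
    using node by (auto simp: leaves_beyond_def beyond_node y_def z_def)
  have disj: "leaves_beyond y \<inter> leaves_beyond z = {}"
    using beyond_disjoint[of y z] h ne by (auto simp: leaves_beyond_def vertex_of_def z_def)
  have wy: "word_at T (opp T y) = Bracket (word_at T z) (word_at T (opp T x))"
    using word_at_opp[OF h(1)] ne rz by (simp add: z_def)
  have wz: "word_at T (opp T z) = Bracket (word_at T (opp T x)) (word_at T y)"
    using word_at_opp[OF h(2)] ne rz by (simp add: y_def)
  have "(\<Sum>w\<in>leaves_beyond x. f (lab T w) (word_at T w)) =
      (\<Sum>w\<in>leaves_beyond y. f (lab T w) (word_at T w)) +
      (\<Sum>w\<in>leaves_beyond z. f (lab T w) (word_at T w))"
    unfolding split
    by (rule sum.union_disjoint) (auto simp: leaves_beyond_def finite_leaves disj[unfolded leaves_beyond_def])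
  also have "\<dots> = leaf_sum f (word_at T y) (Bracket (word_at T z) (word_at T (opp T x))) +
      leaf_sum f (word_at T z) (Bracket (word_at T (opp T x)) (word_at T y))"
    using node.IH wy wz by (simp add: y_def z_def)
  finally show ?case
    using node word_at_node[of x] by (simp add: y_def z_def)
qed

lemma leaves_split:
  assumes "x \<in> half_edges T"
  shows "leaves T = leaves_beyond x \<union> leaves_beyond (opp T x)"
    and "leaves_beyond x \<inter> leaves_beyond (opp T x) = {}"
proof -
  have *: "w = e" if "w \<in> leaves T" "w \<in> beyond e" for w e
  proof (rule ccontr)
    assume "w \<noteq> e"
    with that(2) obtain p where "(p, w) \<in> walk_step T"
      by (auto simp: beyond_def elim: rtranclE)
    then have "w \<in> vertex_of T (opp T p)" "w \<noteq> opp T p" "p \<in> half_edges T"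
      by (auto simp: walk_step_def)
    then show False
      using vertex_of_eq[of "opp T p" w] leaf_vertex_of[OF that(1)] self_in_vertex_of[of "opp T p"]
      by auto
  qed
  have "opp T w \<in> beyond x \<union> beyond (opp T x)" if w: "w \<in> leaves T" for w
    using beyond_cover[OF assms leaf_closed[OF w]] *[OF w, of x] *[OF w, of "opp T x"] assms
    by auto
  then show "leaves T = leaves_beyond x \<union> leaves_beyond (opp T x)"
    by (auto simp: leaves_beyond_def)
  show "leaves_beyond x \<inter> leaves_beyond (opp T x) = {}"
    using beyond_opp_disjoint[OF assms] by (auto simp: leaves_beyond_def)
qed

text \<open>The left side does not mention the edge, so the right side takes the same value at every
  edge of the tree.\<close>

lemma sum_leaves:
  assumes "x \<in> half_edges T"
  shows "(\<Sum>w\<in>leaves T. f (lab T w) (word_at T w)) =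
    leaf_sum f (word_at T x) (word_at T (opp T x)) +
    leaf_sum f (word_at T (opp T x)) (word_at T x)"
proof -
  have "(\<Sum>w\<in>leaves T. f (lab T w) (word_at T w)) =
      (\<Sum>w\<in>leaves_beyond x. f (lab T w) (word_at T w)) +
      (\<Sum>w\<in>leaves_beyond (opp T x). f (lab T w) (word_at T w))"
    using leaves_split[OF assms] finite_leaves
    by (metis (no_types, lifting) finite_Un sum.union_disjoint)
  then show ?thesis
    using assms sum_leaves_beyond[of x f] sum_leaves_beyond[of "opp T x" f] by simp
qed

lemma card_leaves:
  assumes "x \<in> half_edges T"
  shows "card (leaves T) = word_degree (word_at T x) + word_degree (word_at T (opp T x))"
  using sum_leaves[OF assms, of "\<lambda>_ _. Suc 0"] by (simp add: leaf_sum_one)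

section \<open>The numbers of leaves and of trivalent vertices\<close>

definition vertices_beyond :: "nat \<Rightarrow> nat set set" where
  "vertices_beyond x = (\<lambda>y. vertex_of T (opp T y)) ` {y \<in> beyond x. rot T (opp T y) \<noteq> opp T y}"

lemma finite_vertices_beyond: "x \<in> half_edges T \<Longrightarrow> finite (vertices_beyond x)"
  by (simp add: vertices_beyond_def finite_beyond)

lemma vertices_beyond_disjoint:
  assumes u: "u \<in> half_edges T" and v: "v \<in> half_edges T"
    and disj: "beyond u \<inter> beyond v = {}" and step: "(opp T v, u) \<in> (walk_step T)\<^sup>*"
  shows "vertices_beyond u \<inter> vertices_beyond v = {}"
proof (rule ccontr)
  assume "vertices_beyond u \<inter> vertices_beyond v \<noteq> {}"
  then obtain p q where p: "p \<in> beyond u" and q: "q \<in> beyond v"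
    and pq: "vertex_of T (opp T p) = vertex_of T (opp T q)"
    by (auto simp: vertices_beyond_def)
  have h: "p \<in> half_edges T" "q \<in> half_edges T"
    using p q beyond_closed u v by auto
  have "opp T q \<noteq> opp T p"
    using h disj p q opp_inj by auto
  then have pq': "(p, opp T q) \<in> walk_step T"
    using h pq self_in_vertex_of[of "opp T q"] by (simp add: walk_step_def)
  have "(opp T q, opp T v) \<in> (walk_step T)\<^sup>*"
    using q walk_reverse by (simp add: beyond_def)
  also note step
  also have "(u, p) \<in> (walk_step T)\<^sup>*"
    using p by (simp add: beyond_def)
  finally have "(p, p) \<in> (walk_step T)\<^sup>+"
    using pq' by (meson rtrancl_into_trancl2)
  with no_cycle show False by blast
qed

lemma card_vertices_beyond:
  assumes "x \<in> half_edges T"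
  shows "card (vertices_beyond x) + 1 = word_degree (word_at T x)"
  using assms
proof (induction rule: walk_induct)
  case (leaf x)
  then have "vertices_beyond x = {}"
    by (auto simp: vertices_beyond_def beyond_leaf)
  then show ?case
    using leaf by (simp add: word_at_leaf)
next
  case (node x)
  define y z where "y = rot T (opp T x)" and "z = rot T y"
  have h: "y \<in> half_edges T" "z \<in> half_edges T"
    using node by (auto simp: y_def z_def)
  have ne: "y \<noteq> opp T x" "z \<noteq> opp T x" "z \<noteq> y"
    using node rot_rot_neq[of "opp T x"] by (auto simp: y_def z_def)
  have split: "vertices_beyond x =
      insert (vertex_of T (opp T x)) (vertices_beyond y \<union> vertices_beyond z)"
    using node by (auto simp: vertices_beyond_def beyond_node y_def z_def)
  have yz: "z \<in> vertex_of T y"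
    by (simp add: vertex_of_def z_def)
  have zy: "y \<in> vertex_of T z"
    using vertex_of_eq[OF h(1) yz] self_in_vertex_of by simp
  have disj: "vertices_beyond y \<inter> vertices_beyond z = {}"
    using vertices_beyond_disjoint[OF h] beyond_disjoint[OF h(1) yz] ne
      walk_step_vertex[OF h(2) zy] by auto
  have new: "vertex_of T (opp T x) \<notin> vertices_beyond u"
    if u: "(x, u) \<in> walk_step T" for u
  proof
    assume "vertex_of T (opp T x) \<in> vertices_beyond u"
    then obtain p where p: "p \<in> beyond u" "vertex_of T (opp T x) = vertex_of T (opp T p)"
      by (auto simp: vertices_beyond_def)
    have uh: "u \<in> half_edges T" using u walk_step_closed by blast
    have ph: "p \<in> half_edges T" using p uh beyond_closed by auto
    have up: "(u, p) \<in> (walk_step T)\<^sup>*" using p by (simp add: beyond_def)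
    show False
    proof (cases "opp T p = opp T x")
      case True
      then have "p = x" using ph node opp_inj by blast
      with u up no_cycle show False by (meson rtrancl_into_trancl2)
    next
      case False
      then have "(x, opp T p) \<in> walk_step T"
        using p(2) node self_in_vertex_of[of "opp T p"] by (auto simp: walk_step_def)
      also have "(opp T p, opp T u) \<in> (walk_step T)\<^sup>*"
        using walk_reverse[OF up] .
      also have "(opp T u, opp T x) \<in> walk_step T"
        using walk_step_reverse[OF u] .
      finally show False
        using no_return node by (meson trancl_into_rtrancl)
    qed
  qed
  have st: "(x, y) \<in> walk_step T" "(x, z) \<in> walk_step T"
    using node by (auto simp: walk_step_iff y_def z_def)
  have "card (vertices_beyond x) = Suc (card (vertices_beyond y) + card (vertices_beyond z))"
    using new[OF st(1)] new[OF st(2)] disj h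
    by (simp add: split finite_vertices_beyond card_Un_disjoint)
  then show ?case
    using node word_at_node[of x] by (simp add: y_def z_def)
qed

text \<open>Cutting an edge leaves two rooted binary trees, each with one node fewer than leaves.
  This trades the vertex count in \<open>trees\<close> for the number of leaves, which is visible in
  the degrees of words.\<close>

lemma card_leaves_trivalent: "card (leaves T) = card (trivalent_vertices T) + 2"
proof -
  obtain x where x: "x \<in> half_edges T"
    using connected by (auto simp: connected_graph_def)
  have sub: "vertices_beyond u \<subseteq> trivalent_vertices T" if "u \<in> half_edges T" for u
    using beyond_closed[OF that]
    by (auto simp: vertices_beyond_def trivalent_vertices_def leaves_def)
  have in_beyond: "vertex_of T y \<in> vertices_beyond u"
    if "y \<in> half_edges T" "rot T y \<noteq> y" "u \<in> half_edges T" "opp T y \<in> beyond u" for y u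
    unfolding vertices_beyond_def by (rule image_eqI[of _ _ "opp T y"]) (use that in auto)
  have in_beyond': "vertex_of T y \<in> vertices_beyond u \<union> vertices_beyond (opp T u)"
    if y: "y \<in> half_edges T" "rot T y \<noteq> y" and u: "u \<in> half_edges T" "y \<in> beyond u" for y u
  proof (cases "y = u")
    case True
    then show ?thesis using in_beyond[of y "opp T u"] y by auto
  next
    case False
    with u obtain p where p: "(p, y) \<in> walk_step T" "p \<in> beyond u"
      by (auto simp: beyond_def elim: rtranclE)
    then have "p \<in> half_edges T" "y \<in> vertex_of T (opp T p)"
      by (auto simp: walk_step_def)
    then have "vertex_of T y = vertex_of T (opp T p)" "rot T (opp T p) \<noteq> opp T p"
      using vertex_of_eq[of "opp T p" y] p(1) by (auto simp: walk_step_iff)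
    with p(2) show ?thesis
      by (auto simp: vertices_beyond_def)
  qed
  have "trivalent_vertices T = vertices_beyond x \<union> vertices_beyond (opp T x)"
  proof
    show "trivalent_vertices T \<subseteq> vertices_beyond x \<union> vertices_beyond (opp T x)"
    proof
      fix V assume "V \<in> trivalent_vertices T"
      then obtain y where y: "y \<in> half_edges T" "rot T y \<noteq> y" "V = vertex_of T y"
        by (auto simp: trivalent_vertices_def leaves_def)
      show "V \<in> vertices_beyond x \<union> vertices_beyond (opp T x)"
        using beyond_cover[OF x y(1)] y in_beyond[OF y(1,2)] in_beyond'[OF y(1,2)] x
        by (metis UnCI UnE opp_closed opp_opp)
    qed
  qed (use sub x in auto)
  moreover have "vertices_beyond x \<inter> vertices_beyond (opp T x) = {}"
    using vertices_beyond_disjoint[of x "opp T x"] x beyond_opp_disjoint[OF x] by simp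
  ultimately have "card (trivalent_vertices T) =
      card (vertices_beyond x) + card (vertices_beyond (opp T x))"
    using x by (simp add: card_Un_disjoint finite_vertices_beyond)
  then show ?thesis
    using card_leaves[OF x] card_vertices_beyond[OF x] card_vertices_beyond[of "opp T x"] x
    by simp
qed

end

text \<open>Reading a word from \<open>x\<close> inspects only the vertices reached by walks from
  \<open>x\<close>, so a change of orders or labels elsewhere does not affect it.\<close>

lemma branch_cong:
  assumes "branch T x t" "opp T' = opp T"
    and "\<And>y z. (x, y) \<in> (walk_step T)\<^sup>* \<Longrightarrow> z \<in> vertex_of T (opp T y) \<Longrightarrow> rot T' z = rot T z"
    and "\<And>y. (x, y) \<in> (walk_step T)\<^sup>* \<Longrightarrow> rot T (opp T y) = opp T y \<Longrightarrow> lab T' (opp T y) = lab T (opp T y)"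
    and "uni_graph T" "x \<in> half_edges T"
  shows "branch T' x t"
  using assms
proof (induction)
  case (leaf x)
  have "rot T' (opp T x) = rot T (opp T x)"
    using leaf.prems(2)[of x "opp T x"] by (simp add: vertex_of_def)
  moreover have "lab T' (opp T x) = lab T (opp T x)"
    using leaf by auto
  ultimately show ?case
    using branch.leaf[of T' x] leaf by simp
next
  case (node x s t)
  interpret uni_graph T by fact
  let ?o = "opp T x"
  have st: "(x, rot T ?o) \<in> walk_step T" "(x, rot T (rot T ?o)) \<in> walk_step T"
    using node by (auto simp: walk_step_iff)
  have r: "rot T' ?o = rot T ?o" "rot T' (rot T ?o) = rot T (rot T ?o)"
    using node.prems(2)[of x] by (auto simp: vertex_of_def)
  have b: "branch T' (rot T ?o) s" "branch T' (rot T (rot T ?o)) t"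
    using node.IH node.prems st by (meson converse_rtrancl_into_rtrancl walk_step_closed)+
  show ?case
    using branch.node[of T' x s t] r b node.hyps node.prems(1) by simp
qed

lemma trees_iff:
  "T \<in> trees H k \<longleftrightarrow> tree_graph T \<and> card (leaves T) = k + 2 \<and> (\<forall>w\<in>leaves T. lab T w \<in> carrier H)"
proof (cases "tree_graph T")
  case True
  then show ?thesis
    using tree_graph.card_leaves_trivalent[OF True]
    by (auto simp: trees_def tree_graph_def conn_graph_def uni_graph_def
        conn_graph_axioms_def tree_graph_axioms_def)
next
  case False
  then show ?thesis
    by (auto simp: trees_def tree_graph_def conn_graph_def uni_graph_def
        conn_graph_axioms_def tree_graph_axioms_def)
qed

section \<open>Morphisms of graphs\<close>

text \<open>A morphism maps walks without backtracking to such walks, so it cannot identify two half-edges.\<close>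

lemma graph_morphism_bij:
  assumes "conn_graph T" "tree_graph T'"
    and f_closed: "\<And>x. x \<in> half_edges T \<Longrightarrow> f x \<in> half_edges T'"
    and f_opp: "\<And>x. x \<in> half_edges T \<Longrightarrow> f (opp T x) = opp T' (f x)"
    and f_rot: "\<And>x. x \<in> half_edges T \<Longrightarrow> f (rot T x) = rot T' (f x)"
    and f_node: "\<And>x. x \<in> half_edges T \<Longrightarrow> rot T x \<noteq> x \<Longrightarrow> rot T' (f x) \<noteq> f x"
  shows "bij_betw f (half_edges T) (half_edges T')"
proof -
  interpret T: conn_graph T by fact
  interpret T': tree_graph T' by fact
  have step: "(f x, f y) \<in> walk_step T'" if "(x, y) \<in> walk_step T" for x y
  proof -
    have x: "x \<in> half_edges T"
      using that T.walk_step_closed by blast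
    show ?thesis
      using that f_node[of "opp T x"] x f_closed
      by (auto simp: T.walk_step_iff T'.walk_step_iff f_opp f_rot)
  qed
  have walk: "(f x, f y) \<in> (walk_step T')\<^sup>*" if "(x, y) \<in> (walk_step T)\<^sup>*" for x y
    using that by (induction rule: rtrancl_induct) (auto intro: rtrancl_into_rtrancl step)
  have loop: "f x \<noteq> f y" if "(x, y) \<in> (walk_step T)\<^sup>*" "x \<noteq> y" for x y
  proof
    assume eq: "f x = f y"
    from that obtain z where z: "(x, z) \<in> walk_step T" "(z, y) \<in> (walk_step T)\<^sup>*"
      by (meson converse_rtranclE)
    have "(f x, f x) \<in> (walk_step T')\<^sup>+"
      using rtrancl_into_trancl2[OF step[OF z(1)] walk[OF z(2)]] eq by simp
    then show False
      using T'.no_cycle by blast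
  qed
  have inj: "inj_on f (half_edges T)"
  proof (rule inj_onI, rule ccontr)
    fix x y assume xy: "x \<in> half_edges T" "y \<in> half_edges T" "f x = f y" "x \<noteq> y"
    consider "(x, y) \<in> (walk_step T)\<^sup>*" | "(opp T x, y) \<in> (walk_step T)\<^sup>*"
      | "(x, opp T y) \<in> (walk_step T)\<^sup>*" | "(opp T x, opp T y) \<in> (walk_step T)\<^sup>*"
      using T.beyond_cover[OF xy(1,2)] by (auto simp: T.beyond_def)
    then show False
    proof cases
      case 1
      then show False using loop xy by blast
    next
      case 2
      then have "(opp T' (f x), opp T' (opp T' (f x))) \<in> (walk_step T')\<^sup>*"
        using walk[OF 2] f_opp xy f_closed by simp
      then show False using T'.no_return xy f_closed T'.opp_closed by blast
    next
      case 3
      then show False using walk[OF 3] f_opp xy f_closed T'.no_return by simp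
    next
      case 4
      then show False using loop[OF 4] f_opp xy T.opp_inj by simp
    qed
  qed
  obtain e where e: "e \<in> half_edges T"
    using T.connected by (auto simp: connected_graph_def)
  have "y \<in> f ` half_edges T" if "y \<in> half_edges T'" for y
    using f_closed[OF e] that
  proof (induction rule: T'.half_edge_induct)
    case base
    then show ?case using e by blast
  next
    case (opp y)
    then obtain x where x: "x \<in> half_edges T" "y = f x" by blast
    then show ?case by (intro image_eqI[of _ _ "opp T x"]) (simp_all add: f_opp)
  next
    case (rot y)
    then obtain x where x: "x \<in> half_edges T" "y = f x" by blast
    then show ?case by (intro image_eqI[of _ _ "rot T x"]) (simp_all add: f_rot)
  qed
  then show ?thesis
    using inj f_closed by (auto simp: bij_betw_def)
qed

lemma branch_morphism:
  assumes "branch T x t" "x \<in> half_edges T" "uni_graph T"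
    and "\<And>x. x \<in> half_edges T \<Longrightarrow> f (opp T x) = opp T' (f x)"
    and "\<And>x. x \<in> half_edges T \<Longrightarrow> f (rot T x) = rot T' (f x)"
    and "\<And>x. x \<in> half_edges T \<Longrightarrow> rot T x \<noteq> x \<Longrightarrow> rot T' (f x) \<noteq> f x"
    and "\<And>w. w \<in> leaves T \<Longrightarrow> lab T' (f w) = lab T w"
  shows "branch T' (f x) t"
  using assms
proof (induction)
  case (leaf x)
  interpret uni_graph T by fact
  have o: "opp T x \<in> half_edges T" "opp T x \<in> leaves T"
    using leaf by (auto simp: leaves_def)
  show ?case
    using branch.leaf[of T' "f x"] leaf.hyps leaf.prems(3,4,6) o leaf.prems(1) by metis
next
  case (node x s t)
  interpret uni_graph T by fact
  have o: "opp T x \<in> half_edges T" "rot T (opp T x) \<in> half_edges T"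
    using node by auto
  have b: "branch T' (f (rot T (opp T x))) s" "branch T' (f (rot T (rot T (opp T x)))) t"
    by (rule node.IH; use node.prems in simp)+
  show ?case
    by (rule branch.node)
      (use b node.hyps(1) node.prems(3,4,5) o node.prems(1) in \<open>metis\<close>)+
qed

lemma tree_iso_word_at:
  assumes "tree_graph T" "tree_graph T'" "tree_iso T T'" "x \<in> half_edges T"
  obtains x' where "x' \<in> half_edges T'" "word_at T' x' = word_at T x"
    "word_at T' (opp T' x') = word_at T (opp T x)"
proof -
  interpret T: tree_graph T by fact
  interpret T': tree_graph T' by fact
  obtain f where bij: "bij_betw f (half_edges T) (half_edges T')"
    and f: "\<And>x. x \<in> half_edges T \<Longrightarrow> f (opp T x) = opp T' (f x)"
      "\<And>x. x \<in> half_edges T \<Longrightarrow> f (rot T x) = rot T' (f x)"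
      "\<And>w. w \<in> leaves T \<Longrightarrow> lab T' (f w) = lab T w"
    using assms(3) by (auto simp: tree_iso_def)
  have node: "rot T' (f x) \<noteq> f x" if "x \<in> half_edges T" "rot T x \<noteq> x" for x
    using that bij f(2)[OF that(1)] T.rot_closed[OF that(1)]
    by (metis bij_betw_inv_into_left)
  have br: "branch T' (f x) (word_at T x)" if "x \<in> half_edges T" for x
    by (rule branch_morphism[OF T.branch_word_at[OF that] that T.uni_graph_axioms])
      (use f node in auto)
  show ?thesis
  proof
    show "f x \<in> half_edges T'"
      using bij assms(4) by (auto simp: bij_betw_def)
    show "word_at T' (f x) = word_at T x"
      by (rule word_at_eqI[OF br[OF assms(4)]])
    show "word_at T' (opp T' (f x)) = word_at T (opp T x)"
      using word_at_eqI[OF br[OF T.opp_closed[OF assms(4)]]] f assms(4) by simp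
  qed
qed

section \<open>Changing the cyclic orders and the labels\<close>

text \<open>Walks without backtracking see the vertices as sets and not the cyclic orders at them,
  so acyclicity carries over.\<close>

lemma tree_graph_same_vertices:
  assumes "tree_graph T" "unitrivalent_graph T'" "half_edges T' = half_edges T" "opp T' = opp T"
    and vert: "\<And>u. u \<in> half_edges T \<Longrightarrow> vertex_of T' u = vertex_of T u"
  shows "tree_graph T'" "leaves T' = leaves T"
proof -
  interpret T: tree_graph T by fact
  interpret T': uni_graph T' using assms(2) by (simp add: uni_graph_def)
  have "walk_step T' = walk_step T"
    using assms(3,4) vert T.opp_closed by (auto simp: walk_step_def)
  moreover have "connected_graph T'"
  proof -
    obtain e where e: "e \<in> half_edges T"
      using T.connected by (auto simp: connected_graph_def)
    show ?thesis
    proof (rule T'.connectedI)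
      show "e \<in> half_edges T'" using e assms(3) by simp
      fix P x
      assume P: "P e" "\<And>x. x \<in> half_edges T' \<Longrightarrow> P x \<Longrightarrow> P (opp T' x)"
        "\<And>x. x \<in> half_edges T' \<Longrightarrow> P x \<Longrightarrow> P (rot T' x)" and "x \<in> half_edges T'"
      from e \<open>x \<in> half_edges T'\<close>[unfolded assms(3)] show "P x"
      proof (induction rule: T.half_edge_induct)
        case (opp x)
        then show ?case using P(2) assms(3,4) by metis
      next
        case (rot x)
        have "rot T x \<in> vertex_of T' x"
          using vert[OF rot.hyps] by (simp add: vertex_of_def)
        then show ?case
          using P(3)[of x] P(3)[of "rot T' x"] rot assms(3) T'.rot_closed
          by (auto simp: vertex_of_def)
      qed (rule P(1))
    qed
  qed
  ultimately show "tree_graph T'"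
    using T.acyclic_walk by unfold_locales simp_all
  have leaf_iff: "u \<in> leaves T \<longleftrightarrow> u \<in> half_edges T \<and> vertex_of T u = {u}" for u
    by (auto simp: leaves_def vertex_of_def)
  have leaf_iff': "u \<in> leaves T' \<longleftrightarrow> u \<in> half_edges T' \<and> vertex_of T' u = {u}" for u
    by (auto simp: leaves_def vertex_of_def)
  show "leaves T' = leaves T"
    using vert assms(3) by (auto simp: leaf_iff leaf_iff')
qed

context tree_graph
begin

text \<open>Returning to the vertex of \<open>u\<close> would mean either coming back along
  \<open>u\<close> itself or being able to step onto \<open>u\<close> again;
  \<open>no_return\<close> and acyclicity exclude both.\<close>

lemma beyond_avoids_vertex:
  assumes "u \<in> half_edges T" "(u, p) \<in> (walk_step T)\<^sup>*"
  shows "vertex_of T (opp T p) \<inter> vertex_of T u = {}"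
proof (rule ccontr)
  assume "vertex_of T (opp T p) \<inter> vertex_of T u \<noteq> {}"
  moreover have p: "p \<in> half_edges T" using walk_closed assms by blast
  ultimately have "vertex_of T (opp T p) = vertex_of T u"
    using vertex_of_eq assms(1) opp_closed by blast
  then have u: "u \<in> vertex_of T (opp T p)" using self_in_vertex_of by simp
  show False
  proof (cases "u = opp T p")
    case True
    then show False using no_return[of u] assms p by simp
  next
    case False
    then have "(p, u) \<in> walk_step T" using u p by (simp add: walk_step_def)
    then show False using assms no_cycle by (meson rtrancl_into_trancl2)
  qed
qed

lemma beyond_avoids_opposite_vertex:
  assumes "e \<in> half_edges T" "a \<in> vertex_of T e" "a \<noteq> e" "(a, p) \<in> (walk_step T)\<^sup>*"
  shows "vertex_of T (opp T p) \<inter> vertex_of T (opp T e) = {}"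
proof -
  have "(opp T e, a) \<in> walk_step T"
    using assms by (auto simp: walk_step_def)
  then have "(opp T e, p) \<in> (walk_step T)\<^sup>*"
    using assms(4) by (rule converse_rtrancl_into_rtrancl)
  then show ?thesis
    using beyond_avoids_vertex assms(1) by simp
qed

lemma flip_at_tree:
  assumes x: "x \<in> half_edges T" "rot T x \<noteq> x"
  shows "tree_graph (flip_at x T)" "leaves (flip_at x T) = leaves T"
    "word_at (flip_at x T) x = word_at T x"
    "word_at (flip_at x T) (opp T x) =
      Bracket (word_at T (rot T (rot T x))) (word_at T (rot T x))"
proof -
  define y z where "y = rot T x" and "z = rot T y"
  define T' where "T' = flip_at x T"
  have T': "T' = T\<lparr>rot := (rot T)(x := z, z := y, y := x)\<rparr>"
    by (simp add: T'_def flip_at_def y_def z_def Let_def)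
  have h: "y \<in> half_edges T" "z \<in> half_edges T" and rz: "rot T z = x" "rot T y = z" "rot T x = y"
    using x by (auto simp: y_def z_def)
  have ne: "x \<noteq> y" "y \<noteq> z" "x \<noteq> z"
    using x rot_rot_neq[of x] by (auto simp: y_def z_def)
  have off: "rot T u \<notin> {x, y, z}" if "u \<in> half_edges T" "u \<notin> {x, y, z}" for u
    using that rz x(1) h rot_inj by (metis insert_iff singletonD)
  have "unitrivalent_graph T'"
    unfolding unitrivalent_graph_def
  proof (intro conjI ballI)
    show "finite (half_edges T')" using finite_half_edges by (simp add: T')
    fix u assume "u \<in> half_edges T'"
    then have u: "u \<in> half_edges T" by (simp add: T')
    show "opp T' u \<in> half_edges T'" "opp T' u \<noteq> u" "opp T' (opp T' u) = u"
      using u by (simp_all add: T')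
    show "rot T' u \<in> half_edges T'"
      using u h x by (simp add: T')
    show "rot T' (rot T' (rot T' u)) = u"
    proof (cases "u \<in> {x, y, z}")
      case True
      then show ?thesis using ne by (auto simp: T')
    next
      case False
      then show ?thesis
        using off[of u] off[of "rot T u"] u by (simp add: T')
    qed
  qed
  moreover have "vertex_of T' u = vertex_of T u" if u: "u \<in> half_edges T" for u
  proof (cases "u \<in> {x, y, z}")
    case True
    then show ?thesis using ne rz by (auto simp: T' vertex_of_def)
  next
    case False
    then show ?thesis
      using off[of u] off[of "rot T u"] u by (simp add: T' vertex_of_def)
  qed
  moreover have "half_edges T' = half_edges T" "opp T' = opp T"
    by (simp_all add: T')
  ultimately have tree: "tree_graph T'" "leaves T' = leaves T"
    using tree_graph_same_vertices[OF tree_graph_axioms] by blast+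
  have br: "branch T' u (word_at T u)" if u: "u \<in> {x, y, z}" for u
  proof (rule branch_cong[OF branch_word_at])
    show "u \<in> half_edges T" "u \<in> half_edges T" using u h x by auto
    show "opp T' = opp T" by (simp add: T')
    show "uni_graph T" by unfold_locales
    fix p v assume p: "(u, p) \<in> (walk_step T)\<^sup>*"
    {
      assume v: "v \<in> vertex_of T (opp T p)"
      have "vertex_of T u = {x, y, z}"
        using u rz by (auto simp: vertex_of_def)
      then have "v \<notin> {x, y, z}"
        using beyond_avoids_vertex[OF _ p] \<open>u \<in> half_edges T\<close> v by blast
      then show "rot T' v = rot T v" by (simp add: T')
    }
    show "lab T' (opp T p) = lab T (opp T p)" by (simp add: T')
  qed
  show "tree_graph (flip_at x T)" "leaves (flip_at x T) = leaves T"
    using tree by (simp_all add: T'_def)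
  show "word_at (flip_at x T) x = word_at T x"
    using word_at_eqI[OF br[of x]] by (simp add: T'_def)
  have "branch T' (opp T x) (Bracket (word_at T z) (word_at T y))"
    by (rule branch.node) (use br[of y] br[of z] ne x in \<open>auto simp: T'\<close>)
  then show "word_at (flip_at x T) (opp T x) =
      Bracket (word_at T (rot T (rot T x))) (word_at T (rot T x))"
    using word_at_eqI by (simp add: T'_def y_def z_def)
qed

lemma relabel_tree:
  fixes g :: 'a
  assumes w: "w \<in> leaves T"
  defines "T' \<equiv> T\<lparr>lab := (lab T)(w := g)\<rparr>"
  shows "tree_graph T'" "leaves T' = leaves T" "word_at T' w = word_at T w"
    "word_at T' (opp T w) = Letter g"
proof -
  have wh: "w \<in> half_edges T" "rot T w = w" using w by (auto simp: leaves_def)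
  have "unitrivalent_graph T'"
    using unitrivalent by (simp add: unitrivalent_graph_def T'_def)
  then show tree: "tree_graph T'" "leaves T' = leaves T"
    using tree_graph_same_vertices[OF tree_graph_axioms, of T']
    by (simp_all add: T'_def vertex_of_def)
  have "branch T' w (word_at T w)"
  proof (rule branch_cong[OF branch_word_at])
    show "w \<in> half_edges T" "w \<in> half_edges T" "opp T' = opp T" "uni_graph T"
      using wh by (simp_all add: T'_def uni_graph_axioms)
    fix p v assume p: "(w, p) \<in> (walk_step T)\<^sup>*"
    show "rot T' v = rot T v" by (simp add: T'_def)
    have "opp T p \<noteq> w"
      using no_return[OF wh(1)] p walk_closed[OF p wh(1)] by auto
    then show "lab T' (opp T p) = lab T (opp T p)" by (simp add: T'_def)
  qed
  then show "word_at T' w = word_at T w" by (rule word_at_eqI)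
  show "word_at T' (opp T w) = Letter g"
    using tree_graph.word_at_leaf[OF tree(1), of "opp T w"] wh by (simp add: T'_def)
qed

text \<open>Here the vertices change as sets, so acyclicity and connectedness have to be proved
  anew. The four subtrees at the ends of \<open>e\<close> are untouched, and a walk that has entered
  one of them stays there, so it is a walk of the old tree.\<close>

lemma regraft_tree:
  fixes a' b' c' d' :: nat
  assumes e: "e \<in> half_edges T" "rot T e \<noteq> e" "rot T (opp T e) \<noteq> opp T e"
    and perm: "distinct [a', b', c', d']"
      "{a', b', c', d'} = {rot T e, rot T (rot T e), rot T (opp T e), rot T (rot T (opp T e))}"
  defines "T' \<equiv> regraft T e (a', b') (c', d')"
  shows "tree_graph T'" "leaves T' = leaves T"
    "word_at T' e = Bracket (word_at T c') (word_at T d')"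
    "word_at T' (opp T e) = Bracket (word_at T a') (word_at T b')"
proof -
  define o' a b c d where "o' = opp T e" and "a = rot T e" and "b = rot T a"
    and "c = rot T o'" and "d = rot T c"
  define X where "X = {a, b, e, c, d, o'}"
  have T': "T' = T\<lparr>rot := (rot T)(a' := b', b' := e, e := a', o' := c', c' := d', d' := o')\<rparr>"
    by (simp add: T'_def regraft_def o'_def)
  have perm': "{a', b', c', d'} = {a, b, c, d}"
    using perm by (simp add: a_def b_def c_def d_def o'_def)
  have h: "a \<in> half_edges T" "b \<in> half_edges T" "c \<in> half_edges T" "d \<in> half_edges T"
      "o' \<in> half_edges T"
    and r: "rot T e = a" "rot T a = b" "rot T b = e" "rot T o' = c" "rot T c = d" "rot T d = o'"
    using e by (auto simp: a_def b_def c_def d_def o'_def)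
  have ne: "a \<noteq> e" "b \<noteq> e" "a \<noteq> b" "c \<noteq> o'" "d \<noteq> o'" "c \<noteq> d" "o' \<noteq> e"
    using e h rot_rot_neq[of e] rot_rot_neq[of o'] by (auto simp: a_def b_def c_def d_def o'_def)
  have ve: "vertex_of T e = {a, b, e}" and vo: "vertex_of T o' = {c, d, o'}"
    using r by (auto simp: vertex_of_def)
  have "o' \<notin> vertex_of T e"
  proof
    assume "o' \<in> vertex_of T e"
    then have "(o', o') \<in> walk_step T"
      using walk_step_vertex[OF e(1), of o'] ne(7) by (simp add: o'_def)
    then show False using no_cycle by blast
  qed
  then have disj: "vertex_of T e \<inter> vertex_of T o' = {}"
    using vertex_of_eq[OF e(1)] vertex_of_eq[OF h(5)] self_in_vertex_of[of o'] by blast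
  have dist: "distinct [a, b, e, c, d, o']"
    using ne disj[unfolded ve vo] by auto
  have e_notin: "e \<notin> {a', b', c', d'}" "o' \<notin> {a', b', c', d'}"
    unfolding perm' using dist by auto
  have dist': "distinct [a', b', e, c', d', o']"
    using perm(1) e_notin ne by auto
  have X': "X = {a', b', e, c', d', o'}"
    using perm' by (auto simp: X_def)
  have hX: "X \<subseteq> half_edges T"
    using h e by (auto simp: X_def)
  have off: "rot T u \<notin> X" if "u \<in> half_edges T" "u \<notin> X" for u
  proof
    assume "rot T u \<in> X"
    moreover have "\<And>v. v \<in> X \<Longrightarrow> \<exists>u\<in>X. rot T u = v"
      using r by (auto simp: X_def)
    ultimately obtain v where v: "v \<in> X" "rot T v = rot T u"
      by auto
    then have "v \<in> half_edges T" using hX by blast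
    then have "v = u" using rot_inj that(1) v(2) by blast
    with v that(2) show False by simp
  qed
  have rot_off: "rot T' u = rot T u" if "u \<notin> X" for u
    using that by (simp add: T' X')
  have rot_on: "rot T' a' = b'" "rot T' b' = e" "rot T' e = a'"
    "rot T' c' = d'" "rot T' d' = o'" "rot T' o' = c'"
    using dist' by (auto simp: T')
  have uni': "unitrivalent_graph T'"
    unfolding unitrivalent_graph_def
  proof (intro conjI ballI)
    show "finite (half_edges T')" using finite_half_edges by (simp add: T')
    fix u assume "u \<in> half_edges T'"
    then have u: "u \<in> half_edges T" by (simp add: T')
    show "opp T' u \<in> half_edges T'" "opp T' u \<noteq> u" "opp T' (opp T' u) = u"
      using u by (simp_all add: T')
    have "rot T' u \<in> half_edges T \<and> rot T' (rot T' (rot T' u)) = u"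
    proof (cases "u \<in> X")
      case True
      then show ?thesis using rot_on hX by (auto simp: X')
    next
      case False
      then show ?thesis
        using off[of u] off[of "rot T u"] u by (simp add: rot_off)
    qed
    then show "rot T' u \<in> half_edges T'" "rot T' (rot T' (rot T' u)) = u"
      by (simp_all add: T')
  qed
  then interpret T': uni_graph T' by (simp add: uni_graph_def)
  have he: "half_edges T' = half_edges T" and opp': "opp T' = opp T" and lab': "lab T' = lab T"
    by (simp_all add: T')
  show leaves': "leaves T' = leaves T"
  proof -
    have "rot T' u = u \<longleftrightarrow> rot T u = u" for u
    proof (cases "u \<in> X")
      case True
      then have "rot T' u \<noteq> u" using rot_on dist' unfolding X' by auto
      moreover from True have "rot T u \<noteq> u" using r dist unfolding X_def by auto
      ultimately show ?thesis by simp
    qed (simp add: rot_off)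
    then show ?thesis by (simp add: leaves_def he)
  qed
  have avoid: "vertex_of T (opp T p) \<inter> X = {}"
    if i: "i \<in> {a, b, c, d}" and p: "(i, p) \<in> (walk_step T)\<^sup>*" for i p
  proof -
    have "X = vertex_of T e \<union> vertex_of T o'" using ve vo by (auto simp: X_def)
    moreover have "vertex_of T (opp T p) \<inter> vertex_of T e = {} \<and>
        vertex_of T (opp T p) \<inter> vertex_of T o' = {}"
    proof (cases "i \<in> {a, b}")
      case True
      then have v: "i \<in> vertex_of T e" "i \<noteq> e" using ve ne by auto
      then show ?thesis
        using beyond_avoids_vertex[OF _ p] vertex_of_eq[OF e(1) v(1)] vertex_of_closed[OF e(1) v(1)]
          beyond_avoids_opposite_vertex[OF e(1) v p] by (simp add: o'_def)
    next
      case False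
      then have v: "i \<in> vertex_of T o'" "i \<noteq> o'" using i vo ne by auto
      then show ?thesis
        using beyond_avoids_vertex[OF _ p] vertex_of_eq[OF h(5) v(1)] vertex_of_closed[OF h(5) v(1)]
          beyond_avoids_opposite_vertex[OF h(5) v p] e(1) by (simp add: o'_def)
    qed
    ultimately show ?thesis by blast
  qed
  have br: "branch T' i (word_at T i)" if i: "i \<in> {a, b, c, d}" for i
  proof (rule branch_cong[OF branch_word_at])
    show "i \<in> half_edges T" "i \<in> half_edges T" using i h by auto
    show "opp T' = opp T" "uni_graph T" by (simp_all add: T' uni_graph_axioms)
    fix p v assume p: "(i, p) \<in> (walk_step T)\<^sup>*"
    show "lab T' (opp T p) = lab T (opp T p)" by (simp add: T')
    show "rot T' v = rot T v" if "v \<in> vertex_of T (opp T p)"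
      using avoid[OF i p] that by (intro rot_off) blast
  qed
  have ne': "c' \<noteq> o'" "a' \<noteq> e" using dist' by auto
  have "branch T' e (Bracket (word_at T c') (word_at T d'))"
    by (rule branch.node)
      (use br[of c'] br[of d'] perm' ne' rot_on in \<open>auto simp: opp' simp flip: o'_def\<close>)
  then show "word_at T' e = Bracket (word_at T c') (word_at T d')"
    by (rule word_at_eqI)
  have "opp T' (opp T e) = e" using e by (simp add: opp')
  then have "branch T' (opp T e) (Bracket (word_at T a') (word_at T b'))"
    by (intro branch.node)
      (use br[of a'] br[of b'] perm' ne' rot_on in auto)
  then show "word_at T' (opp T e) = Bracket (word_at T a') (word_at T b')"
    by (rule word_at_eqI)
  \<comment> \<open>The half-edges that lead into the four subtrees or lie in them, directed away
    from \<open>e\<close>.\<close>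
  define P where "P = {p. \<exists>i\<in>{a, b, c, d}. (i, p) \<in> (walk_step T)\<^sup>*}"
  have P_vertex: "vertex_of T (opp T p) \<inter> X = {}" if "p \<in> P" for p
    using that avoid by (auto simp: P_def)
  have P_closed: "p \<in> half_edges T" if "p \<in> P" for p
    using that h walk_closed by (auto simp: P_def)
  have P_walk: "(p, q) \<in> walk_step T \<and> q \<in> P" if pq: "(p, q) \<in> walk_step T'" and p: "p \<in> P" for p q
  proof -
    have "opp T p \<notin> X" "rot T (opp T p) \<notin> X"
      using P_vertex[OF p] by (auto simp: vertex_of_def)
    then have "vertex_of T' (opp T p) = vertex_of T (opp T p)"
      by (simp add: vertex_of_def rot_off)
    then have "(p, q) \<in> walk_step T"
      using pq by (simp add: walk_step_def he opp')
    moreover from this have "q \<in> P"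
      using p by (auto simp: P_def intro: rtrancl_into_rtrancl)
    ultimately show ?thesis by simp
  qed
  have P_trancl: "(p, q) \<in> (walk_step T)\<^sup>+ \<and> q \<in> P"
    if "(p, q) \<in> (walk_step T')\<^sup>+" "p \<in> P" for p q
    using that
  proof (induction rule: trancl_induct)
    case (base q)
    then show ?case using P_walk by blast
  next
    case (step q s)
    then show ?case using P_walk by (meson trancl_into_trancl)
  qed
  have into_P: "q \<in> P" if "(x, q) \<in> walk_step T'" "x \<in> {e, o'}" for x q
  proof -
    have "opp T x \<in> {e, o'}" using that(2) e by (auto simp: o'_def)
    then have "q \<in> {a', b', c', d'}"
      using that rot_on by (auto simp: walk_step_def opp' vertex_of_def)
    then show ?thesis unfolding perm' by (auto simp: P_def)
  qed
  have notin_P: "x \<notin> P" if "x \<in> {e, o'}" for x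
  proof
    assume "x \<in> P"
    then obtain i where i: "i \<in> {a, b, c, d}" "(i, x) \<in> (walk_step T)\<^sup>*"
      by (auto simp: P_def)
    from avoid[OF i] have "opp T x \<notin> X" using self_in_vertex_of by blast
    moreover have "opp T x \<in> X" using that e by (auto simp: o'_def X_def)
    ultimately show False by simp
  qed
  have cover: "u \<in> P \<or> opp T u \<in> P \<or> u \<in> {e, o'}" if u: "u \<in> half_edges T" for u
  proof -
    have oo: "opp T o' = e" using e(1) by (simp add: o'_def)
    have "beyond e = insert e (beyond c \<union> beyond d)"
      using beyond_node[OF e(1,3)] by (simp only: o'_def[symmetric] r)
    moreover have "beyond o' = insert o' (beyond a \<union> beyond b)"
      using beyond_node[OF h(5)] ne(1) by (simp add: oo r)
    ultimately have sub: "beyond e \<subseteq> insert e P" "beyond o' \<subseteq> insert o' P"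
      by (auto simp: P_def beyond_def)
    have "u \<in> insert e P \<union> insert o' P \<or> opp T u \<in> insert e P \<union> insert o' P"
      using beyond_cover[OF e(1) u] sub unfolding o'_def by blast
    moreover have "opp T u = e \<Longrightarrow> u = o'" "opp T u = o' \<Longrightarrow> u = e"
      using u e(1) opp_opp by (auto simp: o'_def opp_inj)
    ultimately show ?thesis by blast
  qed
  have trancl_rev: "(opp T y, opp T x) \<in> (walk_step T')\<^sup>+" if "(x, y) \<in> (walk_step T')\<^sup>+" for x y
    using that
  proof (induction rule: trancl_induct)
    case (base y)
    then show ?case using T'.walk_step_reverse opp' by auto
  next
    case (step y z)
    then show ?case using T'.walk_step_reverse opp' by (metis trancl_into_trancl2)
  qed
  have acyc: "acyclic (walk_step T')"
    unfolding acyclic_def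
  proof (intro allI notI)
    fix x assume x: "(x, x) \<in> (walk_step T')\<^sup>+"
    then have xh: "x \<in> half_edges T"
      using T'.walk_step_closed he by (auto elim: converse_tranclE)
    have notP: "False" if "(y, y) \<in> (walk_step T')\<^sup>+" "y \<in> P" for y
      using P_trancl[OF that] no_cycle by blast
    \<comment> \<open>A closed walk in \<open>P\<close> would be closed in \<open>T\<close>; if only
      the opposite half-edge is in \<open>P\<close>, reverse the walk; and a walk through an end of
      \<open>e\<close> enters \<open>P\<close> at its next step and cannot come back.\<close>
    from cover[OF xh] show False
    proof (elim disjE)
      assume "x \<in> {e, o'}"
      obtain q where q: "(x, q) \<in> walk_step T'" "q = x \<or> (q, x) \<in> (walk_step T')\<^sup>+"
        using x by (meson tranclD rtrancl_eq_or_trancl)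
      then have "q \<in> P" using into_P \<open>x \<in> {e, o'}\<close> by blast
      then have "x \<in> P" using q(2) P_trancl by blast
      then show False using notin_P \<open>x \<in> {e, o'}\<close> by blast
    qed (use notP trancl_rev[OF x] x in auto)
  qed
  have conn: "connected_graph T'"
  proof (rule T'.connectedI)
    show "e \<in> half_edges T'" using e he by simp
    fix Q x
    assume x: "x \<in> half_edges T'" and Q: "Q e"
      and Q_opp: "\<And>x. x \<in> half_edges T' \<Longrightarrow> Q x \<Longrightarrow> Q (opp T' x)"
      and Q_rot: "\<And>x. x \<in> half_edges T' \<Longrightarrow> Q x \<Longrightarrow> Q (rot T' x)"
    have hX': "X \<subseteq> half_edges T'" using hX he by simp
    have "Q o'" using Q_opp[of e] Q e he opp' by (simp add: o'_def)
    moreover have "Q a'" using Q_rot[of e] Q e he rot_on by simp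
    moreover from this have "Q b'" using Q_rot[of a'] hX' rot_on by (simp add: X')
    moreover have "Q c'" using Q_rot[of o'] \<open>Q o'\<close> h he rot_on by simp
    moreover from this have "Q d'" using Q_rot[of c'] hX' rot_on by (simp add: X')
    ultimately have QX: "Q u" if "u \<in> X" for u using that Q by (auto simp: X')
    have QP: "Q p" if "i \<in> {a, b, c, d}" "(i, p) \<in> (walk_step T)\<^sup>*" for i p
      using that(2)
    proof (induction rule: rtrancl_induct)
      case base
      then show ?case using QX that(1) by (auto simp: X_def)
    next
      case (step p q)
      have ph: "opp T p \<in> half_edges T'" using step.hyps(2) walk_step_closed he by auto
      have Qo: "Q (opp T p)" using Q_opp step walk_step_closed he opp' by metis
      have "opp T p \<notin> X" "rot T (opp T p) \<notin> X"
        using avoid[OF that(1) step.hyps(1)] by (auto simp: vertex_of_def)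
      then have "Q (rot T (opp T p))" "Q (rot T (rot T (opp T p)))"
        using Q_rot[OF ph Qo] Q_rot[of "rot T (opp T p)"] ph he
        by (simp_all add: rot_off)
      then show ?case
        using step.hyps(2) by (auto simp: walk_step_def vertex_of_def)
    qed
    have "Q u" if "u \<in> P" for u using that QP by (auto simp: P_def)
    then show "Q x"
      using cover[of x] x Q_opp[of "opp T x"] QX[of x] he opp' by (auto simp: X_def)
  qed
  show "tree_graph T'"
    using conn acyc by unfold_locales
qed

end

section \<open>The tree obtained from two rooted trees by joining their roots\<close>

text \<open>
  Positions in a word are lists of directions, innermost direction first. In
  \<open>joined_tree s t\<close>, every position \<open>p \<noteq> []\<close> of \<open>Bracket s t\<close> gives a half-edge \<open>(True, p)\<close>
  that points away from the root; its opposite is \<open>(False, p)\<close>, except that \<open>(True, [False])\<close>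
  and \<open>(True, [True])\<close> are opposite to each other, because the root itself is erased.
\<close>

fun subword :: "'h word \<Rightarrow> bool list \<Rightarrow> 'h word option" where
  "subword u [] = Some u"
| "subword u (i # p) =
    (case subword u p of Some (Bracket s t) \<Rightarrow> Some (if i then t else s) | _ \<Rightarrow> None)"

definition is_node :: "'h word \<Rightarrow> bool list \<Rightarrow> bool" where
  "is_node u p \<longleftrightarrow> (\<exists>s t. subword u p = Some (Bracket s t))"

definition is_position :: "'h word \<Rightarrow> bool list \<Rightarrow> bool" where
  "is_position u p \<longleftrightarrow> subword u p \<noteq> None"

lemma is_position_Cons: "is_position u (i # p) \<longleftrightarrow> is_node u p"
  by (auto simp: is_position_def is_node_def split: option.splits word.splits)

lemma is_node_position: "is_node u p \<Longrightarrow> is_position u p"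
  by (auto simp: is_position_def is_node_def)

lemma not_node_Letter:
  "is_position u p \<Longrightarrow> \<not> is_node u p \<Longrightarrow> \<exists>h. subword u p = Some (Letter h)"
  by (auto simp: is_position_def is_node_def) (metis word.exhaust)

lemma subword_degree:
  "subword u p = Some v \<Longrightarrow> length p + word_degree v \<le> word_degree u"
proof (induction p arbitrary: v)
  case (Cons i p)
  then obtain s t where "subword u p = Some (Bracket s t)" "v = (if i then t else s)"
    by (auto split: option.splits word.splits)
  with Cons.IH[of "Bracket s t"] show ?case
    using word_degree_pos[of s] word_degree_pos[of t] by auto
qed simp

lemma finite_positions: "finite {p. is_position u p}"
proof (rule finite_subset)
  show "{p. is_position u p} \<subseteq> {p. set p \<subseteq> UNIV \<and> length p \<le> word_degree u}"
    using subword_degree by (fastforce simp: is_position_def)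
  show "finite {p :: bool list. set p \<subseteq> UNIV \<and> length p \<le> word_degree u}"
    by (rule finite_lists_length_le) simp
qed

lemma subword_letters: "subword u p = Some v \<Longrightarrow> set_word v \<subseteq> set_word u"
proof (induction p arbitrary: v)
  case (Cons i p)
  then obtain s t where "subword u p = Some (Bracket s t)" "v = (if i then t else s)"
    by (auto split: option.splits word.splits)
  with Cons.IH[of "Bracket s t"] show ?case by auto
qed simp

definition joined_half_edges :: "'h word \<Rightarrow> (bool \<times> bool list) set" where
  "joined_half_edges u = {(d, p). is_position u p \<and> p \<noteq> [] \<and> (d \<or> tl p \<noteq> [])}"

fun joined_opp :: "bool \<times> bool list \<Rightarrow> bool \<times> bool list" where
  "joined_opp (d, [i]) = (True, [\<not> i])"
| "joined_opp (d, p) = (\<not> d, p)"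

text \<open>The cyclic order at a node is (towards the root, first subtree, second subtree), as in
  \<open>branch\<close>. Since the root is erased, \<open>(True, [i])\<close> starts at position
  \<open>[\<not> i]\<close> and is the half-edge towards the root there.\<close>

fun joined_rot :: "'h word \<Rightarrow> bool \<times> bool list \<Rightarrow> bool \<times> bool list" where
  "joined_rot u (True, i # j # p) = (if i then joined_opp (True, j # p) else (True, True # j # p))"
| "joined_rot u (True, [i]) = (if is_node u [\<not> i] then (True, [False, \<not> i]) else (True, [i]))"
| "joined_rot u (d, p) = (if is_node u p then (True, False # p) else (d, p))"

fun joined_lab :: "'h word \<Rightarrow> bool \<times> bool list \<Rightarrow> 'h" where
  "joined_lab u (True, [i]) = (case subword u [\<not> i] of Some (Letter h) \<Rightarrow> h | _ \<Rightarrow> undefined)"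
| "joined_lab u (d, p) = (case subword u p of Some (Letter h) \<Rightarrow> h | _ \<Rightarrow> undefined)"

definition joined_tree :: "'h word \<Rightarrow> 'h word \<Rightarrow> 'h half_edge_graph" where
  "joined_tree s t = (let u = Bracket s t in
     \<lparr>half_edges = to_nat ` joined_half_edges u,
      opp = to_nat \<circ> joined_opp \<circ> from_nat,
      rot = to_nat \<circ> joined_rot u \<circ> from_nat,
      lab = joined_lab u \<circ> from_nat\<rparr>)"

lemma joined_half_edge_cases [consumes 1, case_names root down up]:
  assumes "x \<in> joined_half_edges u"
    and "\<And>i. x = (True, [i]) \<Longrightarrow> is_position u [i] \<Longrightarrow> is_node u [] \<Longrightarrow> P"
    and "\<And>i j p. x = (True, i # j # p) \<Longrightarrow> is_position u (i # j # p) \<Longrightarrow> is_node u (j # p) \<Longrightarrow> P"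
    and "\<And>i j p. x = (False, i # j # p) \<Longrightarrow> is_position u (i # j # p) \<Longrightarrow> is_node u (j # p) \<Longrightarrow> P"
  shows P
proof -
  obtain d p where x: "x = (d, p)" by fastforce
  show P
  proof (cases p rule: remdups_adj.cases)
    case 1
    then show P using assms(1) x by (simp add: joined_half_edges_def)
  next
    case (2 i)
    then show P
      using assms(1,2) x by (auto simp: joined_half_edges_def is_position_Cons)
  next
    case (3 i j q)
    then show P
      using assms(1,3,4) x by (cases d) (auto simp: joined_half_edges_def is_position_Cons)
  qed
qed

lemma joined_opp_closed: "x \<in> joined_half_edges u \<Longrightarrow> joined_opp x \<in> joined_half_edges u"
  by (cases rule: joined_half_edge_cases)
    (auto simp: joined_half_edges_def is_position_Cons)

lemma joined_opp_opp: "x \<in> joined_half_edges u \<Longrightarrow> joined_opp (joined_opp x) = x"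
  by (cases rule: joined_half_edge_cases) auto

lemma joined_opp_neq: "x \<in> joined_half_edges u \<Longrightarrow> joined_opp x \<noteq> x"
  by (cases rule: joined_half_edge_cases) auto

lemma joined_rot_opp:
  assumes "p \<noteq> []" "is_position u p"
  shows "joined_rot u (joined_opp (True, p)) =
    (if is_node u p then (True, False # p) else joined_opp (True, p))"
  using assms by (cases p rule: remdups_adj.cases) auto

lemma joined_rot_False:
  "p \<noteq> [] \<Longrightarrow> joined_rot u (True, False # p) = (True, True # p)"
  by (cases p) auto

lemma joined_rot_True:
  "p \<noteq> [] \<Longrightarrow> joined_rot u (True, True # p) = joined_opp (True, p)"
  by (cases p) auto

lemma joined_vertex_cases [consumes 1, case_names root left right]:
  assumes "x \<in> joined_half_edges u"
    and "\<And>p. x = joined_opp (True, p) \<Longrightarrow> p \<noteq> [] \<Longrightarrow> is_position u p \<Longrightarrow> P"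
    and "\<And>p. x = (True, False # p) \<Longrightarrow> p \<noteq> [] \<Longrightarrow> is_node u p \<Longrightarrow> P"
    and "\<And>p. x = (True, True # p) \<Longrightarrow> p \<noteq> [] \<Longrightarrow> is_node u p \<Longrightarrow> P"
  shows P
  using assms(1)
proof (cases rule: joined_half_edge_cases)
  case (root i)
  then show P using assms(2)[of "[\<not> i]"] by (simp add: is_position_Cons)
next
  case (down i j p)
  then show P using assms(3,4)[of "j # p"] by (cases i) auto
next
  case (up i j p)
  then show P using assms(2)[of "i # j # p"] by simp
qed

lemma down_in_joined: "p \<noteq> [] \<Longrightarrow> is_position u p \<Longrightarrow> (True, p) \<in> joined_half_edges u"
  by (simp add: joined_half_edges_def)

lemma joined_rot_closed: "x \<in> joined_half_edges u \<Longrightarrow> joined_rot u x \<in> joined_half_edges u"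
  by (cases rule: joined_vertex_cases)
    (auto simp: joined_rot_opp joined_rot_False joined_rot_True is_position_Cons is_node_position
      intro!: joined_opp_closed down_in_joined)

lemma joined_rot_rot_rot:
  "x \<in> joined_half_edges u \<Longrightarrow> joined_rot u (joined_rot u (joined_rot u x)) = x"
  by (cases rule: joined_vertex_cases)
    (auto simp: joined_rot_opp joined_rot_False joined_rot_True is_node_position)

lemma joined_rot_fixed:
  assumes "x \<in> joined_half_edges u" "joined_rot u x = x"
  obtains p where "x = joined_opp (True, p)" "p \<noteq> []" "is_position u p" "\<not> is_node u p"
  using assms(1)
proof (cases rule: joined_vertex_cases)
  case (root p)
  have "(True, False # p) \<noteq> joined_opp (True, p)"
    by (cases p rule: remdups_adj.cases) auto
  then have "\<not> is_node u p"
    using assms(2) root by (auto simp: joined_rot_opp)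
  then show thesis by (rule that[OF root])
next
  case (left p)
  then show thesis using assms(2) by (simp add: joined_rot_False)
next
  case (right p)
  then show thesis using assms(2)
    by (cases p rule: remdups_adj.cases) (auto simp: joined_rot_True)
qed

lemma joined_lab_opp:
  "p \<noteq> [] \<Longrightarrow> subword u p = Some (Letter h) \<Longrightarrow> joined_lab u (joined_opp (True, p)) = h"
  by (cases p rule: remdups_adj.cases) (auto split: option.splits word.splits)

lemma joined_tree_sel:
  "half_edges (joined_tree s t) = to_nat ` joined_half_edges (Bracket s t)"
  "opp (joined_tree s t) (to_nat x) = to_nat (joined_opp x)"
  "rot (joined_tree s t) (to_nat x) = to_nat (joined_rot (Bracket s t) x)"
  "lab (joined_tree s t) (to_nat x) = joined_lab (Bracket s t) x"
  by (simp_all add: joined_tree_def Let_def)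

definition joined_rank :: "bool \<times> bool list \<Rightarrow> int" where
  "joined_rank x = (if fst x then int (length (snd x)) else - int (length (snd x)))"

text \<open>A walk first climbs towards the root and then descends.\<close>

lemma joined_rank_less:
  assumes "x \<in> joined_half_edges u" "joined_rot u (joined_opp x) \<noteq> joined_opp x"
  shows "joined_rank x < joined_rank (joined_rot u (joined_opp x))"
    and "joined_rank x < joined_rank (joined_rot u (joined_rot u (joined_opp x)))"
proof -
  have "joined_rank x < joined_rank (joined_rot u (joined_opp x)) \<and>
      joined_rank x < joined_rank (joined_rot u (joined_rot u (joined_opp x)))"
    using assms(1)
  proof (cases rule: joined_half_edge_cases)
    case (root i)
    then show ?thesis
      using assms(2) by (auto simp: joined_rank_def joined_rot_False split: if_splits)
  next
    case (down i j p)
    then show ?thesis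
      using assms(2) by (auto simp: joined_rank_def joined_rot_False split: if_splits)
  next
    case (up i j p)
    then show ?thesis
      by (cases i; cases p) (auto simp: joined_rank_def is_node_position)
  qed
  then show "joined_rank x < joined_rank (joined_rot u (joined_opp x))"
    "joined_rank x < joined_rank (joined_rot u (joined_rot u (joined_opp x)))" by auto
qed

lemma tree_graph_joined_tree: "tree_graph (joined_tree s t)"
proof -
  let ?T = "joined_tree s t" and ?u = "Bracket s t"
  have "finite (joined_half_edges ?u)"
    by (rule finite_subset[of _ "UNIV \<times> {p. is_position ?u p}"])
      (auto simp: joined_half_edges_def finite_positions)
  then interpret uni_graph ?T
    by unfold_locales
      (auto simp: unitrivalent_graph_def joined_tree_sel joined_opp_closed joined_opp_neq
        joined_opp_opp joined_rot_closed joined_rot_rot_rot)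
  have node: "is_node ?u []" by (simp add: is_node_def)
  have pos: "is_position ?u [i]" for i by (simp add: is_position_Cons node)
  have "connected_graph ?T"
  proof (rule connectedI)
    show "to_nat (True, [False]) \<in> half_edges ?T"
      using pos by (auto simp: joined_tree_sel intro!: imageI down_in_joined)
    fix P x
    assume x: "x \<in> half_edges ?T" and base: "P (to_nat (True, [False]))"
      and P_opp: "\<And>x. x \<in> half_edges ?T \<Longrightarrow> P x \<Longrightarrow> P (opp ?T x)"
      and P_rot: "\<And>x. x \<in> half_edges ?T \<Longrightarrow> P x \<Longrightarrow> P (rot ?T x)"
    have P_opp': "P (to_nat (joined_opp y))" if "y \<in> joined_half_edges ?u" "P (to_nat y)" for y
      using P_opp[of "to_nat y"] that by (simp add: joined_tree_sel)
    have P_rot': "P (to_nat (joined_rot ?u y))" if "y \<in> joined_half_edges ?u" "P (to_nat y)" for y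
      using P_rot[of "to_nat y"] that by (simp add: joined_tree_sel)
    have down: "P (to_nat (True, p))" if "p \<noteq> []" "is_position ?u p" for p
      using that
    proof (induction p)
      case (Cons i p)
      show ?case
      proof (cases "p = []")
        case True
        have "P (to_nat (True, [True]))"
          using P_opp'[of "(True, [False])"] base pos by (simp add: down_in_joined)
        then show ?thesis using base True by (cases i) auto
      next
        case False
        have p: "is_node ?u p" "is_position ?u p"
          using Cons.prems by (simp_all add: is_position_Cons is_node_position)
        have in_u: "joined_opp (True, p) \<in> joined_half_edges ?u"
          "(True, False # p) \<in> joined_half_edges ?u"
          using p False by (auto intro!: joined_opp_closed down_in_joined simp: is_position_Cons)
        have "P (to_nat (joined_opp (True, p)))"
          using P_opp' Cons.IH False p down_in_joined by blast
        then have f: "P (to_nat (True, False # p))"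
          using P_rot'[OF in_u(1)] p False by (simp add: joined_rot_opp)
        then have "P (to_nat (True, True # p))"
          using P_rot'[OF in_u(2)] False by (simp add: joined_rot_False)
        with f show ?thesis by (cases i) auto
      qed
    qed simp
    from x obtain y where y: "y \<in> joined_half_edges ?u" "x = to_nat y"
      by (auto simp: joined_tree_sel)
    from y(1) show "P x"
    proof (cases rule: joined_vertex_cases)
      case (root p)
      then show ?thesis using P_opp'[of "(True, p)"] down down_in_joined y(2) by blast
    qed (use down y(2) is_position_Cons in blast)+
  qed
  moreover have "acyclic (walk_step ?T)"
  proof -
    have step: "joined_rank (from_nat x) < joined_rank (from_nat y)"
      if xy: "(x, y) \<in> walk_step ?T" for x y
    proof -
      have "x \<in> half_edges ?T" using xy walk_step_closed by blast
      then obtain x' where x': "x' \<in> joined_half_edges ?u" "x = to_nat x'"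
        by (auto simp: joined_tree_sel)
      then show ?thesis
        using xy[unfolded walk_step_iff[OF \<open>x \<in> half_edges ?T\<close>]] joined_rank_less[OF x'(1)]
        by (auto simp: joined_tree_sel)
    qed
    have "joined_rank (from_nat x) < joined_rank (from_nat y)"
      if "(x, y) \<in> (walk_step ?T)\<^sup>+" for x y
      using that by (induction rule: trancl_induct) (auto dest: step)
    then show ?thesis by (fastforce simp: acyclic_def)
  qed
  ultimately show ?thesis by unfold_locales
qed

lemma branch_joined_tree:
  assumes "p \<noteq> []" "subword (Bracket s t) p = Some v"
  shows "branch (joined_tree s t) (to_nat (True, p)) v"
  using assms
proof (induction v arbitrary: p)
  case (Letter h)
  then have p: "is_position (Bracket s t) p" "\<not> is_node (Bracket s t) p"
    by (auto simp: is_position_def is_node_def)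
  have "branch (joined_tree s t) (to_nat (True, p))
      (Letter (lab (joined_tree s t) (opp (joined_tree s t) (to_nat (True, p)))))"
    by (rule branch.leaf) (use p Letter in \<open>simp add: joined_tree_sel joined_rot_opp\<close>)
  then show ?case
    using Letter by (simp add: joined_tree_sel joined_lab_opp)
next
  case (Bracket v w)
  then have p: "is_position (Bracket s t) p" "is_node (Bracket s t) p"
    by (auto simp: is_position_def is_node_def)
  have "(True, False # p) \<noteq> joined_opp (True, p)"
    by (cases p rule: remdups_adj.cases) auto
  then show ?case
    by (intro branch.node)
      (use p Bracket in \<open>simp_all add: joined_tree_sel joined_rot_opp joined_rot_False\<close>)
qed

lemma word_at_joined_tree:
  obtains e where "e \<in> half_edges (joined_tree s t)" "word_at (joined_tree s t) e = s"
    "word_at (joined_tree s t) (opp (joined_tree s t) e) = t"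
proof
  show "to_nat (True, [False]) \<in> half_edges (joined_tree s t)"
    by (auto simp: joined_tree_sel joined_half_edges_def is_position_def)
  show "word_at (joined_tree s t) (to_nat (True, [False])) = s"
    by (rule word_at_eqI[OF branch_joined_tree]) auto
  have "word_at (joined_tree s t) (to_nat (True, [True])) = t"
    by (rule word_at_eqI[OF branch_joined_tree]) auto
  then show "word_at (joined_tree s t) (opp (joined_tree s t) (to_nat (True, [False]))) = t"
    by (simp add: joined_tree_sel)
qed

lemma lab_joined_tree:
  assumes "w \<in> leaves (joined_tree s t)"
  shows "lab (joined_tree s t) w \<in> set_word s \<union> set_word t"
proof -
  from assms obtain x where x: "x \<in> joined_half_edges (Bracket s t)" "w = to_nat x"
    "joined_rot (Bracket s t) x = x"
    by (auto simp: leaves_def joined_tree_sel)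
  from x(1,3) obtain p where p: "x = joined_opp (True, p)" "p \<noteq> []"
    "is_position (Bracket s t) p" "\<not> is_node (Bracket s t) p"
    by (rule joined_rot_fixed)
  then obtain h where h: "subword (Bracket s t) p = Some (Letter h)"
    using not_node_Letter by blast
  then have "lab (joined_tree s t) w = h"
    using p x by (simp add: joined_tree_sel joined_lab_opp)
  then show ?thesis using subword_letters[OF h] by simp
qed

section \<open>Recovering a tree from the two words at an edge\<close>

context tree_graph
begin

fun half_edge_at :: "nat \<Rightarrow> bool list \<Rightarrow> nat" where
  "half_edge_at e [] = e"
| "half_edge_at e [i] = (if i then opp T e else e)"
| "half_edge_at e (i # p) = (let r = rot T (opp T (half_edge_at e p)) in if i then rot T r else r)"

lemma half_edge_at_Cons:
  "p \<noteq> [] \<Longrightarrow> half_edge_at e (i # p) =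
    (if i then rot T (rot T (opp T (half_edge_at e p))) else rot T (opp T (half_edge_at e p)))"
  by (cases p) (auto simp: Let_def)

lemma half_edge_at_branch:
  assumes e: "e \<in> half_edges T"
    and "p \<noteq> []" "subword (Bracket (word_at T e) (word_at T (opp T e))) p = Some v"
  shows "half_edge_at e p \<in> half_edges T \<and> word_at T (half_edge_at e p) = v"
  using assms(2,3)
proof (induction p arbitrary: v)
  case (Cons i p)
  show ?case
  proof (cases "p = []")
    case True
    then show ?thesis using Cons.prems e by auto
  next
    case False
    from Cons.prems obtain s t where
      st: "subword (Bracket (word_at T e) (word_at T (opp T e))) p = Some (Bracket s t)"
        "v = (if i then t else s)"
      by (auto split: option.splits word.splits)
    have IH: "half_edge_at e p \<in> half_edges T" "word_at T (half_edge_at e p) = Bracket s t"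
      using Cons.IH[OF False st(1)] by auto
    then have "rot T (opp T (half_edge_at e p)) \<noteq> opp T (half_edge_at e p)"
      using word_at_leaf[of "half_edge_at e p"] by auto
    then show ?thesis
      using IH word_at_node[OF IH(1)] st(2) False by (auto simp: half_edge_at_Cons)
  qed
qed simp

text \<open>Positions in the two words correspond to half-edges of \<open>T\<close>, compatibly with
  \<open>opp\<close> and \<open>rot\<close>; \<open>graph_morphism_bij\<close> then yields
  bijectivity without an explicit inverse.\<close>

theorem joined_tree_iso:
  assumes e: "e \<in> half_edges T"
  shows "tree_iso (joined_tree (word_at T e) (word_at T (opp T e))) T"
proof -
  define s t where "s = word_at T e" and "t = word_at T (opp T e)"
  let ?C = "joined_tree s t" and ?u = "Bracket s t"
  interpret C: tree_graph ?C by (rule tree_graph_joined_tree)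
  define g where "g = (\<lambda>(d, p). if d then half_edge_at e p else opp T (half_edge_at e p))"
  define f where "f = g \<circ> (from_nat :: nat \<Rightarrow> bool \<times> bool list)"
  have at: "half_edge_at e p \<in> half_edges T" if "p \<noteq> []" "is_position ?u p" for p
    using half_edge_at_branch[OF e that(1)] that(2) by (auto simp: is_position_def s_def t_def)
  have node: "rot T (opp T (half_edge_at e p)) \<noteq> opp T (half_edge_at e p)"
    if "p \<noteq> []" "is_node ?u p" for p
    using half_edge_at_branch[OF e that(1)] that(2) word_at_leaf[of "half_edge_at e p"]
    by (auto simp: is_node_def s_def t_def)
  have leaf: "rot T (opp T (half_edge_at e p)) = opp T (half_edge_at e p) \<and>
      lab T (opp T (half_edge_at e p)) = h"
    if p: "p \<noteq> []" "subword ?u p = Some (Letter h)" for p h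
  proof -
    have "half_edge_at e p \<in> half_edges T" "word_at T (half_edge_at e p) = Letter h"
      using half_edge_at_branch[OF e p(1)] p(2) by (auto simp: s_def t_def)
    then show ?thesis
      using word_at_node[of "half_edge_at e p"] word_at_leaf[of "half_edge_at e p"]
      by (cases "rot T (opp T (half_edge_at e p)) = opp T (half_edge_at e p)") auto
  qed
  have g_opp: "g (joined_opp (True, p)) = opp T (half_edge_at e p)" if "p \<noteq> []" for p
    using that e by (cases p rule: remdups_adj.cases) (auto simp: g_def)
  have g_opp': "g (joined_opp x) = opp T (g x)" if x: "x \<in> joined_half_edges ?u" for x
    using x
  proof (cases rule: joined_half_edge_cases)
    case (root i)
    then show ?thesis using e by (auto simp: g_def)
  next
    case (down i j p)
    then show ?thesis by (simp add: g_def)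
  next
    case (up i j p)
    then show ?thesis using at[of "i # j # p"] by (simp add: g_def)
  qed
  have g_closed: "g x \<in> half_edges T" if "x \<in> joined_half_edges ?u" for x
    using that at by (auto simp: g_def joined_half_edges_def)
  have g_rot: "g (joined_rot ?u x) = rot T (g x) \<and>
      (joined_rot ?u x \<noteq> x \<longrightarrow> rot T (g x) \<noteq> g x)"
    if x: "x \<in> joined_half_edges ?u" for x
    using x
  proof (cases rule: joined_vertex_cases)
    case (root p)
    show ?thesis
    proof (cases "is_node ?u p")
      case True
      then show ?thesis
        using root node[of p] g_opp[of p]
        by (simp add: joined_rot_opp) (simp add: g_def half_edge_at_Cons)
    next
      case False
      then obtain h where "subword ?u p = Some (Letter h)"
        using root not_node_Letter by blast
      then show ?thesis
        using False root leaf[of p h] g_opp[of p] by (simp add: joined_rot_opp)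
    qed
  next
    case (left p)
    then show ?thesis
      using node[of p] at[of p]
      by (simp add: joined_rot_False is_node_position rot_inj)
        (simp add: g_def half_edge_at_Cons rot_inj)
  next
    case (right p)
    then show ?thesis
      using node[of p] at[of p] g_opp[of p] rot_rot_neq(1)[of "opp T (half_edge_at e p)"]
      by (simp add: joined_rot_True is_node_position)
        (auto simp: g_def half_edge_at_Cons rot_inj dest: sym)
  qed
  have f_opp: "f (opp ?C x) = opp T (f x)" if "x \<in> half_edges ?C" for x
    using that g_opp' by (auto simp: f_def joined_tree_sel)
  have f_rot: "f (rot ?C x) = rot T (f x)" if "x \<in> half_edges ?C" for x
    using that g_rot by (auto simp: f_def joined_tree_sel)
  have "bij_betw f (half_edges ?C) (half_edges T)"
  proof (rule graph_morphism_bij[OF C.conn_graph_axioms tree_graph_axioms])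
    show "f x \<in> half_edges T" if "x \<in> half_edges ?C" for x
      using that g_closed by (auto simp: f_def joined_tree_sel)
    show "rot T (f x) \<noteq> f x" if "x \<in> half_edges ?C" "rot ?C x \<noteq> x" for x
      using that g_rot by (auto simp: f_def joined_tree_sel)
  qed (use f_opp f_rot in auto)
  moreover have "lab T (f w) = lab ?C w" if "w \<in> leaves ?C" for w
  proof -
    from that obtain x where x: "x \<in> joined_half_edges ?u" "w = to_nat x" "joined_rot ?u x = x"
      by (auto simp: leaves_def joined_tree_sel)
    from x(1,3) obtain p where p: "x = joined_opp (True, p)" "p \<noteq> []"
      "is_position ?u p" "\<not> is_node ?u p"
      by (rule joined_rot_fixed)
    then obtain h where h: "subword ?u p = Some (Letter h)"
      using not_node_Letter by blast
    then show ?thesis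
      using p x leaf[OF p(2) h] g_opp[OF p(2)] by (simp add: f_def joined_tree_sel joined_lab_opp)
  qed
  ultimately show ?thesis
    using f_opp f_rot unfolding tree_iso_def s_def[symmetric] t_def[symmetric] by blast
qed

end

section \<open>Groups of cosets of finitely supported functions\<close>

definition frag_coset :: "'a::ab_group_add set \<Rightarrow> 'a \<Rightarrow> 'a set" where
  "frag_coset N p = (\<lambda>n. n + p) ` N"

lemma r_coset_free_Abelian_group: "N #>\<^bsub>free_Abelian_group S\<^esub> p = frag_coset N p"
  by (auto simp: r_coset_def frag_coset_def)

lemma mem_frag_coset: "q \<in> frag_coset N p \<longleftrightarrow> q - p \<in> N"
proof
  assume "q - p \<in> N"
  then show "q \<in> frag_coset N p"
    unfolding frag_coset_def by (intro image_eqI[of _ _ "q - p"]) auto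
qed (auto simp: frag_coset_def)

lemma frag_coset_eq_iff:
  assumes "additive_subset N"
  shows "frag_coset N p = frag_coset N q \<longleftrightarrow> p - q \<in> N"
proof
  assume "frag_coset N p = frag_coset N q"
  then have "p \<in> frag_coset N q"
    using additive_subset_zero[OF assms] by (auto simp: mem_frag_coset)
  then show "p - q \<in> N" by (simp add: mem_frag_coset)
next
  assume pq: "p - q \<in> N"
  have "x - p \<in> N \<longleftrightarrow> x - q \<in> N" for x
    using additive_subset_add[OF assms _ pq, of "x - p"] additive_subset_diff[OF assms _ pq, of "x - q"]
    by auto
  then show "frag_coset N p = frag_coset N q"
    by (auto simp: mem_frag_coset)
qed

lemma self_mem_frag_coset: "additive_subset N \<Longrightarrow> p \<in> frag_coset N p"
  by (simp add: mem_frag_coset additive_subset_zero)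

text \<open>A common interface to the presented groups, the graded pieces of L' and
  \<open>D_group\<close>. \<open>N\<close> may reach outside \<open>C\<close>: the degree
  \<open>n\<close> part of L' consists of the classes of homogeneous elements modulo the whole
  ideal.\<close>

locale coset_group =
  fixes C N :: "('a \<Rightarrow>\<^sub>0 int) set" and G :: "(('a \<Rightarrow>\<^sub>0 int) set, 'm) monoid_scheme"
  assumes additive_C: "additive_subset C" and additive_N: "additive_subset N"
    and carrier_G: "carrier G = frag_coset N ` C"
    and mult_G: "\<And>p q. p \<in> C \<Longrightarrow> q \<in> C \<Longrightarrow> frag_coset N p \<otimes>\<^bsub>G\<^esub> frag_coset N q = frag_coset N (p + q)"
    and one_G: "\<one>\<^bsub>G\<^esub> = frag_coset N 0"
begin

lemma comm_group_G: "comm_group G"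
proof (rule comm_groupI)
  note clos = additive_subset_add[OF additive_C] additive_subset_zero[OF additive_C]
  show "x \<otimes>\<^bsub>G\<^esub> y \<in> carrier G" if "x \<in> carrier G" "y \<in> carrier G" for x y
    using that clos by (auto simp: carrier_G mult_G)
  show "\<one>\<^bsub>G\<^esub> \<in> carrier G"
    using clos by (auto simp: carrier_G one_G)
  show "x \<otimes>\<^bsub>G\<^esub> y \<otimes>\<^bsub>G\<^esub> z = x \<otimes>\<^bsub>G\<^esub> (y \<otimes>\<^bsub>G\<^esub> z)"
    if "x \<in> carrier G" "y \<in> carrier G" "z \<in> carrier G" for x y z
    using that clos by (auto simp: carrier_G mult_G add.assoc)
  show "x \<otimes>\<^bsub>G\<^esub> y = y \<otimes>\<^bsub>G\<^esub> x" if "x \<in> carrier G" "y \<in> carrier G" for x y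
    using that by (auto simp: carrier_G mult_G add.commute)
  show "\<one>\<^bsub>G\<^esub> \<otimes>\<^bsub>G\<^esub> x = x" if "x \<in> carrier G" for x
    using that clos by (auto simp: carrier_G mult_G one_G)
  show "\<exists>y\<in>carrier G. y \<otimes>\<^bsub>G\<^esub> x = \<one>\<^bsub>G\<^esub>" if x: "x \<in> carrier G" for x
  proof -
    obtain p where p: "p \<in> C" "x = frag_coset N p" using x by (auto simp: carrier_G)
    then have "- p \<in> C" using additive_subset_minus additive_C by blast
    then show ?thesis
      using p by (intro bexI[of _ "frag_coset N (- p)"]) (auto simp: carrier_G mult_G one_G)
  qed
qed

sublocale comm_group G by (rule comm_group_G)

lemma coset_closed: "p \<in> C \<Longrightarrow> frag_coset N p \<in> carrier G"
  by (auto simp: carrier_G)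

lemma coset_eq_iff: "frag_coset N p = frag_coset N q \<longleftrightarrow> p - q \<in> N"
  by (rule frag_coset_eq_iff[OF additive_N])

lemma coset_eq_one_iff: "frag_coset N p = \<one>\<^bsub>G\<^esub> \<longleftrightarrow> p \<in> N"
  by (simp add: one_G coset_eq_iff)

lemma nat_pow_coset:
  "p \<in> C \<Longrightarrow> frag_coset N p [^]\<^bsub>G\<^esub> (n::nat) = frag_coset N (frag_cmul (int n) p)"
proof (induction n)
  case 0
  then show ?case by (simp add: one_G)
next
  case (Suc n)
  have "frag_cmul (int n) p \<in> C"
    using additive_subset_cmul[OF additive_C Suc.prems] .
  then show ?case
    using Suc by (simp add: mult_G frag_cmul_distrib add.commute)
qed

lemma inv_coset: "p \<in> C \<Longrightarrow> inv\<^bsub>G\<^esub> (frag_coset N p) = frag_coset N (- p)"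
  using additive_subset_minus[OF additive_C]
  by (intro inv_equality) (auto simp: mult_G one_G coset_closed)

lemma int_pow_coset:
  assumes "p \<in> C"
  shows "frag_coset N p [^]\<^bsub>G\<^esub> (n::int) = frag_coset N (frag_cmul n p)"
proof (cases n rule: int_cases2)
  case (nonneg m)
  then show ?thesis using nat_pow_coset[OF assms] by (simp add: int_pow_int)
next
  case (nonpos m)
  have "frag_coset N p [^]\<^bsub>G\<^esub> n = inv\<^bsub>G\<^esub> (frag_coset N p [^]\<^bsub>G\<^esub> m)"
    using nonpos by (simp add: int_pow_neg coset_closed[OF assms] int_pow_int)
  also have "\<dots> = frag_coset N (- frag_cmul (int m) p)"
    using additive_subset_cmul[OF additive_C assms] by (simp add: nat_pow_coset[OF assms] inv_coset)
  finally show ?thesis using nonpos by simp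
qed

lemma finprod_coset:
  assumes "finite A" "\<And>a. a \<in> A \<Longrightarrow> \<phi> a \<in> C" "\<And>a. a \<in> A \<Longrightarrow> f a = frag_coset N (\<phi> a)"
  shows "finprod G f A = frag_coset N (\<Sum>a\<in>A. \<phi> a)"
  using assms
proof (induction A rule: finite_induct)
  case empty
  then show ?case by (simp add: one_G)
next
  case (insert a A)
  have "(\<Sum>a\<in>A. \<phi> a) \<in> C"
    using additive_subset_sum[OF additive_C] insert.prems(1) by blast
  moreover have "finprod G f (insert a A) = f a \<otimes>\<^bsub>G\<^esub> finprod G f A"
    by (rule finprod_insert) (use insert coset_closed in auto)
  ultimately show ?case using insert by (simp add: mult_G)
qed

lemma free_hom_coset:
  assumes "\<And>a. a \<in> S \<Longrightarrow> \<phi> a \<in> C" "\<And>a. a \<in> S \<Longrightarrow> f a = frag_coset N (\<phi> a)"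
    and "Poly_Mapping.keys p \<subseteq> S"
  shows "free_hom G f p = frag_coset N (frag_extend \<phi> p)"
  unfolding free_hom_def frag_extend_def
  by (rule finprod_coset) (use assms in \<open>auto simp: int_pow_coset additive_subset_cmul[OF additive_C]\<close>)

lemma induced_hom_coset:
  assumes \<phi>: "\<And>a. a \<in> S \<Longrightarrow> \<phi> a \<in> C" "\<And>a. a \<in> S \<Longrightarrow> f a = frag_coset N (\<phi> a)"
    and M: "additive_subset M" "M \<subseteq> carrier (free_Abelian_group S)"
      "\<And>p. p \<in> M \<Longrightarrow> frag_extend \<phi> p \<in> N"
    and p: "p \<in> carrier (free_Abelian_group S)"
  shows "induced_hom G f (frag_coset M p) = frag_coset N (frag_extend \<phi> p)"
proof -
  have "free_hom G f q = frag_coset N (frag_extend \<phi> p)" if q: "q \<in> frag_coset M p" for q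
  proof -
    have qp: "q - p \<in> M" using q by (simp add: mem_frag_coset)
    then have "q - p + p \<in> carrier (free_Abelian_group S)"
      using M(2) p additive_subset_add[OF additive_subset_carrier] by blast
    then have "free_hom G f q = frag_coset N (frag_extend \<phi> q)"
      using free_hom_coset[OF \<phi>] by simp
    then show ?thesis
      using M(3)[OF qp] by (simp add: coset_eq_iff frag_extend_diff)
  qed
  then have "free_hom G f ` frag_coset M p = {frag_coset N (frag_extend \<phi> p)}"
    using self_mem_frag_coset[OF M(1)] by blast
  then show ?thesis by (simp add: induced_hom_def)
qed

end

lemma additive_generate:
  assumes "R \<subseteq> carrier (free_Abelian_group S)"
  shows "additive_subset (generate (free_Abelian_group S) R)"
    and "generate (free_Abelian_group S) R \<subseteq> carrier (free_Abelian_group S)"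
proof -
  interpret group "free_Abelian_group S" by simp
  show sub: "generate (free_Abelian_group S) R \<subseteq> carrier (free_Abelian_group S)"
    by (rule generate_incl[OF assms])
  show "additive_subset (generate (free_Abelian_group S) R)"
    unfolding additive_subset_def
  proof (intro conjI ballI)
    show "0 \<in> generate (free_Abelian_group S) R"
      using generate.one[of "free_Abelian_group S" R] by simp
    fix p q assume p: "p \<in> generate (free_Abelian_group S) R" and q: "q \<in> generate (free_Abelian_group S) R"
    have "- q \<in> generate (free_Abelian_group S) R"
      using generate_m_inv_closed[OF assms q] q sub by auto
    then show "p - q \<in> generate (free_Abelian_group S) R"
      using generate.eng[OF p, of "- q"] by simp
  qed
qed

lemma generate_minimal_additive:
  assumes "R \<subseteq> carrier (free_Abelian_group S)" "additive_subset M" "R \<subseteq> M"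
  shows "generate (free_Abelian_group S) R \<subseteq> M"
proof
  fix p assume "p \<in> generate (free_Abelian_group S) R"
  then show "p \<in> M"
  proof induction
    case one
    then show ?case using additive_subset_zero[OF assms(2)] by simp
  next
    case (incl h)
    then show ?case using assms(3) by blast
  next
    case (inv h)
    then have "h \<in> carrier (free_Abelian_group S)" "h \<in> M" using assms(1,3) by blast+
    then show ?case using additive_subset_minus[OF assms(2)] by simp
  next
    case (eng h h')
    then show ?case using additive_subset_add[OF assms(2)] by simp
  qed
qed

lemma coset_group_FactGroup:
  assumes N: "additive_subset N"
  shows "coset_group (carrier (free_Abelian_group S)) N (free_Abelian_group S Mod N)"
proof
  show "carrier (free_Abelian_group S Mod N) = frag_coset N ` carrier (free_Abelian_group S)"
    by (auto simp: carrier_FactGroup r_coset_free_Abelian_group)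
  show "\<one>\<^bsub>free_Abelian_group S Mod N\<^esub> = frag_coset N 0"
    by (simp add: frag_coset_def)
  fix p q
  show "frag_coset N p \<otimes>\<^bsub>free_Abelian_group S Mod N\<^esub> frag_coset N q = frag_coset N (p + q)"
  proof
    show "frag_coset N p \<otimes>\<^bsub>free_Abelian_group S Mod N\<^esub> frag_coset N q \<subseteq> frag_coset N (p + q)"
    proof
      fix x assume "x \<in> frag_coset N p \<otimes>\<^bsub>free_Abelian_group S Mod N\<^esub> frag_coset N q"
      then obtain m n where "m \<in> N" "n \<in> N" "x = (m + p) + (n + q)"
        by (auto simp: set_mult_def frag_coset_def)
      moreover have "(m + p) + (n + q) = (m + n) + (p + q)" by (simp add: algebra_simps)
      ultimately show "x \<in> frag_coset N (p + q)"
        using additive_subset_add[OF N] unfolding frag_coset_def by blast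
    qed
    show "frag_coset N (p + q) \<subseteq> frag_coset N p \<otimes>\<^bsub>free_Abelian_group S Mod N\<^esub> frag_coset N q"
    proof
      fix x assume "x \<in> frag_coset N (p + q)"
      then obtain n where "n \<in> N" "x = (n + p) + (0 + q)"
        by (auto simp: frag_coset_def add.assoc)
      then show "x \<in> frag_coset N p \<otimes>\<^bsub>free_Abelian_group S Mod N\<^esub> frag_coset N q"
        using additive_subset_zero[OF N] by (force simp: set_mult_def frag_coset_def)
    qed
  qed
qed (use N additive_subset_carrier in auto)

lemma coset_group_restrict:
  assumes "coset_group C N G" "additive_subset C'" "C' \<subseteq> C"
  shows "coset_group C' N (G\<lparr>carrier := frag_coset N ` C'\<rparr>)"
proof -
  interpret coset_group C N G by fact
  show ?thesis
    by unfold_locales (use assms additive_N mult_G one_G in \<open>simp_all add: subset_iff\<close>)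
qed

lemma quasi_lie_class_eq: "quasi_lie_class H p = frag_coset (quasi_lie_ideal H) p"
  by (simp add: quasi_lie_class_def r_coset_free_Abelian_group)

lemma set_word_word_at:
  assumes "tree_graph T" "x \<in> half_edges T" "\<forall>w\<in>leaves T. lab T w \<in> carrier H"
  shows "word_at T x \<in> words H"
proof -
  interpret tree_graph T by fact
  show ?thesis
    using assms(2)
    by (induction rule: walk_induct)
      (use assms(3) in \<open>auto simp: word_at_leaf word_at_node leaves_def\<close>)
qed

lemma branch_leaf_iff:
  assumes "tree_graph T" "x \<in> half_edges T" "word_at T x = Letter h"
  shows "opp T x \<in> leaves T" "lab T (opp T x) = h"
proof -
  interpret tree_graph T by fact
  have "rot T (opp T x) = opp T x"
    using word_at_node[OF assms(2)] assms(3) by (metis word.distinct(1))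
  then show "opp T x \<in> leaves T" "lab T (opp T x) = h"
    using word_at_leaf assms(2,3) by (auto simp: leaves_def)
qed

section \<open>The graded pieces of the quasi-Lie algebra\<close>

locale quasi_lie_trees =
  fixes H :: "('h, 'm) monoid_scheme" (structure) and k :: nat
  assumes comm_group_H: "comm_group H"
begin

sublocale comm_group H by (rule comm_group_H)

abbreviation I :: "('h word \<Rightarrow>\<^sub>0 int) set" where
  "I \<equiv> word_relations H"

abbreviation cls :: "('h word \<Rightarrow>\<^sub>0 int) \<Rightarrow> ('h word \<Rightarrow>\<^sub>0 int) set" where
  "cls \<equiv> frag_coset I"

definition homogeneous :: "nat \<Rightarrow> ('h word \<Rightarrow>\<^sub>0 int) set" where
  "homogeneous n = carrier (free_Abelian_group {t \<in> words H. word_degree t = n})"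

lemma additive_homogeneous: "additive_subset (homogeneous n)"
  unfolding homogeneous_def by (rule additive_subset_carrier)

lemma word_homogeneous: "t \<in> words H \<Longrightarrow> word_degree t = n \<Longrightarrow> frag_of t \<in> homogeneous n"
  by (auto simp: homogeneous_def)

lemma ideal_eq: "quasi_lie_ideal H = I"
  by (rule quasi_lie_ideal_eq) unfold_locales

lemma I_carrier: "I \<subseteq> carrier (magma_ring H)"
  by (rule word_relations_carrier) unfold_locales

lemma I_keys: "p \<in> I \<Longrightarrow> t \<in> Poly_Mapping.keys p \<Longrightarrow> t \<in> words H"
  using I_carrier unfolding subset_iff carrier_free_Abelian_group_iff by blast

lemmas I_diff = additive_subset_diff[OF additive_word_relations[of H]]
  and I_add = additive_subset_add[OF additive_word_relations[of H]]

lemma cls_eq_iff: "cls p = cls q \<longleftrightarrow> p - q \<in> I"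
  by (rule frag_coset_eq_iff[OF additive_word_relations])

lemma quasi_lie_deg_coset_group: "coset_group (homogeneous n) I (quasi_lie_deg H n)"
proof -
  have "coset_group (carrier (magma_ring H)) I (quasi_lie H)"
    unfolding quasi_lie_def ideal_eq by (rule coset_group_FactGroup[OF additive_word_relations])
  moreover have "homogeneous n \<subseteq> carrier (magma_ring H)"
    by (auto simp: homogeneous_def)
  ultimately have "coset_group (homogeneous n) I ((quasi_lie H)\<lparr>carrier := cls ` homogeneous n\<rparr>)"
    by (intro coset_group_restrict additive_homogeneous)
  then show ?thesis
    by (simp add: quasi_lie_deg_def homogeneous_def quasi_lie_class_eq[abs_def] ideal_eq)
qed

lemma homogeneous_mult_letter:
  "h \<in> carrier H \<Longrightarrow> p \<in> homogeneous n \<Longrightarrow> word_mult_left (Letter h) p \<in> homogeneous (Suc n)"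
  unfolding word_mult_left_def
  by (rule additive_subset_frag_extend[OF additive_homogeneous])
    (auto simp: homogeneous_def keys_frag_of)

text \<open>Maps on classes are defined through a homogeneous representative; by
  \<open>rep_cls\<close> its choice matters only modulo relations.\<close>

definition rep :: "nat \<Rightarrow> ('h word \<Rightarrow>\<^sub>0 int) set \<Rightarrow> ('h word \<Rightarrow>\<^sub>0 int)" where
  "rep n X = (SOME p. p \<in> homogeneous n \<and> cls p = X)"

lemma rep:
  assumes "X \<in> cls ` homogeneous n"
  shows "rep n X \<in> homogeneous n" "cls (rep n X) = X"
proof -
  have "\<exists>p. p \<in> homogeneous n \<and> cls p = X" using assms by auto
  from someI_ex[OF this] show "rep n X \<in> homogeneous n" "cls (rep n X) = X"
    by (simp_all add: rep_def)
qed

lemma rep_cls: "p \<in> homogeneous n \<Longrightarrow> rep n (cls p) - p \<in> I"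
  using rep(2)[OF imageI, of p n] by (simp add: cls_eq_iff)

section \<open>The tensor product\<close>

definition pairs :: "('h \<times> ('h word \<Rightarrow>\<^sub>0 int) set) set" where
  "pairs = carrier H \<times> cls ` homogeneous (Suc k)"

definition tensor_ideal :: "('h \<times> ('h word \<Rightarrow>\<^sub>0 int) set \<Rightarrow>\<^sub>0 int) set" where
  "tensor_ideal = generate (free_Abelian_group pairs) (tensor_rels H (quasi_lie_deg H (Suc k)))"

sublocale L: coset_group "homogeneous (Suc k)" I "quasi_lie_deg H (Suc k)"
  by (rule quasi_lie_deg_coset_group)

lemma tensor_rels_carrier: "tensor_rels H (quasi_lie_deg H (Suc k)) \<subseteq> carrier (free_Abelian_group pairs)"
proof -
  note diff = additive_subset_diff[OF additive_subset_carrier]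
  have gen: "frag_of (h, X) \<in> carrier (free_Abelian_group pairs)"
    if "h \<in> carrier H" "X \<in> carrier (quasi_lie_deg H (Suc k))" for h X
    using that by (simp add: pairs_def L.carrier_G)
  show ?thesis
    unfolding tensor_rels_def
    by (auto simp del: carrier_free_Abelian_group_iff intro!: diff gen m_closed L.m_closed)
qed

lemmas additive_tensor_ideal = additive_generate(1)[OF tensor_rels_carrier, folded tensor_ideal_def]
  and tensor_ideal_carrier = additive_generate(2)[OF tensor_rels_carrier, folded tensor_ideal_def]

lemmas TI_diff = additive_subset_diff[OF additive_tensor_ideal]
  and TI_add = additive_subset_add[OF additive_tensor_ideal]

lemma tensor_left:
  assumes "g \<in> carrier H" "h \<in> carrier H" "X \<in> cls ` homogeneous (Suc k)"
  shows "frag_of (g \<otimes> h, X) - frag_of (g, X) - frag_of (h, X) \<in> tensor_ideal"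
  unfolding tensor_ideal_def
  by (rule generate.incl) (use assms in \<open>auto simp: tensor_rels_def L.carrier_G\<close>)

lemma tensor_right:
  assumes "h \<in> carrier H" "p \<in> homogeneous (Suc k)" "q \<in> homogeneous (Suc k)"
  shows "frag_of (h, cls (p + q)) - frag_of (h, cls p) - frag_of (h, cls q) \<in> tensor_ideal"
proof -
  have "frag_of (h, cls p \<otimes>\<^bsub>quasi_lie_deg H (Suc k)\<^esub> cls q) - frag_of (h, cls p) - frag_of (h, cls q)
      \<in> tensor_rels H (quasi_lie_deg H (Suc k))"
    unfolding tensor_rels_def using assms L.carrier_G by blast
  then show ?thesis
    using generate.incl L.mult_G[OF assms(2,3)] unfolding tensor_ideal_def by fastforce
qed

lemma tensor_ideal_minimal:
  assumes "additive_subset M"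
    and "\<And>g h p. \<lbrakk>g \<in> carrier H; h \<in> carrier H; p \<in> homogeneous (Suc k)\<rbrakk> \<Longrightarrow>
      frag_of (g \<otimes> h, cls p) - frag_of (g, cls p) - frag_of (h, cls p) \<in> M"
    and "\<And>h p q. \<lbrakk>h \<in> carrier H; p \<in> homogeneous (Suc k); q \<in> homogeneous (Suc k)\<rbrakk> \<Longrightarrow>
      frag_of (h, cls (p + q)) - frag_of (h, cls p) - frag_of (h, cls q) \<in> M"
  shows "tensor_ideal \<subseteq> M"
  unfolding tensor_ideal_def
proof (rule generate_minimal_additive[OF tensor_rels_carrier assms(1)])
  show "tensor_rels H (quasi_lie_deg H (Suc k)) \<subseteq> M"
    unfolding tensor_rels_def L.carrier_G
    by (auto simp: L.mult_G intro: assms(2,3))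
qed

lemma tensor_zero: "h \<in> carrier H \<Longrightarrow> frag_of (h, cls 0) \<in> tensor_ideal"
  using tensor_right[of h 0 0] additive_subset_zero[OF additive_homogeneous]
    additive_subset_minus_iff[OF additive_tensor_ideal] by simp

sublocale HL: coset_group "carrier (free_Abelian_group pairs)" tensor_ideal "tensor H (quasi_lie_deg H (Suc k))"
proof -
  have "coset_group (carrier (free_Abelian_group pairs)) tensor_ideal
      (free_Abelian_group pairs Mod tensor_ideal)"
    by (rule coset_group_FactGroup[OF additive_tensor_ideal])
  moreover have "tensor H (quasi_lie_deg H (Suc k)) = free_Abelian_group pairs Mod tensor_ideal"
    by (simp add: tensor_def presented_def tensor_ideal_def pairs_def L.carrier_G)
  ultimately show "coset_group (carrier (free_Abelian_group pairs)) tensor_ideal (tensor H (quasi_lie_deg H (Suc k)))"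
    by simp
qed

text \<open>
  The value zero in the wrong degree makes this a function on all words, as needed for inductions
  over the ideal of relations, which is not defined degree by degree.
\<close>

definition leaf_tensor :: "'h \<Rightarrow> 'h word \<Rightarrow> ('h \<times> ('h word \<Rightarrow>\<^sub>0 int) set \<Rightarrow>\<^sub>0 int)" where
  "leaf_tensor h t = (if word_degree t = Suc k then frag_of (h, cls (frag_of t)) else 0)"

text \<open>Resolves the class in the second factor into words by additivity, so that afterwards
  only pure tensors of words have to be considered.\<close>

lemma tensor_linear:
  assumes h: "h \<in> carrier H" and p: "p \<in> homogeneous (Suc k)"
  shows "frag_extend (leaf_tensor h) p - frag_of (h, cls p) \<in> tensor_ideal"
proof -
  have "Poly_Mapping.keys p \<subseteq> {t \<in> words H. word_degree t = Suc k}"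
    using p by (simp add: homogeneous_def)
  then have "p \<in> homogeneous (Suc k) \<and> frag_extend (leaf_tensor h) p - frag_of (h, cls p) \<in> tensor_ideal"
  proof (induction p rule: frag_induction)
    case zero
    show ?case
      using tensor_zero[OF h] additive_subset_zero[OF additive_homogeneous]
        additive_subset_minus_iff[OF additive_tensor_ideal] by simp
  next
    case (one t)
    then show ?case
      by (simp add: leaf_tensor_def word_homogeneous additive_subset_zero[OF additive_tensor_ideal])
  next
    case (diff a b)
    have ab: "a - b \<in> homogeneous (Suc k)"
      using diff additive_subset_diff[OF additive_homogeneous] by blast
    \<comment> \<open>The tensor relations speak of sums, so a difference is handled by writing
      \<open>a\<close> as \<open>(a - b) + b\<close>.\<close>
    have "frag_of (h, cls (a - b + b)) - frag_of (h, cls (a - b)) - frag_of (h, cls b) \<in> tensor_ideal"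
      using tensor_right[OF h ab] diff by blast
    moreover have "(frag_extend (leaf_tensor h) a - frag_of (h, cls a)) -
        (frag_extend (leaf_tensor h) b - frag_of (h, cls b)) \<in> tensor_ideal"
      using diff TI_diff by blast
    ultimately have "(frag_extend (leaf_tensor h) a - frag_of (h, cls a)) -
        (frag_extend (leaf_tensor h) b - frag_of (h, cls b)) +
        (frag_of (h, cls (a - b + b)) - frag_of (h, cls (a - b)) - frag_of (h, cls b)) \<in> tensor_ideal"
      by (intro TI_add)
    then show ?case using ab by (simp add: frag_extend_diff)
  qed
  then show ?thesis by simp
qed

abbreviation F :: "'h word \<Rightarrow> 'h word \<Rightarrow> ('h \<times> ('h word \<Rightarrow>\<^sub>0 int) set \<Rightarrow>\<^sub>0 int)" where
  "F \<equiv> leaf_sum leaf_tensor"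

definition \<Phi> :: "'h word \<Rightarrow> 'h word \<Rightarrow> ('h \<times> ('h word \<Rightarrow>\<^sub>0 int) set \<Rightarrow>\<^sub>0 int)" where
  "\<Phi> s t = F s t + F t s"

lemma F_degree: "word_degree s + word_degree t \<noteq> k + 2 \<Longrightarrow> F s t = 0"
  by (induction s arbitrary: t) (auto simp: leaf_tensor_def)

text \<open>Unfolding \<open>leaf_sum\<close> along \<open>s\<close> moves the brackets of
  \<open>s\<close> onto \<open>p\<close>, which remains a relation. At a letter only the part of
  degree \<open>k + 1\<close> counts, and its class is zero.\<close>

lemma F_right:
  assumes p: "p \<in> I" and s: "s \<in> words H"
  shows "frag_extend (F s) p \<in> tensor_ideal"
  using s p
proof (induction s arbitrary: p)
  case (Letter h)
  let ?q = "homogeneous_part (Suc k) p"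
  have "frag_extend (leaf_tensor h) p = frag_extend (leaf_tensor h) ?q"
    by (induction p rule: frag_induct) (auto simp: leaf_tensor_def frag_extend_diff)
  moreover have q: "?q \<in> I" by (rule homogeneous_part_relations[OF Letter.prems(2)])
  moreover have hom: "?q \<in> homogeneous (Suc k)"
    unfolding homogeneous_part_def
  proof (rule additive_subset_frag_extend[OF additive_homogeneous])
    fix t assume "t \<in> Poly_Mapping.keys p"
    then have "t \<in> words H" using Letter.prems(2) I_keys by blast
    then show "(if word_degree t = Suc k then frag_of t else 0) \<in> homogeneous (Suc k)"
      using word_homogeneous additive_subset_zero[OF additive_homogeneous] by auto
  qed
  moreover have "cls ?q = cls 0" using q by (simp add: cls_eq_iff)
  ultimately show ?case
    using TI_add[OF tensor_linear[OF _ hom] tensor_zero] Letter.prems(1) by fastforce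
next
  case (Bracket s u)
  have eq: "F (Bracket s u) = (\<lambda>t. F s (Bracket u t) + F u (Bracket t s))"
    by auto
  have "frag_extend (F (Bracket s u)) p =
      frag_extend (F s) (word_mult_left u p) + frag_extend (F u) (word_mult_right s p)"
    unfolding eq
    by (simp add: word_mult_left_def word_mult_right_def frag_extend_frag_extend frag_extend_add_fun)
  moreover have "\<dots> \<in> tensor_ideal"
    using Bracket by (auto intro!: TI_add word_relations.left word_relations.right)
  ultimately show ?case by (simp only:)
qed

text \<open>Collecting terms by the factor that contains the leaf turns a relation on the left into
  relations on the right, where \<open>F_right\<close> applies.\<close>

lemma F_left:
  assumes p: "p \<in> I" and t: "t \<in> words H"
  shows "frag_extend (\<lambda>s. F s t) p \<in> tensor_ideal"
  using p t
proof (induction arbitrary: t)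
  case (letter g h)
  have "leaf_tensor (g \<otimes> h) t - leaf_tensor g t - leaf_tensor h t \<in> tensor_ideal"
    using tensor_left[OF letter(1,2)] word_homogeneous[OF letter(3)]
      additive_subset_zero[OF additive_tensor_ideal]
    by (auto simp: leaf_tensor_def)
  then show ?case by (simp add: frag_extend_diff)
next
  case (antisym s u)
  have "frag_extend (F s) (frag_of (Bracket u t) + frag_of (Bracket t u)) +
      frag_extend (F u) (frag_of (Bracket t s) + frag_of (Bracket s t)) \<in> tensor_ideal"
    by (intro TI_add F_right word_relations.antisym) (use antisym in auto)
  then show ?case by (simp add: frag_extend_add algebra_simps)
next
  case (jacobi a b c)
  \<comment> \<open>The terms whose leaf lies in \<open>x\<close>: up to antisymmetry their second
    arguments form the Jacobi identity for \<open>y\<close>, \<open>z\<close>,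
    \<open>t\<close>.\<close>
  have J: "frag_extend (F x) (frag_of (Bracket y (Bracket z t)) + frag_of (Bracket (Bracket y t) z) +
      frag_of (Bracket t (Bracket y z))) \<in> tensor_ideal"
    if "x \<in> words H" "y \<in> words H" "z \<in> words H" for x y z
  proof (rule F_right[OF _ that(1)])
    have 1: "frag_of (Bracket y (Bracket z t)) + frag_of (Bracket (Bracket z t) y) \<in> I"
      "frag_of (Bracket t (Bracket y z)) + frag_of (Bracket (Bracket y z) t) \<in> I"
      by (intro word_relations.antisym; use that jacobi.prems in simp)+
    have 2: "word_mult_right z (frag_of (Bracket y t) + frag_of (Bracket t y)) \<in> I"
      by (intro word_relations.right word_relations.antisym) (use that jacobi.prems in auto)
    have 3: "frag_of (Bracket (Bracket y z) t) + frag_of (Bracket (Bracket z t) y) +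
        frag_of (Bracket (Bracket t y) z) \<in> I"
      by (intro word_relations.jacobi) (use that jacobi.prems in auto)
    from I_diff[OF I_add[OF I_add[OF 1] 2] 3]
    show "frag_of (Bracket y (Bracket z t)) + frag_of (Bracket (Bracket y t) z) +
      frag_of (Bracket t (Bracket y z)) \<in> I"
      by (simp add: algebra_simps)
  qed
  from TI_add[OF TI_add[OF J[of a b c] J[of b c a]] J[of c a b]] jacobi.hyps
  show ?case by (simp add: frag_extend_add algebra_simps)
next
  case zero
  then show ?case by (simp add: additive_subset_zero[OF additive_tensor_ideal])
next
  case (diff p q)
  then show ?case by (simp add: frag_extend_diff TI_diff)
next
  case (left s p)
  have "frag_extend (\<lambda>s. F s t) (word_mult_left s p) =
      frag_extend (F s) (word_mult_right t p) + frag_extend (\<lambda>u. F u (Bracket t s)) p"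
    by (simp add: word_mult_left_def word_mult_right_def frag_extend_frag_extend frag_extend_add_fun)
  then show ?case
    using left by (auto intro!: TI_add F_right word_relations.right)
next
  case (right s p)
  have "frag_extend (\<lambda>s. F s t) (word_mult_right s p) =
      frag_extend (\<lambda>u. F u (Bracket s t)) p + frag_extend (F s) (word_mult_left t p)"
    by (simp add: word_mult_left_def word_mult_right_def frag_extend_frag_extend frag_extend_add_fun)
  then show ?case
    using right by (auto intro!: TI_add F_right word_relations.left)
qed

lemma \<Phi>_commute: "\<Phi> s t = \<Phi> t s"
  by (simp add: \<Phi>_def add.commute)

text \<open>Both sides belong to the same tree, cut at two different edges of the vertex where
  \<open>s\<close>, \<open>t\<close> and \<open>u\<close> meet.\<close>

lemma \<Phi>_assoc: "\<Phi> (Bracket s t) u = \<Phi> s (Bracket t u)"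
  by (simp add: \<Phi>_def algebra_simps)

lemma \<Phi>_relations:
  assumes "p \<in> I" "t \<in> words H"
  shows "frag_extend (\<lambda>s. \<Phi> s t) p \<in> tensor_ideal"
  unfolding \<Phi>_def frag_extend_add_fun using assms by (intro TI_add F_left F_right)

section \<open>The group of trees\<close>

definition tree_relations :: "('h half_edge_graph \<Rightarrow>\<^sub>0 int) set" where
  "tree_relations = iso_rels H k \<union> antisymmetry_rels H k \<union> IHX_rels H k \<union> linearity_rels H k"

definition tree_ideal :: "('h half_edge_graph \<Rightarrow>\<^sub>0 int) set" where
  "tree_ideal = generate (free_Abelian_group (trees H k)) tree_relations"

lemma treesD:
  assumes "T \<in> trees H k"
  shows "tree_graph T" "\<And>w. w \<in> leaves T \<Longrightarrow> lab T w \<in> carrier H"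
    "\<And>x. x \<in> half_edges T \<Longrightarrow> word_at T x \<in> words H"
    "\<And>x. x \<in> half_edges T \<Longrightarrow> word_degree (word_at T x) + word_degree (word_at T (opp T x)) = k + 2"
  using assms set_word_word_at[of T _ H] tree_graph.card_leaves by (fastforce simp: trees_iff)+

lemma flip_at_trees:
  "T \<in> trees H k \<Longrightarrow> x \<in> half_edges T - leaves T \<Longrightarrow> flip_at x T \<in> trees H k"
  using tree_graph.flip_at_tree[of T x] by (simp add: trees_iff leaves_def) (simp add: flip_at_def Let_def)

lemma relabel_trees:
  "T \<in> trees H k \<Longrightarrow> w \<in> leaves T \<Longrightarrow> g \<in> carrier H \<Longrightarrow> T\<lparr>lab := (lab T)(w := g)\<rparr> \<in> trees H k"
  using tree_graph.relabel_tree[of T w g] by (simp add: trees_iff)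

lemma regraft_trees:
  assumes "T \<in> trees H k" "e \<in> half_edges T - leaves T" "opp T e \<notin> leaves T"
    and "distinct [a', b', c', d']"
      "{a', b', c', d'} = {rot T e, rot T (rot T e), rot T (opp T e), rot T (rot T (opp T e))}"
  shows "regraft T e (a', b') (c', d') \<in> trees H k"
    and "word_at (regraft T e (a', b') (c', d')) e = Bracket (word_at T c') (word_at T d')"
    and "word_at (regraft T e (a', b') (c', d')) (opp T e) = Bracket (word_at T a') (word_at T b')"
proof -
  interpret tree_graph T using treesD assms(1) by blast
  have e: "e \<in> half_edges T" "rot T e \<noteq> e" "rot T (opp T e) \<noteq> opp T e"
    using assms(2,3) by (auto simp: leaves_def)
  note r = regraft_tree[OF e assms(4,5)]
  show "regraft T e (a', b') (c', d') \<in> trees H k"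
    using assms(1) r(1,2) by (simp add: trees_iff) (simp add: regraft_def)
  show "word_at (regraft T e (a', b') (c', d')) e = Bracket (word_at T c') (word_at T d')"
    "word_at (regraft T e (a', b') (c', d')) (opp T e) = Bracket (word_at T a') (word_at T b')"
    using r by auto
qed

lemma IHX_setup:
  assumes "T \<in> trees H k" "e \<in> half_edges T - leaves T" "opp T e \<notin> leaves T"
  defines "a \<equiv> rot T e" and "b \<equiv> rot T (rot T e)"
    and "c \<equiv> rot T (opp T e)" and "d \<equiv> rot T (rot T (opp T e))"
  shows "distinct [a, b, c, d]" "a \<in> half_edges T" "b \<in> half_edges T" "c \<in> half_edges T" "d \<in> half_edges T"
proof -
  interpret tree_graph T using treesD assms(1) by blast
  have e: "e \<in> half_edges T" "rot T e \<noteq> e" "opp T e \<in> half_edges T" "rot T (opp T e) \<noteq> opp T e"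
    using assms(2,3) by (auto simp: leaves_def)
  show h: "a \<in> half_edges T" "b \<in> half_edges T" "c \<in> half_edges T" "d \<in> half_edges T"
    using e by (auto simp: a_def b_def c_def d_def)
  have "a \<in> vertex_of T e" "b \<in> vertex_of T e" "c \<in> vertex_of T (opp T e)" "d \<in> vertex_of T (opp T e)"
    by (auto simp: a_def b_def c_def d_def vertex_of_def)
  moreover have "vertex_of T (opp T e) \<inter> vertex_of T e = {}"
    using beyond_avoids_vertex[OF e(1)] by blast
  moreover have "a \<noteq> b" "c \<noteq> d"
    using rot_rot_neq[OF e(1,2)] rot_rot_neq[OF e(3,4)] by (auto simp: a_def b_def c_def d_def)
  ultimately show "distinct [a, b, c, d]" by auto
qed

lemma tree_relations_carrier: "tree_relations \<subseteq> carrier (free_Abelian_group (trees H k))"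
proof -
  note add = additive_subset_add[OF additive_subset_carrier]
    and diff = additive_subset_diff[OF additive_subset_carrier]
  have gen: "frag_of T \<in> carrier (free_Abelian_group (trees H k))" if "T \<in> trees H k" for T
    using that by simp
  have "iso_rels H k \<subseteq> carrier (free_Abelian_group (trees H k))"
    unfolding iso_rels_def
    by (auto simp del: carrier_free_Abelian_group_iff intro!: diff gen)
  moreover have "antisymmetry_rels H k \<subseteq> carrier (free_Abelian_group (trees H k))"
    unfolding antisymmetry_rels_def
    by (auto simp del: carrier_free_Abelian_group_iff intro!: add gen flip_at_trees)
  moreover have "linearity_rels H k \<subseteq> carrier (free_Abelian_group (trees H k))"
    unfolding linearity_rels_def
    by (auto simp del: carrier_free_Abelian_group_iff intro!: diff gen relabel_trees m_closed)
  moreover have "IHX_rels H k \<subseteq> carrier (free_Abelian_group (trees H k))"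
  proof
    fix p assume "p \<in> IHX_rels H k"
    then obtain T e a b c d where p: "p = frag_of (regraft T e (a, b) (c, d)) +
          frag_of (regraft T e (b, c) (a, d)) + frag_of (regraft T e (c, a) (b, d))"
      and T: "T \<in> trees H k" "e \<in> half_edges T - leaves T" "opp T e \<notin> leaves T"
      and abcd: "a = rot T e" "b = rot T a" "c = rot T (opp T e)" "d = rot T c"
      unfolding IHX_rels_def by blast
    have "distinct [a, b, c, d]" using IHX_setup[OF T] abcd by simp
    then show "p \<in> carrier (free_Abelian_group (trees H k))"
      unfolding p by (intro add gen regraft_trees[OF T]) (auto simp: abcd)
  qed
  ultimately show ?thesis unfolding tree_relations_def by blast
qed

lemmas additive_tree_ideal = additive_generate(1)[OF tree_relations_carrier, folded tree_ideal_def]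
  and tree_ideal_carrier = additive_generate(2)[OF tree_relations_carrier, folded tree_ideal_def]

lemmas RI_diff = additive_subset_diff[OF additive_tree_ideal]
  and RI_add = additive_subset_add[OF additive_tree_ideal]
  and RI_zero = additive_subset_zero[OF additive_tree_ideal]

lemma tree_relation: "p \<in> tree_relations \<Longrightarrow> p \<in> tree_ideal"
  unfolding tree_ideal_def by (rule generate.incl)

sublocale A: coset_group "carrier (free_Abelian_group (trees H k))" tree_ideal "tree_group H k"
proof -
  have "coset_group (carrier (free_Abelian_group (trees H k))) tree_ideal
      (free_Abelian_group (trees H k) Mod tree_ideal)"
    by (rule coset_group_FactGroup[OF additive_tree_ideal])
  moreover have "tree_group H k = free_Abelian_group (trees H k) Mod tree_ideal"
    by (simp add: tree_group_def presented_def tree_ideal_def tree_relations_def)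
  ultimately show "coset_group (carrier (free_Abelian_group (trees H k))) tree_ideal (tree_group H k)"
    by simp
qed

section \<open>The group of trees in terms of pairs of words\<close>

definition tau :: "'h word \<Rightarrow> 'h word \<Rightarrow> ('h half_edge_graph \<Rightarrow>\<^sub>0 int)" where
  "tau s t = (if word_degree s + word_degree t = k + 2 then frag_of (joined_tree s t) else 0)"

lemma joined_tree_trees:
  assumes "s \<in> words H" "t \<in> words H" "word_degree s + word_degree t = k + 2"
  shows "joined_tree s t \<in> trees H k"
proof -
  interpret tree_graph "joined_tree s t" by (rule tree_graph_joined_tree)
  obtain e where "e \<in> half_edges (joined_tree s t)" "word_at (joined_tree s t) e = s"
    "word_at (joined_tree s t) (opp (joined_tree s t) e) = t"
    by (rule word_at_joined_tree)
  then have "card (leaves (joined_tree s t)) = k + 2"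
    using card_leaves[of e] assms(3) by simp
  then show ?thesis
    using lab_joined_tree[of _ s t] assms(1,2) tree_graph_axioms by (auto simp: trees_iff words_def)
qed

lemma tau_closed:
  "s \<in> words H \<Longrightarrow> t \<in> words H \<Longrightarrow> tau s t \<in> carrier (free_Abelian_group (trees H k))"
  using joined_tree_trees by (simp add: tau_def)

text \<open>Here the isomorphism relations enter: a tree may be replaced by the joined tree at any
  of its edges, so relations between trees become identities for \<open>tau\<close>.\<close>

lemma tree_eq_tau:
  assumes T: "T \<in> trees H k" and e: "e \<in> half_edges T"
    and words: "word_at T e = s" "word_at T (opp T e) = t"
  shows "tau s t - frag_of T \<in> tree_ideal"
proof -
  interpret tree_graph T using treesD T by blast
  have st: "s \<in> words H" "t \<in> words H" "word_degree s + word_degree t = k + 2"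
    using treesD(3,4)[OF T] e words by auto
  have "tree_iso (joined_tree s t) T"
    using joined_tree_iso[OF e] words by simp
  then have "frag_of (joined_tree s t) - frag_of T \<in> iso_rels H k"
    using joined_tree_trees[OF st] T by (auto simp: iso_rels_def)
  then show ?thesis using st(3) by (auto simp: tau_def intro: tree_relation simp: tree_relations_def)
qed

lemma tau_eqI:
  assumes T: "T \<in> trees H k" and e: "e \<in> half_edges T" "e' \<in> half_edges T"
    and "word_at T e = s" "word_at T (opp T e) = t" "word_at T e' = s'" "word_at T (opp T e') = t'"
  shows "tau s t - tau s' t' \<in> tree_ideal"
  using RI_diff[OF tree_eq_tau[OF T e(1) assms(4,5)] tree_eq_tau[OF T e(2) assms(6,7)]] by simp

lemma joined_tree_edge:
  assumes "s \<in> words H" "t \<in> words H" "word_degree s + word_degree t = k + 2"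
  obtains T e where "T \<in> trees H k" "tree_graph T" "e \<in> half_edges T" "word_at T e = s"
    "word_at T (opp T e) = t"
  using joined_tree_trees[OF assms] tree_graph_joined_tree word_at_joined_tree by metis

lemma tau_commute:
  assumes "s \<in> words H" "t \<in> words H"
  shows "tau s t - tau t s \<in> tree_ideal"
proof (cases "word_degree s + word_degree t = k + 2")
  case True
  then obtain T e where T: "T \<in> trees H k" "tree_graph T" "e \<in> half_edges T" "word_at T e = s"
    "word_at T (opp T e) = t"
    using joined_tree_edge assms by metis
  then interpret tree_graph T by simp
  show ?thesis
    by (rule tau_eqI[OF T(1,3), of "opp T e"]) (use T in auto)
next
  case False
  then show ?thesis using RI_zero by (auto simp: tau_def)
qed

text \<open>One tree, cut at each of the three edges of a vertex.\<close>

lemma tau_rotate: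
  assumes "s \<in> words H" "u \<in> words H" "t \<in> words H"
  shows "tau (Bracket s u) t - tau s (Bracket u t) \<in> tree_ideal"
    and "tau (Bracket s u) t - tau u (Bracket t s) \<in> tree_ideal"
proof -
  have "tau (Bracket s u) t - tau s (Bracket u t) \<in> tree_ideal \<and>
    tau (Bracket s u) t - tau u (Bracket t s) \<in> tree_ideal"
  proof (cases "word_degree (Bracket s u) + word_degree t = k + 2")
    case True
    then obtain T e where T: "T \<in> trees H k" "tree_graph T" "e \<in> half_edges T"
      "word_at T e = Bracket s u" "word_at T (opp T e) = t"
      using joined_tree_edge[of "Bracket s u" t] assms by auto
    then interpret tree_graph T by simp
    define y z where "y = rot T (opp T e)" and "z = rot T y"
    have o: "opp T e \<in> half_edges T" "rot T (opp T e) \<noteq> opp T e"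
      using T word_at_leaf[of e] by auto
    have h: "y \<in> half_edges T" "z \<in> half_edges T" and rz: "rot T z = opp T e"
      using o by (auto simp: y_def z_def)
    have ne: "rot T y \<noteq> y" "rot T z \<noteq> z"
      using o h rz rot_rot_neq[OF o] by (auto simp: y_def z_def)
    have w: "word_at T y = s" "word_at T z = u"
      using T word_at_node[OF T(3) o(2)] by (auto simp: y_def z_def)
    have wy: "word_at T (opp T y) = Bracket u t"
      using word_at_opp[OF h(1) ne(1)] w rz T(5) by (simp add: z_def)
    have wz: "word_at T (opp T z) = Bracket t s"
      using word_at_opp[OF h(2) ne(2)] w rz T(5) by (simp add: y_def)
    show ?thesis
      using tau_eqI[OF T(1,3) h(1) T(4,5) w(1) wy] tau_eqI[OF T(1,3) h(2) T(4,5) w(2) wz] by simp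
  next
    case False
    then show ?thesis using RI_zero by (auto simp: tau_def)
  qed
  then show "tau (Bracket s u) t - tau s (Bracket u t) \<in> tree_ideal"
    "tau (Bracket s u) t - tau u (Bracket t s) \<in> tree_ideal" by auto
qed

lemma tau_antisym:
  assumes "s \<in> words H" "u \<in> words H" "t \<in> words H"
  shows "tau (Bracket s u) t + tau (Bracket u s) t \<in> tree_ideal"
proof (cases "word_degree (Bracket s u) + word_degree t = k + 2")
  case True
  then obtain T e where T: "T \<in> trees H k" "tree_graph T" "e \<in> half_edges T"
    "word_at T e = Bracket s u" "word_at T (opp T e) = t"
    using joined_tree_edge[of "Bracket s u" t] assms by auto
  then interpret tree_graph T by simp
  define x where "x = opp T e"
  have x: "x \<in> half_edges T" "rot T x \<noteq> x" and ox: "opp T x = e"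
    using T word_at_leaf[of e] by (auto simp: x_def)
  define T' where "T' = flip_at x T"
  note flip = flip_at_tree[OF x, folded T'_def]
  have T': "T' \<in> trees H k"
    using flip_at_trees[OF T(1)] x by (simp add: T'_def leaves_def)
  have same: "half_edges T' = half_edges T" "opp T' = opp T"
    by (simp_all add: T'_def flip_at_def Let_def)
  have "word_at T (rot T x) = s" "word_at T (rot T (rot T x)) = u"
    using T(4) word_at_node[OF T(3)] x by (auto simp: x_def)
  then have w: "word_at T' e = Bracket u s" "word_at T' (opp T' e) = t"
    using flip(3,4) T(5) ox same by (auto simp: x_def)
  have "frag_of T + frag_of T' \<in> tree_ideal"
    using T(1) x by (intro tree_relation) (auto simp: tree_relations_def antisymmetry_rels_def T'_def leaves_def)
  moreover have "tau (Bracket s u) t - frag_of T \<in> tree_ideal"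
    by (rule tree_eq_tau[OF T(1,3,4,5)])
  moreover have "tau (Bracket u s) t - frag_of T' \<in> tree_ideal"
    using tree_eq_tau[OF T' _ w] T(3) same by simp
  ultimately have "(tau (Bracket s u) t - frag_of T) + (tau (Bracket u s) t - frag_of T') +
      (frag_of T + frag_of T') \<in> tree_ideal"
    using RI_add by blast
  then show ?thesis by simp
next
  case False
  then show ?thesis using RI_zero by (auto simp: tau_def)
qed

lemma RI_trans: "p - q \<in> tree_ideal \<Longrightarrow> q - s \<in> tree_ideal \<Longrightarrow> p - s \<in> tree_ideal"
  using RI_add[of "p - q" "q - s"] by simp

text \<open>By \<open>tau_rotate\<close> the first term is \<open>tau [a, b] [c, d]\<close>, a tree
  with an internal edge between the pairs \<open>a\<close>, \<open>b\<close> and \<open>c\<close>,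
  \<open>d\<close>. Permuting \<open>a\<close>, \<open>b\<close>, \<open>c\<close> cyclically with
  \<open>d\<close> fixed is the IHX relation at this edge.\<close>

lemma tau_jacobi:
  assumes "a \<in> words H" "b \<in> words H" "c \<in> words H" "d \<in> words H"
  shows "tau (Bracket (Bracket a b) c) d + tau (Bracket (Bracket b c) a) d +
    tau (Bracket (Bracket c a) b) d \<in> tree_ideal"
proof (cases "word_degree a + word_degree b + word_degree c + word_degree d = k + 2")
  case True
  then obtain T e0 where T: "T \<in> trees H k" "tree_graph T" "e0 \<in> half_edges T"
    "word_at T e0 = Bracket a b" "word_at T (opp T e0) = Bracket c d"
    using joined_tree_edge[of "Bracket a b" "Bracket c d"] assms by auto
  then interpret tree_graph T by simp
  \<comment> \<open>\<open>word_at\<close> reads what lies across an edge, so \<open>a\<close> and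
    \<open>b\<close> sit at the vertex of \<open>e\<close>, as \<open>regraft\<close>
    expects.\<close>
  define e where "e = opp T e0"
  have e: "e \<in> half_edges T" "opp T e = e0" "rot T e \<noteq> e" "rot T e0 \<noteq> e0"
    using T word_at_leaf[of e0] word_at_leaf[of e] by (auto simp: e_def)
  have eT: "e \<in> half_edges T - leaves T" "opp T e \<notin> leaves T"
    using e by (auto simp: leaves_def)
  define i j m n where "i = rot T e" and "j = rot T i" and "m = rot T (opp T e)" and "n = rot T m"
  have w: "word_at T i = a" "word_at T j = b" "word_at T m = c" "word_at T n = d"
    using word_at_node[OF T(3)] word_at_node[OF e(1)] T(4,5) e
    by (auto simp: e_def[symmetric] i_def j_def m_def n_def)
  have dist: "distinct [i, j, m, n]"
    using IHX_setup[OF T(1) eT] by (simp add: i_def j_def m_def n_def)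
  have IHX: "frag_of (regraft T e (i, j) (m, n)) + frag_of (regraft T e (j, m) (i, n)) +
      frag_of (regraft T e (m, i) (j, n)) \<in> tree_ideal"
    unfolding i_def j_def m_def n_def
    using T(1) eT by (intro tree_relation) (auto simp: tree_relations_def IHX_rels_def)
  have key: "tau (Bracket (Bracket (word_at T i') (word_at T j')) (word_at T m')) (word_at T n') -
      frag_of (regraft T e (i', j') (m', n')) \<in> tree_ideal"
    if p: "distinct [i', j', m', n']" "{i', j', m', n'} = {i, j, m, n}" for i' j' m' n'
  proof -
    have p': "{i', j', m', n'} = {rot T e, rot T (rot T e), rot T (opp T e), rot T (rot T (opp T e))}"
      using p(2) by (simp add: i_def j_def m_def n_def)
    note r = regraft_trees[OF T(1) eT p(1) p']
    have "i' \<in> {i, j, m, n}" "j' \<in> {i, j, m, n}" "m' \<in> {i, j, m, n}" "n' \<in> {i, j, m, n}"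
      using p(2) by blast+
    then have ws: "word_at T i' \<in> words H" "word_at T j' \<in> words H"
        "word_at T m' \<in> words H" "word_at T n' \<in> words H"
      using w assms by auto
    let ?T' = "regraft T e (i', j') (m', n')"
    have same: "half_edges ?T' = half_edges T" "opp ?T' = opp T" by (simp_all add: regraft_def)
    have "tau (Bracket (word_at T i') (word_at T j')) (Bracket (word_at T m') (word_at T n')) -
        frag_of ?T' \<in> tree_ideal"
      using tree_eq_tau[OF r(1), of e0] r(2,3) same T(3) e(2) by (simp add: e_def)
    then show ?thesis
      using RI_trans tau_rotate(1)[of "Bracket (word_at T i') (word_at T j')" "word_at T m'" "word_at T n'"] ws
      by simp
  qed
  have "tau (Bracket (Bracket a b) c) d - frag_of (regraft T e (i, j) (m, n)) \<in> tree_ideal"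
    "tau (Bracket (Bracket b c) a) d - frag_of (regraft T e (j, m) (i, n)) \<in> tree_ideal"
    "tau (Bracket (Bracket c a) b) d - frag_of (regraft T e (m, i) (j, n)) \<in> tree_ideal"
    using key[of i j m n] key[of j m i n] key[of m i j n] dist w by (auto simp: insert_commute)
  from RI_add[OF RI_add[OF RI_add[OF this(1,2)] this(3)] IHX]
  show ?thesis by (simp add: algebra_simps)
next
  case False
  then show ?thesis using RI_zero by (auto simp: tau_def)
qed

lemma tau_letter:
  assumes "g \<in> carrier H" "h \<in> carrier H" "t \<in> words H"
  shows "tau (Letter (g \<otimes> h)) t - tau (Letter g) t - tau (Letter h) t \<in> tree_ideal"
proof (cases "word_degree t = Suc k")
  case True
  then obtain T e where T: "T \<in> trees H k" "tree_graph T" "e \<in> half_edges T"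
    "word_at T e = Letter g" "word_at T (opp T e) = t"
    using joined_tree_edge[of "Letter g" t] assms by auto
  then interpret tree_graph T by simp
  define w where "w = opp T e"
  have w: "w \<in> leaves T" "opp T w = e"
    using branch_leaf_iff[OF T(2,3,4)] T(3) by (auto simp: w_def)
  define T' where "T' x = T\<lparr>lab := (lab T)(w := x)\<rparr>" for x
  have tau: "tau (Letter x) t - frag_of (T' x) \<in> tree_ideal" if x: "x \<in> carrier H" for x
    using tree_eq_tau[OF relabel_trees[OF T(1) w(1) x, folded T'_def], of e]
      relabel_tree(3,4)[OF w(1), of x, folded T'_def] w T(3,5)
    by (simp add: T'_def w_def)
  have "frag_of (T' (g \<otimes> h)) - frag_of (T' g) - frag_of (T' h) \<in> tree_ideal"
    unfolding T'_def using T(1) w assms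
    by (intro tree_relation) (auto simp: tree_relations_def linearity_rels_def)
  from RI_add[OF this RI_diff[OF RI_diff[OF tau[of "g \<otimes> h"] tau[of g]] tau[of h]]]
  show ?thesis using assms by simp
next
  case False
  then show ?thesis using RI_zero by (auto simp: tau_def)
qed

text \<open>The generating relations are handled by the lemmas above; a word that multiplies a
  relation is rotated over to \<open>t\<close>.\<close>

lemma tau_relations:
  assumes "p \<in> I" "t \<in> words H"
  shows "frag_extend (\<lambda>s. tau s t) p \<in> tree_ideal"
  using assms
proof (induction arbitrary: t)
  case (letter g h)
  then show ?case using tau_letter by (simp add: frag_extend_diff)
next
  case (antisym s u)
  then show ?case using tau_antisym by (simp add: frag_extend_add)
next
  case (jacobi a b c)
  then show ?case using tau_jacobi by (simp add: frag_extend_add)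
next
  case zero
  then show ?case by (simp add: RI_zero)
next
  case (diff p q)
  then show ?case by (simp add: frag_extend_diff RI_diff)
next
  case (left s p)
  have "frag_extend (\<lambda>u. tau (Bracket s u) t - tau u (Bracket t s)) p \<in> tree_ideal"
    by (rule additive_subset_frag_extend[OF additive_tree_ideal])
      (use left I_keys in \<open>auto intro!: tau_rotate\<close>)
  moreover have "frag_extend (\<lambda>u. tau u (Bracket t s)) p \<in> tree_ideal"
    using left by simp
  ultimately show ?case
    using RI_add by (fastforce simp: frag_extend_diff_fun word_mult_left_def frag_extend_frag_extend)
next
  case (right s p)
  have "frag_extend (\<lambda>u. tau (Bracket u s) t - tau u (Bracket s t)) p \<in> tree_ideal"
    by (rule additive_subset_frag_extend[OF additive_tree_ideal])
      (use right I_keys in \<open>auto intro!: tau_rotate\<close>)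
  moreover have "frag_extend (\<lambda>u. tau u (Bracket s t)) p \<in> tree_ideal"
    using right by simp
  ultimately show ?case
    using RI_add by (fastforce simp: frag_extend_diff_fun word_mult_right_def frag_extend_frag_extend)
qed

lemma tau_relations_right:
  assumes p: "p \<in> I" and t: "t \<in> words H"
  shows "frag_extend (tau t) p \<in> tree_ideal"
proof -
  have "frag_extend (\<lambda>s. tau t s - tau s t) p \<in> tree_ideal"
    by (rule additive_subset_frag_extend[OF additive_tree_ideal])
      (use p t I_keys in \<open>auto intro!: tau_commute\<close>)
  then show ?thesis
    using RI_add[OF _ tau_relations[OF p t]] by (fastforce simp: frag_extend_diff_fun)
qed

end

lemma frag_extend_cmul_fun: "frag_extend (\<lambda>a. frag_cmul n (f a)) p = frag_cmul n (frag_extend f p)"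
  by (induction p rule: frag_induct) (auto simp: frag_extend_diff frag_cmul_diff_distrib2)

lemma frag_extend_sum_fun:
  "finite J \<Longrightarrow> frag_extend (\<lambda>a. \<Sum>j\<in>J. f j a) p = (\<Sum>j\<in>J. frag_extend (f j) p)"
  by (induction J rule: finite_induct) (auto simp: frag_extend_add_fun frag_extend_eq_0)

context quasi_lie_trees
begin

section \<open>The maps between trees and tensors\<close>

definition eta0 :: "'h half_edge_graph \<Rightarrow> ('h \<times> ('h word \<Rightarrow>\<^sub>0 int) set \<Rightarrow>\<^sub>0 int)" where
  "eta0 T = (\<Sum>w\<in>leaves T. frag_of (lab T w, cls (frag_of (word_at T w))))"

lemma treesD_leaf:
  assumes T: "T \<in> trees H k" and w: "w \<in> leaves T"
  shows "w \<in> half_edges T" "opp T w \<in> half_edges T" "word_at T (opp T w) = Letter (lab T w)"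
    "lab T w \<in> carrier H" "word_at T w \<in> words H" "word_degree (word_at T w) = Suc k"
proof -
  interpret tree_graph T using treesD T by blast
  show h: "w \<in> half_edges T" "opp T w \<in> half_edges T" using w by (auto simp: leaves_def)
  show l: "word_at T (opp T w) = Letter (lab T w)"
    using word_at_leaf[of "opp T w"] h w by (auto simp: leaves_def)
  show "lab T w \<in> carrier H" "word_at T w \<in> words H" using treesD[OF T] h w by auto
  show "word_degree (word_at T w) = Suc k" using treesD(4)[OF T h(1)] l by simp
qed

lemma eta0_closed: "T \<in> trees H k \<Longrightarrow> eta0 T \<in> carrier (free_Abelian_group pairs)"
  unfolding eta0_def
  by (rule additive_subset_sum[OF additive_subset_carrier])
    (use treesD_leaf word_homogeneous in \<open>auto simp: pairs_def\<close>)

lemma eta0_eq: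
  assumes T: "T \<in> trees H k" and x: "x \<in> half_edges T"
  shows "eta0 T = \<Phi> (word_at T x) (word_at T (opp T x))"
proof -
  interpret tree_graph T using treesD T by blast
  have "eta0 T = (\<Sum>w\<in>leaves T. leaf_tensor (lab T w) (word_at T w))"
    unfolding eta0_def by (rule sum.cong) (use treesD_leaf[OF T] in \<open>auto simp: leaf_tensor_def\<close>)
  then show ?thesis
    using sum_leaves[OF x] by (simp add: \<Phi>_def)
qed

lemma eta0_tau:
  assumes "s \<in> words H" "t \<in> words H"
  shows "frag_extend eta0 (tau s t) = \<Phi> s t"
proof (cases "word_degree s + word_degree t = k + 2")
  case True
  have J: "joined_tree s t \<in> trees H k" using joined_tree_trees assms True by blast
  obtain e where "e \<in> half_edges (joined_tree s t)" "word_at (joined_tree s t) e = s"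
    "word_at (joined_tree s t) (opp (joined_tree s t) e) = t"
    by (rule word_at_joined_tree)
  with eta0_eq[OF J] True show ?thesis by (simp add: tau_def)
next
  case False
  then show ?thesis
    using F_degree[of s t] F_degree[of t s] by (simp add: tau_def \<Phi>_def add.commute)
qed

text \<open>Cut at the place it concerns, each relation becomes a word relation in an argument of
  \<open>\<Phi>\<close>: isomorphic trees give the same words, a flip gives antisymmetry, IHX gives
  Jacobi via \<open>\<Phi>_assoc\<close>, and linearity the additivity of a letter.\<close>

lemma eta_relations: "p \<in> tree_ideal \<Longrightarrow> frag_extend eta0 p \<in> tensor_ideal"
proof -
  let ?M = "{p. frag_extend eta0 p \<in> tensor_ideal}"
  have "iso_rels H k \<subseteq> ?M"
  proof
    fix p assume "p \<in> iso_rels H k"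
    then obtain T T' where p: "p = frag_of T - frag_of T'" and T: "T \<in> trees H k" "T' \<in> trees H k"
      "tree_iso T T'" by (auto simp: iso_rels_def)
    obtain x where x: "x \<in> half_edges T"
      using treesD(1)[OF T(1)] conn_graph.connected tree_graph.axioms(1)
      by (fastforce simp: connected_graph_def)
    obtain x' where "x' \<in> half_edges T'" "word_at T' x' = word_at T x"
      "word_at T' (opp T' x') = word_at T (opp T x)"
      using tree_iso_word_at[OF treesD(1)[OF T(1)] treesD(1)[OF T(2)] T(3) x] by blast
    then have "eta0 T' = eta0 T"
      using eta0_eq[OF T(1) x] eta0_eq[OF T(2)] by metis
    then show "p \<in> ?M" using additive_subset_zero[OF additive_tensor_ideal] p by (simp add: frag_extend_diff)
  qed
  moreover have "antisymmetry_rels H k \<subseteq> ?M"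
  proof
    fix p assume "p \<in> antisymmetry_rels H k"
    then obtain T x where p: "p = frag_of T + frag_of (flip_at x T)"
      and T: "T \<in> trees H k" and x: "x \<in> half_edges T - leaves T"
      by (auto simp: antisymmetry_rels_def)
    interpret tree_graph T using treesD T by blast
    have xh: "x \<in> half_edges T" "rot T x \<noteq> x" using x by (auto simp: leaves_def)
    define s u t where "s = word_at T (rot T x)" and "u = word_at T (rot T (rot T x))"
      and "t = word_at T x"
    have w: "s \<in> words H" "u \<in> words H" "t \<in> words H"
      using treesD(3)[OF T] xh by (auto simp: s_def u_def t_def)
    have "eta0 T = \<Phi> (Bracket s u) t"
      using eta0_eq[OF T xh(1)] word_at_opp[OF xh] \<Phi>_commute by (simp add: s_def u_def t_def)
    moreover have "eta0 (flip_at x T) = \<Phi> (Bracket u s) t"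
      using eta0_eq[OF flip_at_trees[OF T x], of x] flip_at_tree(3,4)[OF xh] xh \<Phi>_commute
      by (simp add: s_def u_def t_def) (simp add: flip_at_def Let_def)
    ultimately show "p \<in> ?M"
      using \<Phi>_relations[OF word_relations.antisym[OF w(1,2)] w(3)] p by (simp add: frag_extend_add)
  qed
  moreover have "IHX_rels H k \<subseteq> ?M"
  proof
    fix p assume "p \<in> IHX_rels H k"
    then obtain T e a b c d where p: "p = frag_of (regraft T e (a, b) (c, d)) +
          frag_of (regraft T e (b, c) (a, d)) + frag_of (regraft T e (c, a) (b, d))"
      and T: "T \<in> trees H k" "e \<in> half_edges T - leaves T" "opp T e \<notin> leaves T"
      and abcd: "a = rot T e" "b = rot T a" "c = rot T (opp T e)" "d = rot T c"
      unfolding IHX_rels_def by blast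
    have dist: "distinct [a, b, c, d]" and h: "a \<in> half_edges T" "b \<in> half_edges T"
        "c \<in> half_edges T" "d \<in> half_edges T"
      using IHX_setup[OF T] abcd by simp_all
    have key: "eta0 (regraft T e (a', b') (c', d')) =
        \<Phi> (Bracket (Bracket (word_at T a') (word_at T b')) (word_at T c')) (word_at T d')"
      if p: "distinct [a', b', c', d']" "{a', b', c', d'} = {a, b, c, d}" for a' b' c' d'
    proof -
      note r = regraft_trees[OF T p(1) p(2)[unfolded abcd]]
      have "e \<in> half_edges (regraft T e (a', b') (c', d'))"
        "opp (regraft T e (a', b') (c', d')) e = opp T e"
        using T(2) by (simp_all add: regraft_def)
      then show ?thesis
        using eta0_eq[OF r(1), of e] r(2,3)
          \<Phi>_commute[of "Bracket (word_at T c') (word_at T d')"]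
          \<Phi>_assoc[of "Bracket (word_at T a') (word_at T b')" "word_at T c'" "word_at T d'"] by simp
    qed
    have w: "word_at T a \<in> words H" "word_at T b \<in> words H" "word_at T c \<in> words H" "word_at T d \<in> words H"
      using treesD(3)[OF T(1)] h by auto
    show "p \<in> ?M"
      using \<Phi>_relations[OF word_relations.jacobi[OF w(1-3)] w(4)] dist
        key[of a b c d] key[of b c a d] key[of c a b d] p
      by (auto simp: frag_extend_add insert_commute)
  qed
  moreover have "linearity_rels H k \<subseteq> ?M"
  proof
    fix p assume "p \<in> linearity_rels H k"
    then obtain T w g h where p: "p = frag_of (T\<lparr>lab := (lab T)(w := g \<otimes> h)\<rparr>) -
        frag_of (T\<lparr>lab := (lab T)(w := g)\<rparr>) - frag_of (T\<lparr>lab := (lab T)(w := h)\<rparr>)"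
      and T: "T \<in> trees H k" and w: "w \<in> leaves T" and gh: "g \<in> carrier H" "h \<in> carrier H"
      by (auto simp: linearity_rels_def)
    interpret tree_graph T using treesD T by blast
    have "eta0 (T\<lparr>lab := (lab T)(w := x)\<rparr>) = \<Phi> (Letter x) (word_at T w)" if "x \<in> carrier H" for x
      using eta0_eq[OF relabel_trees[OF T w that], of w] relabel_tree(3,4)[OF w, of x]
        treesD_leaf(1)[OF T w] \<Phi>_commute by simp
    then show "p \<in> ?M"
      using \<Phi>_relations[OF word_relations.letter[OF gh] treesD_leaf(5)[OF T w]] gh p
      by (simp add: frag_extend_diff)
  qed
  ultimately have "tree_relations \<subseteq> ?M" by (auto simp: tree_relations_def)
  then have "tree_ideal \<subseteq> ?M"
    unfolding tree_ideal_def
    by (intro generate_minimal_additive tree_relations_carrier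
        additive_subset_vimage_frag_extend additive_tensor_ideal)
  then show "p \<in> tree_ideal \<Longrightarrow> frag_extend eta0 p \<in> tensor_ideal" by blast
qed

lemma pure_tensor_eq:
  "pure_tensor H (quasi_lie_deg H (Suc k)) h X = frag_coset tensor_ideal (frag_of (h, X))"
  by (simp add: pure_tensor_def gen_class_def r_coset_free_Abelian_group tensor_ideal_def pairs_def L.carrier_G)

lemma eta_coset:
  assumes "p \<in> carrier (free_Abelian_group (trees H k))"
  shows "eta H k (frag_coset tree_ideal p) = frag_coset tensor_ideal (frag_extend eta0 p)"
  unfolding eta_def Suc_eq_plus1[symmetric]
proof (rule HL.induced_hom_coset[OF eta0_closed _ additive_tree_ideal tree_ideal_carrier eta_relations assms])
  fix T assume T: "T \<in> trees H k"
  interpret tree_graph T using treesD T by blast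
  show "finprod (tensor H (quasi_lie_deg H (Suc k)))
      (\<lambda>w. pure_tensor H (quasi_lie_deg H (Suc k)) (lab T w) (rooted_bracket H T w)) (leaves T) =
    frag_coset tensor_ideal (eta0 T)"
    unfolding eta0_def
  proof (rule HL.finprod_coset[OF finite_leaves])
    fix w assume w: "w \<in> leaves T"
    show "frag_of (lab T w, cls (frag_of (word_at T w))) \<in> carrier (free_Abelian_group pairs)"
      using treesD_leaf[OF T w] word_homogeneous by (auto simp: pairs_def)
    have "rooted_bracket H T w = cls (frag_of (word_at T w))"
      by (simp add: rooted_bracket_def quasi_lie_class_eq ideal_eq word_at_def)
    then show "pure_tensor H (quasi_lie_deg H (Suc k)) (lab T w) (rooted_bracket H T w) =
        frag_coset tensor_ideal (frag_of (lab T w, cls (frag_of (word_at T w))))"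
      by (simp add: pure_tensor_eq)
  qed
qed

definition rho0 :: "'h \<times> ('h word \<Rightarrow>\<^sub>0 int) set \<Rightarrow> ('h half_edge_graph \<Rightarrow>\<^sub>0 int)" where
  "rho0 x = frag_extend (tau (Letter (fst x))) (rep (Suc k) (snd x))"

lemma homogeneous_keys: "p \<in> homogeneous n \<Longrightarrow> t \<in> Poly_Mapping.keys p \<Longrightarrow> t \<in> words H \<and> word_degree t = n"
  by (auto simp: homogeneous_def)

lemma rho0_closed: "x \<in> pairs \<Longrightarrow> rho0 x \<in> carrier (free_Abelian_group (trees H k))"
  unfolding rho0_def
  by (rule additive_subset_frag_extend[OF additive_subset_carrier])
    (auto simp: pairs_def intro!: tau_closed dest!: homogeneous_keys[OF rep(1)[OF imageI]]
      simp del: carrier_free_Abelian_group_iff)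

lemma rho0_cls:
  assumes "h \<in> carrier H" "p \<in> homogeneous (Suc k)"
  shows "rho0 (h, cls p) - frag_extend (tau (Letter h)) p \<in> tree_ideal"
  using tau_relations_right[OF rep_cls[OF assms(2)], of "Letter h"] assms(1)
  by (simp add: rho0_def frag_extend_diff)

lemma rho_relations: "z \<in> tensor_ideal \<Longrightarrow> frag_extend rho0 z \<in> tree_ideal"
proof -
  have "tensor_ideal \<subseteq> {z. frag_extend rho0 z \<in> tree_ideal}"
  proof (rule tensor_ideal_minimal)
    show "additive_subset {z. frag_extend rho0 z \<in> tree_ideal}"
      by (intro additive_subset_vimage_frag_extend additive_tree_ideal)
    fix g h p assume gh: "g \<in> carrier H" "h \<in> carrier H" and p: "p \<in> homogeneous (Suc k)"
    have "frag_extend (\<lambda>t. tau (Letter (g \<otimes> h)) t - tau (Letter g) t - tau (Letter h) t) p \<in> tree_ideal"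
      by (rule additive_subset_frag_extend[OF additive_tree_ideal])
        (use tau_letter gh homogeneous_keys[OF p] in auto)
    from RI_add[OF this RI_diff[OF RI_diff[OF rho0_cls[OF m_closed[OF gh] p] rho0_cls[OF gh(1) p]]
          rho0_cls[OF gh(2) p]]]
    show "frag_of (g \<otimes> h, cls p) - frag_of (g, cls p) - frag_of (h, cls p)
        \<in> {z. frag_extend rho0 z \<in> tree_ideal}"
      by (simp add: frag_extend_diff frag_extend_diff_fun)
  next
    fix h p q assume h: "h \<in> carrier H" and pq: "p \<in> homogeneous (Suc k)" "q \<in> homogeneous (Suc k)"
    have "p + q \<in> homogeneous (Suc k)" using pq additive_subset_add[OF additive_homogeneous] by blast
    from RI_diff[OF RI_diff[OF rho0_cls[OF h this] rho0_cls[OF h pq(1)]] rho0_cls[OF h pq(2)]]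
    show "frag_of (h, cls (p + q)) - frag_of (h, cls p) - frag_of (h, cls q)
        \<in> {z. frag_extend rho0 z \<in> tree_ideal}"
      by (simp add: frag_extend_diff frag_extend_add)
  qed
  then show "z \<in> tensor_ideal \<Longrightarrow> frag_extend rho0 z \<in> tree_ideal" by blast
qed

text \<open>Every leaf of a tree contributes the tree itself to the composition.\<close>

lemma rho_eta:
  assumes "p \<in> carrier (free_Abelian_group (trees H k))"
  shows "frag_extend rho0 (frag_extend eta0 p) - frag_cmul (int k + 2) p \<in> tree_ideal"
proof -
  have "frag_extend rho0 (eta0 T) - frag_cmul (int k + 2) (frag_of T) \<in> tree_ideal"
    if T: "T \<in> trees H k" for T
  proof -
    interpret tree_graph T using treesD T by blast
    have leaf: "rho0 (lab T w, cls (frag_of (word_at T w))) - frag_of T \<in> tree_ideal"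
      if w: "w \<in> leaves T" for w
    proof -
      note l = treesD_leaf[OF T w]
      have "tau (Letter (lab T w)) (word_at T w) - frag_of T \<in> tree_ideal"
        using tree_eq_tau[OF T l(2) l(3)] l(1) by simp
      then show ?thesis
        using RI_trans[OF rho0_cls[OF l(4) word_homogeneous[OF l(5,6)]]] by simp
    qed
    have "(\<Sum>w\<in>leaves T. frag_of T) = frag_cmul (int (card (leaves T))) (frag_of T)"
      using finite_leaves by (induction rule: finite_induct) (auto simp: frag_cmul_distrib)
    then have "(\<Sum>w\<in>leaves T. frag_of T) = frag_cmul (int k + 2) (frag_of T)"
      using T by (simp add: trees_iff add.commute)
    moreover have "frag_extend rho0 (eta0 T) = (\<Sum>w\<in>leaves T. rho0 (lab T w, cls (frag_of (word_at T w))))"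
      by (simp add: eta0_def frag_extend_sum[OF finite_leaves] o_def)
    moreover have "(\<Sum>w\<in>leaves T. rho0 (lab T w, cls (frag_of (word_at T w))) - frag_of T) \<in> tree_ideal"
      by (rule additive_subset_sum[OF additive_tree_ideal leaf])
    ultimately show ?thesis by (simp add: sum_subtractf)
  qed
  then have "frag_extend (\<lambda>T. frag_extend rho0 (eta0 T) - frag_cmul (int k + 2) (frag_of T)) p \<in> tree_ideal"
    using assms by (intro additive_subset_frag_extend[OF additive_tree_ideal]) auto
  then show ?thesis
    by (simp add: frag_extend_diff_fun frag_extend_frag_extend frag_extend_cmul_fun frag_extend_single)
qed

section \<open>The bracket map and its kernel\<close>

definition beta0 :: "'h \<times> ('h word \<Rightarrow>\<^sub>0 int) set \<Rightarrow> ('h word \<Rightarrow>\<^sub>0 int)" where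
  "beta0 x = word_mult_left (Letter (fst x)) (rep (Suc k) (snd x))"

lemma beta0_closed: "x \<in> pairs \<Longrightarrow> beta0 x \<in> homogeneous (k + 2)"
  unfolding beta0_def using homogeneous_mult_letter rep(1) by (auto simp: pairs_def)

lemma beta0_cls:
  assumes "h \<in> carrier H" "p \<in> homogeneous (Suc k)"
  shows "beta0 (h, cls p) - word_mult_left (Letter h) p \<in> I"
proof -
  have "word_mult_left (Letter h) (rep (Suc k) (cls p) - p) \<in> I"
    by (rule word_relations.left[OF _ rep_cls[OF assms(2)]]) (use assms(1) in simp)
  then show ?thesis by (simp add: beta0_def)
qed

lemma beta_relations: "z \<in> tensor_ideal \<Longrightarrow> frag_extend beta0 z \<in> I"
proof -
  have "tensor_ideal \<subseteq> {z. frag_extend beta0 z \<in> I}"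
  proof (rule tensor_ideal_minimal)
    show "additive_subset {z. frag_extend beta0 z \<in> I}"
      by (intro additive_subset_vimage_frag_extend additive_word_relations)
    fix g h p assume gh: "g \<in> carrier H" "h \<in> carrier H" and p: "p \<in> homogeneous (Suc k)"
    have "frag_extend (\<lambda>t. word_mult_right t (frag_of (Letter (g \<otimes> h)) - frag_of (Letter g) -
        frag_of (Letter h))) p \<in> I"
      by (rule additive_subset_frag_extend[OF additive_word_relations])
        (use gh homogeneous_keys[OF p] in \<open>auto intro!: word_relations.right word_relations.letter
          simp del: word_mult_simps\<close>)
    then have "word_mult_left (Letter (g \<otimes> h)) p - word_mult_left (Letter g) p - word_mult_left (Letter h) p \<in> I"
      by (simp add: frag_extend_diff_fun word_mult_left_def)
    from I_add[OF this I_diff[OF I_diff[OF beta0_cls[OF m_closed[OF gh] p] beta0_cls[OF gh(1) p]]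
          beta0_cls[OF gh(2) p]]]
    show "frag_of (g \<otimes> h, cls p) - frag_of (g, cls p) - frag_of (h, cls p) \<in> {z. frag_extend beta0 z \<in> I}"
      by (simp add: frag_extend_diff)
  next
    fix h p q assume h: "h \<in> carrier H" and pq: "p \<in> homogeneous (Suc k)" "q \<in> homogeneous (Suc k)"
    have "p + q \<in> homogeneous (Suc k)" using pq additive_subset_add[OF additive_homogeneous] by blast
    from I_diff[OF I_diff[OF beta0_cls[OF h this] beta0_cls[OF h pq(1)]] beta0_cls[OF h pq(2)]]
    show "frag_of (h, cls (p + q)) - frag_of (h, cls p) - frag_of (h, cls q) \<in> {z. frag_extend beta0 z \<in> I}"
      by (simp add: frag_extend_diff)
  qed
  then show "z \<in> tensor_ideal \<Longrightarrow> frag_extend beta0 z \<in> I" by blast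
qed

text \<open>The ideal absorbs products, so the union that defines the bracket runs over one and the
  same class.\<close>

lemma quasi_lie_bracket_eq:
  assumes p: "p \<in> carrier (magma_ring H)" and q: "q \<in> carrier (magma_ring H)"
  shows "quasi_lie_bracket H (cls p) (cls q) = cls (magma_mult p q)"
proof -
  have "quasi_lie_class H (magma_mult x y) = cls (magma_mult p q)"
    if x: "x \<in> cls p" and y: "y \<in> cls q" for x y
  proof -
    have xy: "x - p \<in> I" "y - q \<in> I" using x y by (simp_all add: mem_frag_coset)
    have "y - q + q \<in> carrier (magma_ring H)"
      using xy(2) I_carrier q additive_subset_add[OF additive_subset_carrier] by blast
    then have "magma_mult (x - p) y \<in> I" "magma_mult p (y - q) \<in> I"
      using word_relations_mult p xy by auto
    from I_add[OF this] have "magma_mult x y - magma_mult p q \<in> I"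
      by (simp add: magma_mult_diff_left magma_mult_diff_right)
    then show ?thesis
      by (simp add: quasi_lie_class_eq ideal_eq cls_eq_iff)
  qed
  moreover have "p \<in> cls p" "q \<in> cls q"
    by (simp_all add: self_mem_frag_coset additive_word_relations)
  ultimately show ?thesis
    unfolding quasi_lie_bracket_def by blast
qed

lemma bracket_map_coset:
  assumes "z \<in> carrier (free_Abelian_group pairs)"
  shows "bracket_map H k (frag_coset tensor_ideal z) = cls (frag_extend beta0 z)"
proof -
  interpret L2: coset_group "homogeneous (k + 2)" I "quasi_lie_deg H (k + 2)"
    by (rule quasi_lie_deg_coset_group)
  show ?thesis
    unfolding bracket_map_def
  proof (rule L2.induced_hom_coset[OF beta0_closed _ additive_tensor_ideal tensor_ideal_carrier
        beta_relations assms])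
    fix x assume x: "x \<in> pairs"
    then obtain h X where hX: "x = (h, X)" "h \<in> carrier H" "X \<in> cls ` homogeneous (Suc k)"
      by (auto simp: pairs_def)
    note r = rep[OF hX(3)]
    have "rep (Suc k) X \<in> carrier (magma_ring H)"
      using r(1) by (auto simp: homogeneous_def)
    then have "quasi_lie_bracket H (cls (frag_of (Letter h))) (cls (rep (Suc k) X)) = cls (beta0 x)"
      using quasi_lie_bracket_eq[of "frag_of (Letter h)" "rep (Suc k) X"] hX
      by (simp add: beta0_def magma_mult_of_left)
    then show "(case x of (h, \<alpha>) \<Rightarrow>
        quasi_lie_bracket H (quasi_lie_class H (frag_of (Letter h))) \<alpha>) = cls (beta0 x)"
      using r(2) hX(1) by (simp add: quasi_lie_class_eq ideal_eq)
  qed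
qed

definition cycles :: "('h \<times> ('h word \<Rightarrow>\<^sub>0 int) set \<Rightarrow>\<^sub>0 int) set" where
  "cycles = {z \<in> carrier (free_Abelian_group pairs). frag_extend beta0 z \<in> I}"

sublocale D: coset_group cycles tensor_ideal "D_group H k"
proof -
  have add: "additive_subset cycles"
    using additive_subset_carrier[of pairs] additive_subset_vimage_frag_extend[OF additive_word_relations, of beta0 H]
    unfolding cycles_def additive_subset_def by blast
  have "kernel (H_tensor_L H k) (quasi_lie_deg H (k + 2)) (bracket_map H k) = frag_coset tensor_ideal ` cycles"
  proof -
    interpret L2: coset_group "homogeneous (k + 2)" I "quasi_lie_deg H (k + 2)"
      by (rule quasi_lie_deg_coset_group)
    have "bracket_map H k (frag_coset tensor_ideal z) = \<one>\<^bsub>quasi_lie_deg H (k + 2)\<^esub> \<longleftrightarrow> z \<in> cycles"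
      if "z \<in> carrier (free_Abelian_group pairs)" for z
      unfolding bracket_map_coset[OF that] L2.coset_eq_one_iff using that by (simp add: cycles_def)
    moreover have "cycles \<subseteq> carrier (free_Abelian_group pairs)" by (auto simp: cycles_def)
    ultimately show ?thesis
      unfolding kernel_def Suc_eq_plus1[symmetric] HL.carrier_G by blast
  qed
  then have "D_group H k = (tensor H (quasi_lie_deg H (Suc k)))\<lparr>carrier := frag_coset tensor_ideal ` cycles\<rparr>"
    by (simp add: D_group_def)
  moreover have "cycles \<subseteq> carrier (free_Abelian_group pairs)"
    unfolding cycles_def by blast
  ultimately show "coset_group cycles tensor_ideal (D_group H k)"
    using coset_group_restrict[OF HL.coset_group_axioms add] by simp
qed

text \<open>For \<open>[s, u]\<close> the recursion yields \<open>[s, [u, t]] + [u, [t, s]]\<close>,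
  which is \<open>[[s, u], t]\<close> by antisymmetry and Jacobi. Hence \<open>\<Phi> s t\<close>
  has bracket \<open>[s, t] + [t, s] = 0\<close>.\<close>

lemma beta_F:
  assumes "s \<in> words H" "t \<in> words H" "word_degree s + word_degree t = k + 2"
  shows "frag_extend beta0 (F s t) - frag_of (Bracket s t) \<in> I"
  using assms
proof (induction s arbitrary: t)
  case (Letter h)
  then have t: "word_degree t = Suc k" by simp
  then show ?case
    using beta0_cls[of h "frag_of t"] word_homogeneous[of t "Suc k"] Letter by (simp add: leaf_tensor_def)
next
  case (Bracket s u)
  have w: "s \<in> words H" "u \<in> words H" "t \<in> words H" using Bracket.prems by auto
  have 1: "frag_extend beta0 (F s (Bracket u t)) - frag_of (Bracket s (Bracket u t)) \<in> I"
    "frag_extend beta0 (F u (Bracket t s)) - frag_of (Bracket u (Bracket t s)) \<in> I"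
    using Bracket by auto
  have 2: "frag_of (Bracket s (Bracket u t)) + frag_of (Bracket (Bracket u t) s) \<in> I"
    "frag_of (Bracket u (Bracket t s)) + frag_of (Bracket (Bracket t s) u) \<in> I"
    by (intro word_relations.antisym; use w in simp)+
  from I_diff[OF I_add[OF I_add[OF 1] I_add[OF 2]] word_relations.jacobi[OF w]]
  show ?case by (simp add: frag_extend_add algebra_simps)
qed

lemma eta_cycles:
  assumes "p \<in> carrier (free_Abelian_group (trees H k))"
  shows "frag_extend eta0 p \<in> cycles"
proof (rule additive_subset_frag_extend[OF D.additive_C])
  fix T assume "T \<in> Poly_Mapping.keys p"
  then have T: "T \<in> trees H k" using assms by auto
  obtain x where x: "x \<in> half_edges T"
    using treesD(1)[OF T] conn_graph.connected tree_graph.axioms(1)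
    by (fastforce simp: connected_graph_def)
  interpret tree_graph T using treesD T by blast
  let ?s = "word_at T x" and ?t = "word_at T (opp T x)"
  have w: "?s \<in> words H" "?t \<in> words H" and d: "word_degree ?s + word_degree ?t = k + 2"
    using treesD[OF T] x by auto
  from I_add[OF I_add[OF beta_F[OF w d] beta_F[OF w(2,1)]] word_relations.antisym[OF w]] d
  have "frag_extend beta0 (\<Phi> ?s ?t) \<in> I"
    by (simp add: \<Phi>_def frag_extend_add add.commute)
  then show "eta0 T \<in> cycles"
    using eta0_closed[OF T] eta0_eq[OF T x] by (simp add: cycles_def)
qed

section \<open>Surjectivity\<close>

definition eta_range :: "('h \<times> ('h word \<Rightarrow>\<^sub>0 int) set \<Rightarrow>\<^sub>0 int) set" where
  "eta_range = {z. \<exists>p\<in>carrier (free_Abelian_group (trees H k)). z - frag_extend eta0 p \<in> tensor_ideal}"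

lemma additive_eta_range: "additive_subset eta_range"
  unfolding additive_subset_def
proof (intro conjI ballI)
  show "0 \<in> eta_range"
    unfolding eta_range_def using additive_subset_zero[OF additive_tensor_ideal] by (auto intro!: bexI[of _ 0])
  fix z z' assume "z \<in> eta_range" "z' \<in> eta_range"
  then obtain p p' where p: "p \<in> carrier (free_Abelian_group (trees H k))"
    "p' \<in> carrier (free_Abelian_group (trees H k))"
    "z - frag_extend eta0 p \<in> tensor_ideal" "z' - frag_extend eta0 p' \<in> tensor_ideal"
    unfolding eta_range_def by blast
  have "z - z' - frag_extend eta0 (p - p') \<in> tensor_ideal"
    using TI_diff[OF p(3,4)] by (simp add: frag_extend_diff algebra_simps)
  then show "z - z' \<in> eta_range"
    unfolding eta_range_def using additive_subset_diff[OF additive_subset_carrier p(1,2)] by blast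
qed

lemma tensor_ideal_eta_range: "z \<in> tensor_ideal \<Longrightarrow> z \<in> eta_range"
  unfolding eta_range_def by (auto intro!: bexI[of _ 0])

lemma \<Phi>_eta_range: "s \<in> words H \<Longrightarrow> t \<in> words H \<Longrightarrow> \<Phi> s t \<in> eta_range"
  unfolding eta_range_def
  using eta0_tau tau_closed additive_subset_zero[OF additive_tensor_ideal]
  by (auto intro!: bexI[of _ "tau s t"] simp del: carrier_free_Abelian_group_iff)

primrec split_bracket :: "'h word \<Rightarrow> ('h \<times> ('h word \<Rightarrow>\<^sub>0 int) set \<Rightarrow>\<^sub>0 int)" where
  "split_bracket (Letter h) = 0"
| "split_bracket (Bracket s t) = F s t"

text \<open>
  Modulo the image of \<open>eta\<close>, the map \<open>F\<close> depends only on the bracket of its arguments, so it is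
  a left inverse of the bracket map on the cokernel.
\<close>

lemma split_bracket_relations:
  "p \<in> I \<Longrightarrow> frag_extend split_bracket p \<in> eta_range"
proof (induction rule: word_relations.induct)
  case (letter g h)
  then show ?case
    using additive_subset_zero[OF additive_eta_range] by (simp add: frag_extend_diff)
next
  case (antisym s t)
  then show ?case using \<Phi>_eta_range by (simp add: frag_extend_add \<Phi>_def)
next
  case (jacobi s t u)
  \<comment> \<open>The first term unfolds to \<open>F s [t, u] + F t [u, s]\<close>; these pair up
    with the other two terms.\<close>
  have "frag_extend split_bracket (frag_of (Bracket (Bracket s t) u) + frag_of (Bracket (Bracket t u) s) +
      frag_of (Bracket (Bracket u s) t)) = \<Phi> s (Bracket t u) + \<Phi> t (Bracket u s)"
    by (simp add: frag_extend_add \<Phi>_def algebra_simps)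
  also have "\<dots> \<in> eta_range"
    using jacobi by (intro additive_subset_add[OF additive_eta_range] \<Phi>_eta_range) auto
  finally show ?case .
next
  case zero
  then show ?case using additive_subset_zero[OF additive_eta_range] by simp
next
  case (diff p q)
  then show ?case by (simp add: frag_extend_diff additive_subset_diff[OF additive_eta_range])
next
  case (left s p)
  then show ?case
    using F_right[of p s]
    by (simp add: word_mult_left_def frag_extend_frag_extend tensor_ideal_eta_range)
next
  case (right s p)
  then show ?case
    using F_left[of p s]
    by (simp add: word_mult_right_def frag_extend_frag_extend tensor_ideal_eta_range)
qed

text \<open>\<open>split_bracket\<close> after \<open>beta0\<close> is the identity modulo tensor
  relations. For a cycle \<open>beta0\<close> gives a relation of L', which
  \<open>split_bracket\<close> sends into the image of \<eta>.\<close>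

lemma cycles_eta_range:
  assumes z: "z \<in> cycles"
  obtains p where "p \<in> carrier (free_Abelian_group (trees H k))" "z - frag_extend eta0 p \<in> tensor_ideal"
proof -
  have pair: "frag_extend split_bracket (beta0 x) - frag_of x \<in> tensor_ideal" if x: "x \<in> pairs" for x
  proof -
    obtain h X where hX: "x = (h, X)" "h \<in> carrier H" "X \<in> cls ` homogeneous (Suc k)"
      using x by (auto simp: pairs_def)
    have "frag_extend split_bracket (beta0 x) = frag_extend (leaf_tensor h) (rep (Suc k) X)"
      by (simp add: hX beta0_def word_mult_left_def frag_extend_frag_extend)
    then show ?thesis
      using tensor_linear[OF hX(2) rep(1)[OF hX(3)]] rep(2)[OF hX(3)] hX(1) by simp
  qed
  have "frag_extend (\<lambda>x. frag_extend split_bracket (beta0 x) - frag_of x) z \<in> tensor_ideal"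
    by (rule additive_subset_frag_extend[OF additive_tensor_ideal])
      (use z pair in \<open>auto simp: cycles_def\<close>)
  then have "frag_extend split_bracket (frag_extend beta0 z) - z \<in> tensor_ideal"
    by (simp add: frag_extend_diff_fun frag_extend_frag_extend frag_extend_single)
  moreover have "frag_extend split_bracket (frag_extend beta0 z) \<in> eta_range"
    using z by (intro split_bracket_relations) (simp add: cycles_def)
  ultimately have "frag_extend split_bracket (frag_extend beta0 z) -
      (frag_extend split_bracket (frag_extend beta0 z) - z) \<in> eta_range"
    using additive_subset_diff[OF additive_eta_range] tensor_ideal_eta_range by blast
  then show thesis using that by (auto simp: eta_range_def)
qed

end

section \<open>Sections of homomorphisms to free abelian groups\<close>

lemma strict_well_order_exists:
  obtains r :: "('a \<times> 'a) set" where "wf r" "trans r" "total r"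
proof -
  from well_ordering obtain R :: "('a \<times> 'a) set" where "Well_order R \<and> Field R = UNIV" ..
  then have R: "well_order R" by metis
  show thesis
  proof
    show "wf (R - Id)" using R by (simp add: well_order_on_def)
    have R': "trans R" "antisym R" "total R"
      using R by (simp_all add: well_order_on_def linear_order_on_def partial_order_on_def preorder_on_def)
    show "trans (R - Id)" by (rule trans_diff_Id[OF R'(1,2)])
    show "total (R - Id)" using R'(3) unfolding total_on_def by blast
  qed
qed

lemma finite_max_exists:
  assumes "finite S" "S \<noteq> {}" "trans r" "total r"
  obtains m where "m \<in> S" "\<And>x. x \<in> S \<Longrightarrow> x = m \<or> (x, m) \<in> r"
proof -
  have "\<exists>m\<in>S. \<forall>x\<in>S. x = m \<or> (x, m) \<in> r"
    using assms(1,2)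
  proof (induction rule: finite_ne_induct)
    case (insert a S)
    then obtain m where m: "m \<in> S" "\<forall>x\<in>S. x = m \<or> (x, m) \<in> r" by blast
    consider "a = m" | "(a, m) \<in> r" | "(m, a) \<in> r"
      using assms(4) by (auto simp: total_on_def)
    then show ?case
    proof cases
      case 3
      then have "(x, a) \<in> r" if "x \<in> S" for x
        using m(2) that transD[OF assms(3), of x m a] 3 by metis
      then show ?thesis by blast
    qed (use m in auto)
  qed simp
  then show thesis using that by blast
qed

lemma additive_int_subset_principal:
  fixes N :: "int set"
  assumes "additive_subset N"
  obtains n where "n \<in> N" "\<And>m. m \<in> N \<Longrightarrow> n dvd m"
proof (cases "N \<subseteq> {0}")
  case True
  then show ?thesis using that[of 0] additive_subset_zero[OF assms] by auto
next
  case False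
  then obtain m where m: "m \<in> N" "m \<noteq> 0" by blast
  have "\<bar>m\<bar> \<in> N" using m(1) additive_subset_minus[OF assms m(1)] by (simp add: abs_if)
  then have ex: "\<exists>j::nat. 0 < j \<and> int j \<in> N"
    using m(2) by (intro exI[of _ "nat \<bar>m\<bar>"]) simp
  define n where "n = (LEAST j::nat. 0 < j \<and> int j \<in> N)"
  have n: "0 < n" "int n \<in> N" using LeastI_ex[OF ex] by (simp_all add: n_def)
  have mult: "q * int n \<in> N" for q
  proof -
    have "int j * int n \<in> N" for j :: nat
      by (induction j) (auto simp: distrib_right intro: additive_subset_zero[OF assms] additive_subset_add[OF assms n(2)])
    then show ?thesis
      using additive_subset_minus[OF assms] by (cases q rule: int_cases2) fastforce+
  qed
  have "int n dvd m" if "m \<in> N" for m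
  proof -
    have r: "m mod int n \<in> N"
      using additive_subset_diff[OF assms that mult[of "m div int n"]] by (simp add: minus_div_mult_eq_mod)
    have "\<not> 0 < nat (m mod int n)"
    proof
      assume pos: "0 < nat (m mod int n)"
      have "nat (m mod int n) < n" using n(1) by (simp add: nat_less_iff)
      then show False using not_less_Least[of "nat (m mod int n)" "\<lambda>j. 0 < j \<and> int j \<in> N"] pos r
        by (simp add: n_def[symmetric])
    qed
    then have "m mod int n = 0" using n(1) by (simp add: order_antisym)
    then show ?thesis by (simp add: dvd_eq_mod_eq_0)
  qed
  then show ?thesis using that n(2) by blast
qed

text \<open>
  Elements with the least possible leading coefficient at each leading term of the image map to a
  basis of the image, as in the proof that subgroups of free abelian groups are free.
\<close>

lemma additive_section:
  fixes \<phi> :: "'a \<Rightarrow> ('x \<Rightarrow>\<^sub>0 int)"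
  assumes C: "additive_subset C"
  obtains \<sigma> where "\<And>y. y \<in> frag_extend \<phi> ` C \<Longrightarrow> \<sigma> y \<in> C \<and> frag_extend \<phi> (\<sigma> y) = y"
    and "\<And>y y'. y \<in> frag_extend \<phi> ` C \<Longrightarrow> y' \<in> frag_extend \<phi> ` C \<Longrightarrow> \<sigma> (y - y') = \<sigma> y - \<sigma> y'"
proof -
  obtain r :: "('x \<times> 'x) set" where r: "wf r" "trans r" "total r"
    by (rule strict_well_order_exists)
  define f where "f = frag_extend \<phi>"
  have f_diff: "f (a - b) = f a - f b" and f_cmul: "f (frag_cmul n a) = frag_cmul n (f a)" for a b n
    by (simp_all add: f_def frag_extend_diff frag_extend_cmul)
  define below where "below s = carrier (free_Abelian_group {x. x = s \<or> (x, s) \<in> r})" for s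
  \<comment> \<open>The coefficients at \<open>s\<close> of image elements with no term above
    \<open>s\<close>: a subgroup of the integers, hence principal.\<close>
  define N where "N s = {Poly_Mapping.lookup (f a) s | a. a \<in> C \<and> f a \<in> below s}" for s
  have below: "additive_subset (below s)" for s
    unfolding below_def by (rule additive_subset_carrier)
  have add_N: "additive_subset (N s)" for s
    unfolding additive_subset_def
  proof (intro conjI ballI)
    show "0 \<in> N s"
      unfolding N_def f_def
      using additive_subset_zero[OF C] additive_subset_zero[OF below] by (auto intro!: exI[of _ 0])
    fix m n assume "m \<in> N s" "n \<in> N s"
    then obtain a b where ab: "a \<in> C" "b \<in> C" "f a \<in> below s" "f b \<in> below s"
      "m = Poly_Mapping.lookup (f a) s" "n = Poly_Mapping.lookup (f b) s"
      unfolding N_def by blast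
    have "a - b \<in> C" "f (a - b) \<in> below s"
      using additive_subset_diff[OF C ab(1,2)] additive_subset_diff[OF below ab(3,4)]
      by (simp_all add: f_diff)
    then show "m - n \<in> N s"
      unfolding N_def using ab by (auto intro!: exI[of _ "a - b"] simp: f_diff lookup_minus)
  qed
  have "\<exists>a. a \<in> C \<and> f a \<in> below s \<and> (\<forall>m\<in>N s. Poly_Mapping.lookup (f a) s dvd m)" for s
  proof -
    obtain n where n: "n \<in> N s" "\<And>m. m \<in> N s \<Longrightarrow> n dvd m"
      using additive_int_subset_principal[OF add_N] by metis
    from n(1) obtain a where "a \<in> C" "f a \<in> below s" "n = Poly_Mapping.lookup (f a) s"
      unfolding N_def by blast
    with n(2) show ?thesis by blast
  qed
  then obtain a where a: "\<And>s. a s \<in> C" "\<And>s. f (a s) \<in> below s"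
    "\<And>s m. m \<in> N s \<Longrightarrow> Poly_Mapping.lookup (f (a s)) s dvd m"
    by metis
  \<comment> \<open>The leading terms that really occur; the \<open>f (a s)\<close> for these
    \<open>s\<close> form a basis of the image.\<close>
  define P where "P = {s. Poly_Mapping.lookup (f (a s)) s \<noteq> 0}"
  define g where "g q = frag_extend a q" for q
  have g_closed: "g q \<in> C" for q
    unfolding g_def by (rule additive_subset_frag_extend[OF C a(1)])
  have fg: "f (g q) = frag_extend (\<lambda>s. f (a s)) q" for q
    by (simp add: f_def g_def frag_extend_frag_extend)
  have inj: "q = 0" if q: "Poly_Mapping.keys q \<subseteq> P" "f (g q) = 0" for q
  proof (rule ccontr)
    assume "q \<noteq> 0"
    then obtain s where s: "s \<in> Poly_Mapping.keys q"
      "\<And>t. t \<in> Poly_Mapping.keys q \<Longrightarrow> t = s \<or> (t, s) \<in> r"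
      using finite_max_exists[OF finite_keys _ r(2,3)] by (metis keys_eq_empty)
    \<comment> \<open>\<open>s\<close> is the largest index, and \<open>f (a t)\<close> has no terms
      above \<open>t\<close>; so only \<open>a s\<close> contributes at \<open>s\<close>.\<close>
    have "Poly_Mapping.lookup (f (a t)) s = 0" if t: "t \<in> Poly_Mapping.keys q" "t \<noteq> s" for t
    proof -
      have "(t, s) \<in> r" using s t by blast
      then have "(s, t) \<notin> r" by (rule wf_not_sym[OF r(1)])
      then show ?thesis
        using a(2)[of t] t(2) by (auto simp: below_def in_keys_iff)
    qed
    then have "Poly_Mapping.lookup (f (g q)) s =
        (\<Sum>t\<in>Poly_Mapping.keys q. if t = s then Poly_Mapping.lookup q s * Poly_Mapping.lookup (f (a s)) s else 0)"
      unfolding fg frag_extend_def lookup_sum by (intro sum.cong) auto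
    also have "\<dots> = Poly_Mapping.lookup q s * Poly_Mapping.lookup (f (a s)) s"
      using s(1) by simp
    finally show False
      using q s(1) by (auto simp: P_def in_keys_iff)
  qed
  have surj_below: "\<exists>q. Poly_Mapping.keys q \<subseteq> P \<and> f (g q) = y" if "y \<in> f ` C" "y \<in> below s" for y s
    using r(1) that
  proof (induction s arbitrary: y rule: wf_induct_rule)
    case (less s)
    obtain b where b: "b \<in> C" "y = f b" using less.prems by blast
    then have "Poly_Mapping.lookup y s \<in> N s" using less.prems(2) by (auto simp: N_def)
    then obtain m where m: "Poly_Mapping.lookup y s = m * Poly_Mapping.lookup (f (a s)) s"
      using a(3) by (metis dvd_def mult.commute)
    \<comment> \<open>Removes the coefficient of \<open>y\<close> at \<open>s\<close>. Outside
      \<open>P\<close> that coefficient is a multiple of zero, so there is nothing to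
      remove.\<close>
    define q0 where "q0 = (if s \<in> P then frag_cmul m (frag_of s) else 0)"
    define y' where "y' = y - f (g q0)"
    have q0: "Poly_Mapping.keys q0 \<subseteq> P" by (auto simp: q0_def)
    have "f (g q0) \<in> below s"
      using a(2) additive_subset_zero[OF below] additive_subset_cmul[OF below]
      by (auto simp: fg q0_def frag_extend_cmul)
    then have y'_below: "y' \<in> below s"
      unfolding y'_def using additive_subset_diff[OF below less.prems(2)] by blast
    have y'_zero: "Poly_Mapping.lookup y' s = 0"
      using m by (auto simp: y'_def lookup_minus fg q0_def frag_extend_cmul P_def)
    have y'_im: "y' \<in> f ` C"
      unfolding y'_def b(2) f_diff[symmetric] by (intro imageI additive_subset_diff[OF C] b(1) g_closed)
    have "\<exists>q. Poly_Mapping.keys q \<subseteq> P \<and> f (g q) = y'"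
    proof (cases "y' = 0")
      case True
      then show ?thesis by (intro exI[of _ 0]) (simp add: fg)
    next
      case False
      then obtain t where t: "t \<in> Poly_Mapping.keys y'"
        "\<And>x. x \<in> Poly_Mapping.keys y' \<Longrightarrow> x = t \<or> (x, t) \<in> r"
        using finite_max_exists[OF finite_keys _ r(2,3)] by (metis keys_eq_empty)
      have "(t, s) \<in> r" using t(1) y'_below y'_zero by (auto simp: below_def in_keys_iff)
      moreover have "y' \<in> below t" using t(2) by (auto simp: below_def)
      ultimately show ?thesis using less.IH y'_im by blast
    qed
    then obtain q where q: "Poly_Mapping.keys q \<subseteq> P" "f (g q) = y'" by blast
    have "f (g (q + q0)) = y"
      using q(2) by (simp add: fg frag_extend_add y'_def)
    moreover have "Poly_Mapping.keys (q + q0) \<subseteq> P"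
      using keys_add[of q q0] q(1) q0 by blast
    ultimately show ?case by blast
  qed
  have surj: "\<exists>q. Poly_Mapping.keys q \<subseteq> P \<and> f (g q) = y" if y: "y \<in> f ` C" for y
  proof (cases "y = 0")
    case True
    then show ?thesis by (intro exI[of _ 0]) (simp add: fg)
  next
    case False
    then obtain s where "\<And>x. x \<in> Poly_Mapping.keys y \<Longrightarrow> x = s \<or> (x, s) \<in> r"
      using finite_max_exists[OF finite_keys _ r(2,3)] by (metis keys_eq_empty)
    then have "y \<in> below s" by (auto simp: below_def)
    then show ?thesis using surj_below y by blast
  qed
  define \<psi> where "\<psi> y = (SOME q. Poly_Mapping.keys q \<subseteq> P \<and> f (g q) = y)" for y
  have \<psi>: "Poly_Mapping.keys (\<psi> y) \<subseteq> P" "f (g (\<psi> y)) = y" if "y \<in> f ` C" for y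
    using someI_ex[OF surj[OF that]] by (simp_all add: \<psi>_def)
  show thesis
  proof
    show "g (\<psi> y) \<in> C \<and> frag_extend \<phi> (g (\<psi> y)) = y" if "y \<in> frag_extend \<phi> ` C" for y
      using \<psi>(2)[of y] that g_closed by (simp add: f_def)
    show "g (\<psi> (y - y')) = g (\<psi> y) - g (\<psi> y')"
      if "y \<in> frag_extend \<phi> ` C" "y' \<in> frag_extend \<phi> ` C" for y y'
    proof -
      have y: "y \<in> f ` C" "y' \<in> f ` C" using that by (simp_all add: f_def)
      then have d: "y - y' \<in> f ` C"
        using additive_subset_diff[OF C] by (auto simp: f_diff[symmetric])
      have "\<psi> (y - y') - (\<psi> y - \<psi> y') = 0"
      proof (rule inj)
        show "Poly_Mapping.keys (\<psi> (y - y') - (\<psi> y - \<psi> y')) \<subseteq> P"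
          using \<psi>(1)[OF d] \<psi>(1)[OF y(1)] \<psi>(1)[OF y(2)] keys_diff[of "\<psi> (y - y')" "\<psi> y - \<psi> y'"]
            keys_diff[of "\<psi> y" "\<psi> y'"] by blast
        show "f (g (\<psi> (y - y') - (\<psi> y - \<psi> y'))) = 0"
          using \<psi>(2)[OF d] \<psi>(2)[OF y(1)] \<psi>(2)[OF y(2)]
          by (simp add: fg frag_extend_diff)
      qed
      then have "\<psi> (y - y') = \<psi> y - \<psi> y'" by simp
      then show ?thesis by (simp add: g_def frag_extend_diff)
    qed
  qed
qed

section \<open>The torsion of the tensor product\<close>

text \<open>The first letter tells apart the products with different letters, so a vanishing sum of
  such products vanishes term by term.\<close>

lemma lookup_letter_mult:
  fixes p :: "'a monomial \<Rightarrow>\<^sub>0 int"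
  shows "Poly_Mapping.lookup (frag_of (Monomial [e']) * p) (Monomial (e # w)) =
    (if e' = e then Poly_Mapping.lookup p (Monomial w) else 0)"
proof (induction p rule: frag_induct)
  case zero
  then show ?case by simp
next
  case (one m)
  then show ?case by (cases m) (simp add: mult_single)
next
  case (diff a b)
  then show ?case by (auto simp: right_diff_distrib lookup_minus)
qed

locale based_quasi_lie_trees = quasi_lie_trees H k + based_group r H E \<kappa>
  for H :: "('h, 'm) monoid_scheme" (structure) and k :: nat and r :: "('h \<times> 'h) set"
    and E :: "'h set" and \<kappa> :: "'h \<Rightarrow> ('h \<Rightarrow>\<^sub>0 int)"
begin

abbreviation comm :: "('h word \<Rightarrow>\<^sub>0 int) \<Rightarrow> ('h monomial \<Rightarrow>\<^sub>0 int)" where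
  "comm \<equiv> frag_extend (commutator poly_of)"

text \<open>The ring product plays the part of a tensor product: over basis letters, the first
  letter still recovers the left factor.\<close>

definition theta0 :: "'h \<times> ('h word \<Rightarrow>\<^sub>0 int) set \<Rightarrow> ('h monomial \<Rightarrow>\<^sub>0 int)" where
  "theta0 x = poly_of (fst x) * comm (rep (Suc k) (snd x))"

lemma theta0_cls:
  assumes "p \<in> homogeneous (Suc k)"
  shows "theta0 (h, cls p) = poly_of h * comm p"
  using commutator_relations[OF poly_of_mult rep_cls[OF assms]]
  by (simp add: theta0_def frag_extend_diff)

lemma theta_relations: "z \<in> tensor_ideal \<Longrightarrow> frag_extend theta0 z = 0"
proof -
  have "tensor_ideal \<subseteq> {z. frag_extend theta0 z \<in> {0}}"
  proof (rule tensor_ideal_minimal)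
    show "additive_subset {z. frag_extend theta0 z \<in> {0}}"
      by (rule additive_subset_vimage_frag_extend) (simp add: additive_subset_def)
    fix g h p assume gh: "g \<in> carrier H" "h \<in> carrier H" and p: "p \<in> homogeneous (Suc k)"
    then show "frag_of (g \<otimes> h, cls p) - frag_of (g, cls p) - frag_of (h, cls p)
        \<in> {z. frag_extend theta0 z \<in> {0}}"
      by (simp add: frag_extend_diff theta0_cls poly_of_mult distrib_right)
  next
    fix h p q assume h: "h \<in> carrier H" and pq: "p \<in> homogeneous (Suc k)" "q \<in> homogeneous (Suc k)"
    have "p + q \<in> homogeneous (Suc k)" using pq additive_subset_add[OF additive_homogeneous] by blast
    then show "frag_of (h, cls (p + q)) - frag_of (h, cls p) - frag_of (h, cls q)
        \<in> {z. frag_extend theta0 z \<in> {0}}"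
      using pq by (simp add: frag_extend_diff theta0_cls frag_extend_add distrib_left)
  qed
  then show "z \<in> tensor_ideal \<Longrightarrow> frag_extend theta0 z = 0" by blast
qed

lemma F_Letter [simp]: "F (Letter h) = leaf_tensor h"
  by (simp add: fun_eq_iff)

lemma leaf_tensor_expand:
  assumes "h \<in> carrier H" "t \<in> words H"
  shows "leaf_tensor h t - frag_extend (\<lambda>e. leaf_tensor e t) (\<kappa> h) \<in> tensor_ideal"
  using F_left[OF letter_expand[OF assms(1)] assms(2)]
  by (simp add: frag_extend_diff frag_extend_frag_extend)

definition basis_pairs :: "('h \<times> 'h word) set" where
  "basis_pairs = E \<times> {t \<in> words H. word_degree t = Suc k}"

lemma tensor_basis_expand:
  assumes "z \<in> carrier (free_Abelian_group pairs)"
  obtains y where "y \<in> carrier (free_Abelian_group basis_pairs)"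
    "z - frag_extend (\<lambda>(e, t). leaf_tensor e t) y \<in> tensor_ideal"
proof -
  let ?l = "frag_extend (\<lambda>(e, t). leaf_tensor e t)"
  define M where "M = {z. \<exists>y\<in>carrier (free_Abelian_group basis_pairs). z - ?l y \<in> tensor_ideal}"
  have M: "additive_subset M"
    unfolding additive_subset_def
  proof (intro conjI ballI)
    show "0 \<in> M"
      unfolding M_def using additive_subset_zero[OF additive_tensor_ideal] by (auto intro!: bexI[of _ 0])
    fix z z' assume "z \<in> M" "z' \<in> M"
    then obtain y y' where y: "y \<in> carrier (free_Abelian_group basis_pairs)"
      "y' \<in> carrier (free_Abelian_group basis_pairs)" "z - ?l y \<in> tensor_ideal" "z' - ?l y' \<in> tensor_ideal"
      unfolding M_def by blast
    have "z - z' - ?l (y - y') \<in> tensor_ideal"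
      using TI_diff[OF y(3,4)] by (simp add: frag_extend_diff algebra_simps)
    then show "z - z' \<in> M"
      unfolding M_def using additive_subset_diff[OF additive_subset_carrier y(1,2)] by blast
  qed
  have TI: "z \<in> M" if "z \<in> tensor_ideal" for z
    unfolding M_def using that by (auto intro!: bexI[of _ 0])
  have gen: "leaf_tensor e t \<in> M" if "e \<in> E" "t \<in> words H" for e t
  proof (cases "word_degree t = Suc k")
    case True
    then show ?thesis
      unfolding M_def using that additive_subset_zero[OF additive_tensor_ideal]
      by (auto intro!: bexI[of _ "frag_of (e, t)"] simp: basis_pairs_def)
  next
    case False
    then show ?thesis using additive_subset_zero[OF M] by (simp add: leaf_tensor_def)
  qed
  have leaf: "leaf_tensor h t \<in> M" if "h \<in> carrier H" "t \<in> words H" for h t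
  proof -
    have "frag_extend (\<lambda>e. leaf_tensor e t) (\<kappa> h) \<in> M"
      by (rule additive_subset_frag_extend[OF M]) (use gen coords_keys[OF that(1)] that(2) in blast)
    from additive_subset_add[OF M TI[OF leaf_tensor_expand[OF that]] this] show ?thesis by simp
  qed
  have pair: "frag_of x \<in> M" if x: "x \<in> pairs" for x
  proof -
    obtain h X where hX: "x = (h, X)" "h \<in> carrier H" "X \<in> cls ` homogeneous (Suc k)"
      using x by (auto simp: pairs_def)
    note r = rep[OF hX(3)]
    have "frag_extend (leaf_tensor h) (rep (Suc k) X) \<in> M"
      by (rule additive_subset_frag_extend[OF M])
        (use leaf[OF hX(2)] homogeneous_keys[OF r(1)] in blast)
    from additive_subset_diff[OF M this TI[OF tensor_linear[OF hX(2) r(1)]]] show ?thesis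
      by (simp add: r(2) hX(1))
  qed
  have "frag_extend frag_of z \<in> M"
    by (rule additive_subset_frag_extend[OF M pair]) (use assms in auto)
  then show thesis using that unfolding M_def frag_extend_single by blast
qed

text \<open>With the left factors expanded in the basis, \<open>z\<close> becomes the sum of the
  tensors of \<open>e\<close> with \<open>c e\<close>, and its image is the sum of
  \<open>letter_poly e * comm (c e)\<close>. These summands have different first letters, so each
  \<open>comm (c e)\<close> vanishes and \<open>c e\<close> lies in the square part of degree
  \<open>k + 1\<close>.\<close>

theorem theta_kernel:
  assumes z: "z \<in> carrier (free_Abelian_group pairs)" and zero: "frag_extend theta0 z = 0"
  shows "frag_cmul 2 z \<in> tensor_ideal" "even k \<Longrightarrow> z \<in> tensor_ideal"
proof -
  obtain y where y: "y \<in> carrier (free_Abelian_group basis_pairs)"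
    "z - frag_extend (\<lambda>(e, t). leaf_tensor e t) y \<in> tensor_ideal"
    using tensor_basis_expand[OF z] .
  define J where "J = fst ` Poly_Mapping.keys y"
  define c where "c e = frag_extend (\<lambda>(e', t). if e' = e then frag_of t else 0) y" for e
  have J: "finite J" "J \<subseteq> E"
    using y(1) by (auto simp: J_def basis_pairs_def)
  have c_closed: "c e \<in> homogeneous (Suc k)" for e
    unfolding c_def
    by (rule additive_subset_frag_extend[OF additive_homogeneous])
      (use y(1) in \<open>auto simp: basis_pairs_def additive_subset_zero[OF additive_homogeneous]
        intro!: word_homogeneous\<close>)
  \<comment> \<open>Regroups \<open>y\<close> by its first component, for an arbitrary
    \<open>f\<close>; it is applied both to the tensors and to their images.\<close>
  have decomp: "frag_extend (\<lambda>(e, t). f e t) y = (\<Sum>e\<in>J. frag_extend (f e) (c e))"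
    for f :: "'h \<Rightarrow> 'h word \<Rightarrow> ('x \<Rightarrow>\<^sub>0 int)"
  proof -
    have "(\<Sum>e\<in>J. frag_extend (f e) (c e)) =
        (\<Sum>e\<in>J. frag_extend (\<lambda>(e', t). if e' = e then f e t else 0) y)"
      unfolding c_def frag_extend_frag_extend
      by (intro sum.cong frag_extend_eq) auto
    also have "\<dots> = frag_extend (\<lambda>x. \<Sum>e\<in>J. case x of (e', t) \<Rightarrow> if e' = e then f e t else 0) y"
      by (rule frag_extend_sum_fun[OF J(1), symmetric])
    also have "\<dots> = frag_extend (\<lambda>(e, t). f e t) y"
    proof (rule frag_extend_eq)
      fix x assume "x \<in> Poly_Mapping.keys y"
      then have "fst x \<in> J" by (simp add: J_def)
      then show "(\<Sum>e\<in>J. case x of (e', t) \<Rightarrow> if e' = e then f e t else 0) = (case x of (e, t) \<Rightarrow> f e t)"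
        using J(1) by (cases x) simp
    qed
    finally show ?thesis by simp
  qed
  have "frag_extend theta0 (frag_extend (\<lambda>(e, t). leaf_tensor e t) y) =
      frag_extend (\<lambda>(e, t). letter_poly e * commutator poly_of t) y"
    unfolding frag_extend_frag_extend
  proof (rule frag_extend_eq)
    fix x assume "x \<in> Poly_Mapping.keys y"
    then obtain e t where "x = (e, t)" "e \<in> E" "t \<in> words H" "word_degree t = Suc k"
      using y(1) by (auto simp: basis_pairs_def)
    then show "frag_extend theta0 (case x of (e, t) \<Rightarrow> leaf_tensor e t) =
        (case x of (e, t) \<Rightarrow> letter_poly e * commutator poly_of t)"
      using theta0_cls[OF word_homogeneous] by (simp add: leaf_tensor_def poly_of_basis)
  qed
  also have "\<dots> = (\<Sum>e\<in>J. frag_extend (\<lambda>t. letter_poly e * commutator poly_of t) (c e))"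
    by (rule decomp)
  also have "\<dots> = (\<Sum>e\<in>J. letter_poly e * comm (c e))"
  proof (rule sum.cong[OF refl])
    fix e
    have "frag_extend (\<lambda>t. letter_poly e * commutator poly_of t) p = letter_poly e * comm p" for p
      by (induction p rule: frag_induct) (auto simp: frag_extend_diff right_diff_distrib)
    then show "frag_extend (\<lambda>t. letter_poly e * commutator poly_of t) (c e) = letter_poly e * comm (c e)" .
  qed
  finally have sum_zero: "(\<Sum>e\<in>J. letter_poly e * comm (c e)) = 0"
    using theta_relations[OF y(2)] zero by (simp add: frag_extend_diff)
  have sq: "c e \<in> square_part H (Suc k)" if e: "e \<in> J" for e
  proof -
    have "Poly_Mapping.lookup (comm (c e)) (Monomial w) = 0" for w
    proof -
      have "0 = Poly_Mapping.lookup (\<Sum>e\<in>J. letter_poly e * comm (c e)) (Monomial (e # w))"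
        by (simp add: sum_zero)
      also have "\<dots> = (\<Sum>e'\<in>J. if e' = e then Poly_Mapping.lookup (comm (c e)) (Monomial w) else 0)"
        unfolding lookup_sum by (intro sum.cong) (auto simp: lookup_letter_mult)
      finally show ?thesis using e J(1) by simp
    qed
    then have "comm (c e) = 0"
      by (intro poly_mapping_eqI) (metis lookup_zero monomial.exhaust)
    then show ?thesis
      using commutator_kernel[of "c e" "Suc k"] c_closed by (simp add: homogeneous_def)
  qed
  have Ew: "Letter e \<in> words H" if "e \<in> J" for e
    using that J(2) basis_closed by auto
  have two: "frag_cmul 2 (frag_extend (leaf_tensor e) (c e)) \<in> tensor_ideal" if "e \<in> J" for e
    using F_right[OF _ Ew[OF that], of "frag_cmul 2 (c e)"] sq[OF that]
    by (simp add: square_part_def frag_extend_cmul)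
  \<comment> \<open>For even \<open>k\<close> the degree \<open>k + 1\<close> is odd, and there the
    square part contains relations only.\<close>
  have one: "frag_extend (leaf_tensor e) (c e) \<in> tensor_ideal" if "e \<in> J" "even k" for e
    using F_right[OF _ Ew[OF that(1)], of "c e"] sq[OF that(1)] that(2)
    by (simp add: square_part_def)
  have z_sum: "z - (\<Sum>e\<in>J. frag_extend (leaf_tensor e) (c e)) \<in> tensor_ideal"
    using y(2) decomp[of leaf_tensor] by simp
  have "(\<Sum>e\<in>J. frag_cmul 2 (frag_extend (leaf_tensor e) (c e))) \<in> tensor_ideal"
    by (rule additive_subset_sum[OF additive_tensor_ideal two])
  from TI_add[OF additive_subset_cmul[OF additive_tensor_ideal z_sum, of 2] this]
  show "frag_cmul 2 z \<in> tensor_ideal"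
    by (simp add: frag_cmul_diff_distrib2 frag_cmul_sum)
  assume "even k"
  then have "(\<Sum>e\<in>J. frag_extend (leaf_tensor e) (c e)) \<in> tensor_ideal"
    by (intro additive_subset_sum[OF additive_tensor_ideal] one)
  from TI_add[OF z_sum this] show "z \<in> tensor_ideal" by simp
qed

section \<open>The splitting\<close>

abbreviation eta' :: "('h half_edge_graph \<Rightarrow>\<^sub>0 int) \<Rightarrow> ('h \<times> ('h word \<Rightarrow>\<^sub>0 int) set \<Rightarrow>\<^sub>0 int)" where
  "eta' \<equiv> frag_extend eta0"

abbreviation theta' :: "('h \<times> ('h word \<Rightarrow>\<^sub>0 int) set \<Rightarrow>\<^sub>0 int) \<Rightarrow> ('h monomial \<Rightarrow>\<^sub>0 int)" where
  "theta' \<equiv> frag_extend theta0"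

abbreviation rho' :: "('h \<times> ('h word \<Rightarrow>\<^sub>0 int) set \<Rightarrow>\<^sub>0 int) \<Rightarrow> ('h half_edge_graph \<Rightarrow>\<^sub>0 int)" where
  "rho' \<equiv> frag_extend rho0"

abbreviation tree_chains :: "('h half_edge_graph \<Rightarrow>\<^sub>0 int) set" where
  "tree_chains \<equiv> carrier (free_Abelian_group (trees H k))"

lemma cycles_pairs: "z \<in> cycles \<Longrightarrow> z \<in> carrier (free_Abelian_group pairs)"
  by (simp add: cycles_def)

lemma rho_closed: "z \<in> carrier (free_Abelian_group pairs) \<Longrightarrow> rho' z \<in> tree_chains"
  by (rule additive_subset_frag_extend[OF additive_subset_carrier rho0_closed]) auto

lemma eta_hom: "eta H k \<in> hom (tree_group H k) (D_group H k)"
proof (rule homI)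
  fix x assume "x \<in> carrier (tree_group H k)"
  then show "eta H k x \<in> carrier (D_group H k)"
    using eta_coset eta_cycles by (auto simp: A.carrier_G D.carrier_G simp del: carrier_free_Abelian_group_iff)
next
  fix x y assume "x \<in> carrier (tree_group H k)" "y \<in> carrier (tree_group H k)"
  then obtain p q where pq: "p \<in> tree_chains" "q \<in> tree_chains" "x = frag_coset tree_ideal p"
    "y = frag_coset tree_ideal q"
    by (auto simp: A.carrier_G simp del: carrier_free_Abelian_group_iff)
  then have "p + q \<in> tree_chains" using additive_subset_add[OF additive_subset_carrier] by blast
  then show "eta H k (x \<otimes>\<^bsub>tree_group H k\<^esub> y) = eta H k x \<otimes>\<^bsub>D_group H k\<^esub> eta H k y"
    using pq A.mult_G[OF pq(1,2)] D.mult_G[OF eta_cycles eta_cycles, OF pq(1,2)]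
    by (simp add: eta_coset frag_extend_add del: carrier_free_Abelian_group_iff)
qed

lemma kernel_eta_iff:
  "p \<in> tree_chains \<Longrightarrow>
   frag_coset tree_ideal p \<in> kernel (tree_group H k) (D_group H k) (eta H k) \<longleftrightarrow> eta' p \<in> tensor_ideal"
  using A.coset_closed D.coset_eq_one_iff
  by (simp add: kernel_def eta_coset del: carrier_free_Abelian_group_iff)

lemma kernel_eta_pow:
  assumes "p \<in> tree_chains" "eta' p \<in> tensor_ideal"
  shows "frag_cmul (int k + 2) p \<in> tree_ideal"
  using RI_diff[OF rho_relations[OF assms(2)] rho_eta[OF assms(1)]] by (simp add: add.commute)

text \<open>The associative ring is torsion-free, so a torsion element ends up in the kernel of
  \<theta>, which is zero for even \<open>k\<close>. For odd \<open>n\<close> its image under \<eta>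
  is annihilated by \<open>n\<close> and by two.\<close>

lemma torsion_eta:
  assumes p: "p \<in> tree_chains" and n: "n \<noteq> 0" "frag_cmul n p \<in> tree_ideal"
  shows "frag_cmul 2 (eta' p) \<in> tensor_ideal" "even k \<or> odd n \<Longrightarrow> eta' p \<in> tensor_ideal"
proof -
  have n_eta: "frag_cmul n (eta' p) \<in> tensor_ideal"
    using eta_relations[OF n(2)] by (simp add: frag_extend_cmul)
  have "frag_cmul n (theta' (eta' p)) = 0"
    using theta_relations[OF n_eta] by (simp add: frag_extend_cmul)
  then have zero: "theta' (eta' p) = 0" using n(1) by simp
  note k = theta_kernel[OF cycles_pairs[OF eta_cycles[OF p]] zero]
  show "frag_cmul 2 (eta' p) \<in> tensor_ideal" by (rule k(1))
  assume "even k \<or> odd n"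
  then show "eta' p \<in> tensor_ideal"
  proof
    assume "odd n"
    then obtain m where m: "n = 2 * m + 1" by (rule oddE)
    have "frag_cmul n (eta' p) - frag_cmul m (frag_cmul 2 (eta' p)) \<in> tensor_ideal"
      by (intro TI_diff n_eta additive_subset_cmul[OF additive_tensor_ideal k(1)])
    moreover have "frag_cmul n (eta' p) - frag_cmul m (frag_cmul 2 (eta' p)) = eta' p"
      by (simp add: m frag_cmul_distrib mult.commute)
    ultimately show ?thesis by simp
  qed (rule k(2))
qed

text \<open>
  With a section \<open>\<sigma>\<close> of \<open>\<theta> \<circ> \<eta>\<close>, the element \<open>w = z - \<eta> (\<sigma> (\<theta> z))\<close> lies in the kernel of \<open>\<theta>\<close>.
  Since \<open>\<eta> \<circ> \<rho>\<close> is multiplication by \<open>k + 2\<close>, correcting \<open>\<sigma> (\<theta> z)\<close> by \<open>\<rho> w\<close> changes the error from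
  \<open>- w\<close> to \<open>(k + 1) w\<close>, which vanishes.
\<close>

lemma eta_section: "\<exists>s\<in>hom (D_group H k) (tree_group H k). \<forall>y\<in>carrier (D_group H k). eta H k (s y) = y"
proof -
  define \<phi> where "\<phi> T = theta' (eta0 T)" for T
  have \<phi>: "frag_extend \<phi> p = theta' (eta' p)" for p
    unfolding \<phi>_def frag_extend_frag_extend ..
  obtain \<sigma> where \<sigma>: "\<And>y. y \<in> frag_extend \<phi> ` tree_chains \<Longrightarrow> \<sigma> y \<in> tree_chains \<and> frag_extend \<phi> (\<sigma> y) = y"
    and \<sigma>_diff: "\<And>y y'. y \<in> frag_extend \<phi> ` tree_chains \<Longrightarrow> y' \<in> frag_extend \<phi> ` tree_chains \<Longrightarrow>
      \<sigma> (y - y') = \<sigma> y - \<sigma> y'"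
    using additive_section[OF additive_subset_carrier, of \<phi> "trees H k"] by blast
  \<comment> \<open>By surjectivity \<open>z\<close> is some \<open>eta' p\<close> up to tensor
    relations, and \<theta> kills these.\<close>
  have im: "theta' z \<in> frag_extend \<phi> ` tree_chains" if z: "z \<in> cycles" for z
  proof -
    obtain p where p: "p \<in> tree_chains" "z - eta' p \<in> tensor_ideal"
      using cycles_eta_range[OF z] .
    then have "theta' z = frag_extend \<phi> p"
      using theta_relations[OF p(2)] by (simp add: \<phi> frag_extend_diff)
    then show ?thesis using p(1) by blast
  qed
  define S where "S z = \<sigma> (theta' z) + rho' (z - eta' (\<sigma> (theta' z)))" for z
  have S_diff: "S (z - z') = S z - S z'" if "z \<in> cycles" "z' \<in> cycles" for z z'
  proof -
    have "\<sigma> (theta' (z - z')) = \<sigma> (theta' z) - \<sigma> (theta' z')"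
      using \<sigma>_diff[OF im im, OF that] by (simp add: frag_extend_diff)
    then show ?thesis
      unfolding S_def by (simp only:) (simp add: frag_extend_diff)
  qed
  have w_cycle: "z - eta' (\<sigma> (theta' z)) \<in> cycles" if z: "z \<in> cycles" for z
    using additive_subset_diff[OF D.additive_C z eta_cycles] \<sigma>[OF im[OF z]] by blast
  have S_closed: "S z \<in> tree_chains" if z: "z \<in> cycles" for z
    unfolding S_def
    using additive_subset_add[OF additive_subset_carrier] \<sigma>[OF im[OF z]]
      rho_closed[OF cycles_pairs[OF w_cycle[OF z]]] by blast
  have "\<sigma> 0 = 0"
    using \<sigma>_diff[of "theta' 0" "theta' 0"] im[of 0] additive_subset_zero[OF D.additive_C] by simp
  \<comment> \<open>On a relation \<theta> vanishes, so \<open>S z\<close> reduces to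
    \<open>rho' z\<close>.\<close>
  then have S_relations: "S z \<in> tree_ideal" if "z \<in> tensor_ideal" for z
    using theta_relations[OF that] rho_relations[OF that] by (simp add: S_def)
  have eta_S: "eta' (S z) - z \<in> tensor_ideal" if z: "z \<in> cycles" for z
  proof -
    define w where "w = z - eta' (\<sigma> (theta' z))"
    have w: "w \<in> cycles" using w_cycle[OF z] by (simp add: w_def)
    have "theta' w = 0"
      using \<sigma>[OF im[OF z]] by (simp add: w_def frag_extend_diff \<phi>)
    note tors = theta_kernel[OF cycles_pairs[OF w] this]
    \<comment> \<open>\<open>rho_eta\<close> concerns \<rho> after \<eta>; to compute \<eta> after
      \<rho> on \<open>w\<close>, the cycle is first replaced by some \<open>eta' p\<close>.\<close>
    obtain p where p: "p \<in> tree_chains" "w - eta' p \<in> tensor_ideal"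
      using cycles_eta_range[OF w] .
    have 1: "eta' (rho' (w - eta' p)) \<in> tensor_ideal"
      by (intro eta_relations rho_relations p(2))
    have 2: "eta' (rho' (eta' p) - frag_cmul (int k + 2) p) \<in> tensor_ideal"
      by (intro eta_relations rho_eta p(1))
    have 3: "frag_cmul (int k + 2) (w - eta' p) \<in> tensor_ideal"
      by (intro additive_subset_cmul[OF additive_tensor_ideal] p(2))
    \<comment> \<open>For even \<open>k\<close> already \<open>w\<close> is a relation; for odd
      \<open>k\<close> twice \<open>w\<close> is one, and \<open>k + 1\<close> is even.\<close>
    have err: "frag_cmul (int k + 1) w \<in> tensor_ideal"
    proof (cases "even k")
      case True
      then show ?thesis using additive_subset_cmul[OF additive_tensor_ideal tors(2)] by blast
    next
      case False
      then obtain m where "k = 2 * m + 1" by (rule oddE)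
      then have "frag_cmul (int k + 1) w = frag_cmul (int m + 1) (frag_cmul 2 w)"
        by (simp add: algebra_simps)
      then show ?thesis by (simp only: additive_subset_cmul[OF additive_tensor_ideal tors(1)])
    qed
    have "frag_cmul (int k + 2) w = frag_cmul (int k + 1) w + w"
      using frag_cmul_distrib[of "int k + 1" 1 w] by (simp add: add.commute)
    then have "eta' (S z) - z = eta' (rho' (w - eta' p)) + eta' (rho' (eta' p) - frag_cmul (int k + 2) p) -
        frag_cmul (int k + 2) (w - eta' p) + frag_cmul (int k + 1) w"
      by (simp add: S_def w_def[symmetric] frag_extend_add frag_extend_diff frag_extend_cmul
          frag_cmul_diff_distrib2) (simp add: w_def)
    then show ?thesis using TI_add[OF TI_diff[OF TI_add[OF 1 2] 3] err] by simp
  qed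
  define rep_cycle where "rep_cycle y = (SOME z. z \<in> cycles \<and> frag_coset tensor_ideal z = y)" for y
  have rep_cycle: "rep_cycle y \<in> cycles" "frag_coset tensor_ideal (rep_cycle y) = y"
    if "y \<in> carrier (D_group H k)" for y
  proof -
    have "\<exists>z. z \<in> cycles \<and> frag_coset tensor_ideal z = y" using that by (auto simp: D.carrier_G)
    from someI_ex[OF this] show "rep_cycle y \<in> cycles" "frag_coset tensor_ideal (rep_cycle y) = y"
      by (simp_all add: rep_cycle_def)
  qed
  define s where "s y = frag_coset tree_ideal (S (rep_cycle y))" for y
  have s_coset: "s (frag_coset tensor_ideal z) = frag_coset tree_ideal (S z)" if z: "z \<in> cycles" for z
  proof -
    note r = rep_cycle[OF D.coset_closed[OF z]]
    have "rep_cycle (frag_coset tensor_ideal z) - z \<in> tensor_ideal"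
      using r(2) D.coset_eq_iff by blast
    then show ?thesis
      unfolding s_def A.coset_eq_iff S_diff[OF r(1) z, symmetric] by (rule S_relations)
  qed
  have "s \<in> hom (D_group H k) (tree_group H k)"
  proof (rule homI)
    fix y assume "y \<in> carrier (D_group H k)"
    then show "s y \<in> carrier (tree_group H k)"
      unfolding s_def by (intro A.coset_closed S_closed rep_cycle)
  next
    fix y y' assume "y \<in> carrier (D_group H k)" "y' \<in> carrier (D_group H k)"
    then obtain z z' where z: "z \<in> cycles" "z' \<in> cycles" "y = frag_coset tensor_ideal z"
      "y' = frag_coset tensor_ideal z'" by (auto simp: D.carrier_G)
    have zz: "z + z' \<in> cycles" using additive_subset_add[OF D.additive_C z(1,2)] .
    have "S (z + z') = S z + S z'"
      using S_diff[OF zz z(2)] by (simp add: algebra_simps)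
    then show "s (y \<otimes>\<^bsub>D_group H k\<^esub> y') = s y \<otimes>\<^bsub>tree_group H k\<^esub> s y'"
      using z D.mult_G[OF z(1,2)] A.mult_G[OF S_closed S_closed, OF z(1,2)] s_coset[OF zz]
        s_coset[OF z(1)] s_coset[OF z(2)] by simp
  qed
  moreover have "eta H k (s y) = y" if y: "y \<in> carrier (D_group H k)" for y
  proof -
    obtain z where z: "z \<in> cycles" "y = frag_coset tensor_ideal z"
      using y by (auto simp: D.carrier_G)
    show ?thesis
      using s_coset[OF z(1)] eta_coset[OF S_closed[OF z(1)]] eta_S[OF z(1)] z(2) D.coset_eq_iff by simp
  qed
  ultimately show ?thesis by blast
qed

lemma kernel_pow:
  assumes "x \<in> kernel (tree_group H k) (D_group H k) (eta H k)"
  shows "x [^]\<^bsub>tree_group H k\<^esub> (k + 2) = \<one>\<^bsub>tree_group H k\<^esub>"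
proof -
  obtain p where p: "p \<in> tree_chains" "x = frag_coset tree_ideal p"
    using assms by (auto simp: kernel_def A.carrier_G simp del: carrier_free_Abelian_group_iff)
  then have "frag_cmul (int k + 2) p \<in> tree_ideal"
    using assms kernel_eta_iff kernel_eta_pow by blast
  moreover have "int (k + 2) = int k + 2" by simp
  ultimately show ?thesis
    unfolding p(2) A.nat_pow_coset[OF p(1)] A.coset_eq_one_iff by (simp only:)
qed

lemma torsion_kernel:
  assumes x: "x \<in> carrier (tree_group H k)" and n: "0 < n" "x [^]\<^bsub>tree_group H k\<^esub> (n::nat) = \<one>\<^bsub>tree_group H k\<^esub>"
    and "even k \<or> odd n"
  shows "x \<in> kernel (tree_group H k) (D_group H k) (eta H k)"
proof -
  obtain p where p: "p \<in> tree_chains" "x = frag_coset tree_ideal p"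
    using x by (auto simp: A.carrier_G simp del: carrier_free_Abelian_group_iff)
  have "frag_cmul (int n) p \<in> tree_ideal"
    using n(2) unfolding p(2) A.nat_pow_coset[OF p(1)] A.coset_eq_one_iff .
  then have "eta' p \<in> tensor_ideal"
    using torsion_eta(2)[OF p(1), of "int n"] n(1) assms(4) by simp
  then show ?thesis using kernel_eta_iff p by simp
qed

theorem eta_split_surjection:
  "split_surjection (tree_group H k) (D_group H k) (eta H k) \<and>
    (even k \<longrightarrow>
      kernel (tree_group H k) (D_group H k) (eta H k) = torsion_subgroup (tree_group H k)) \<and>
    (odd k \<longrightarrow>
      kernel (tree_group H k) (D_group H k) (eta H k) = odd_torsion_subgroup (tree_group H k)) \<and>
    (\<forall>x \<in> kernel (tree_group H k) (D_group H k) (eta H k).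
      x [^]\<^bsub>tree_group H k\<^esub> (k + 2) = \<one>\<^bsub>tree_group H k\<^esub>)"
proof (intro conjI impI ballI)
  let ?K = "kernel (tree_group H k) (D_group H k) (eta H k)"
  obtain s where s: "s \<in> hom (D_group H k) (tree_group H k)"
    "\<forall>y\<in>carrier (D_group H k). eta H k (s y) = y"
    using eta_section by blast
  have "carrier (D_group H k) \<subseteq> eta H k ` carrier (tree_group H k)"
  proof
    fix y assume y: "y \<in> carrier (D_group H k)"
    show "y \<in> eta H k ` carrier (tree_group H k)"
      using s(2) y hom_in_carrier[OF s(1) y] by (intro image_eqI[of _ _ "s y"]) simp_all
  qed
  then have "eta H k ` carrier (tree_group H k) = carrier (D_group H k)"
    using hom_carrier[OF eta_hom] by (rule subset_antisym[rotated])
  then have "eta H k \<in> epi (tree_group H k) (D_group H k)"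
    using eta_hom by (simp add: epi_def)
  then show "split_surjection (tree_group H k) (D_group H k) (eta H k)"
    unfolding split_surjection_def using s by blast
  have K: "x \<in> carrier (tree_group H k)" if "x \<in> ?K" for x
    using that by (simp add: kernel_def)
  have dvd: "A.ord x dvd k + 2" if "x \<in> ?K" for x
    using kernel_pow[OF that] K[OF that] A.pow_eq_id by blast
  have tors: "x \<in> ?K" if "x \<in> carrier (tree_group H k)" "0 < A.ord x" "even k \<or> odd (A.ord x)" for x
    by (rule torsion_kernel[OF that(1,2) A.pow_ord_eq_1[OF that(1)] that(3)])
  show "?K = torsion_subgroup (tree_group H k)" if k: "even k"
  proof (intro subset_antisym subsetI)
    fix x assume x: "x \<in> ?K"
    \<comment> \<open>Infinite order is \<open>ord\<close> zero, and zero does not divide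
      \<open>k + 2\<close>.\<close>
    have "A.ord x \<noteq> 0" using dvd[OF x] by (intro notI) simp
    then show "x \<in> torsion_subgroup (tree_group H k)"
      using K[OF x] by (simp add: torsion_subgroup_def)
  next
    fix x assume "x \<in> torsion_subgroup (tree_group H k)"
    then show "x \<in> ?K" using tors[of x] k by (simp add: torsion_subgroup_def)
  qed
  show "?K = odd_torsion_subgroup (tree_group H k)" if k: "odd k"
  proof (intro subset_antisym subsetI)
    fix x assume x: "x \<in> ?K"
    \<comment> \<open>The order divides \<open>k + 2\<close>, which is odd.\<close>
    have "odd (A.ord x)" using dvd_trans[OF _ dvd[OF x], of 2] k by auto
    then show "x \<in> odd_torsion_subgroup (tree_group H k)"
      using K[OF x] by (simp add: odd_torsion_subgroup_def)
  next
    fix x assume "x \<in> odd_torsion_subgroup (tree_group H k)"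
    then show "x \<in> ?K" using tors[of x] by (simp add: odd_torsion_subgroup_def odd_pos)
  qed
  show "x [^]\<^bsub>tree_group H k\<^esub> (k + 2) = \<one>\<^bsub>tree_group H k\<^esub>" if "x \<in> ?K" for x
    by (rule kernel_pow[OF that])
qed

end

section \<open>A basis of the free abelian group\<close>

lemma based_group_exists:
  fixes H :: "('h, 'm) monoid_scheme" (structure) and B :: "'b set"
  assumes "comm_group H" and "H \<cong> free_Abelian_group B"
  obtains r E \<kappa> where "based_group r H E \<kappa>"
proof -
  interpret comm_group H by fact
  obtain f where f: "f \<in> iso H (free_Abelian_group B)"
    using assms(2) by (auto simp: is_iso_def)
  define g where "g = inv_into (carrier H) f"
  have g: "g \<in> iso (free_Abelian_group B) H"
    unfolding g_def by (rule iso_set_sym[OF f])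
  have fg: "f (g c) = c" if "c \<in> carrier (free_Abelian_group B)" for c
    using f that by (auto simp: g_def iso_def bij_betw_def f_inv_into_f)
  have gf: "g (f x) = x" if "x \<in> carrier H" for x
    using f that by (auto simp: g_def iso_def bij_betw_def)
  have hom: "f \<in> hom H (free_Abelian_group B)" "g \<in> hom (free_Abelian_group B) H"
    using f g by (simp_all add: iso_def)
  have g_closed: "g c \<in> carrier H" if "c \<in> carrier (free_Abelian_group B)" for c
    using hom_in_carrier[OF hom(2) that] .
  have f_closed: "f x \<in> carrier (free_Abelian_group B)" if "x \<in> carrier H" for x
    using hom_in_carrier[OF hom(1) that] .
  have g_add: "g (c + d) = g c \<otimes> g d"
    if "c \<in> carrier (free_Abelian_group B)" "d \<in> carrier (free_Abelian_group B)" for c d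
    using hom_mult[OF hom(2) that] by simp
  have f_mult: "f (x \<otimes> y) = f x + f y" if "x \<in> carrier H" "y \<in> carrier H" for x y
    using hom_mult[OF hom(1) that] by simp
  \<comment> \<open>The generators \<open>B\<close> are moved into \<open>H\<close>, because letters
    are elements of \<open>H\<close>.\<close>
  define \<epsilon> where "\<epsilon> b = g (frag_of b)" for b
  define E where "E = \<epsilon> ` B"
  define \<kappa> where "\<kappa> x = frag_extend (\<lambda>b. frag_of (\<epsilon> b)) (f x)" for x
  obtain r :: "('h \<times> 'h) set" where r: "wf r" "trans r" "total r"
    by (rule strict_well_order_exists)
  have expand: "frag_of (Letter (g c)) - frag_extend (\<lambda>b. frag_of (Letter (\<epsilon> b))) c \<in> word_relations H"
    if c: "c \<in> carrier (free_Abelian_group B)" for c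
  proof -
    have "Poly_Mapping.keys c \<subseteq> B" using c by simp
    then have "c \<in> carrier (free_Abelian_group B) \<and>
        frag_of (Letter (g c)) - frag_extend (\<lambda>b. frag_of (Letter (\<epsilon> b))) c \<in> word_relations H"
    proof (induction c rule: frag_induction)
      case zero
      have "g 0 = \<one>" using g_add[of 0 0] g_closed[of 0] by simp
      \<comment> \<open>Additivity for \<one> with itself leaves minus the letter \<one>, so this
        letter is a relation.\<close>
      have "frag_of (Letter (\<one> \<otimes> \<one>)) - frag_of (Letter \<one>) - frag_of (Letter \<one>) \<in> word_relations H"
        by (intro word_relations.letter) auto
      from additive_subset_minus[OF additive_word_relations this] \<open>g 0 = \<one>\<close> show ?case by simp
    next
      case (one b)
      then show ?case by (simp add: \<epsilon>_def word_relations.zero)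
    next
      case (diff a b)
      have ab: "a - b \<in> carrier (free_Abelian_group B)"
        using diff additive_subset_diff[OF additive_subset_carrier] by blast
      have "frag_of (Letter (g (a - b) \<otimes> g b)) - frag_of (Letter (g (a - b))) - frag_of (Letter (g b))
          \<in> word_relations H"
        using diff ab by (intro word_relations.letter g_closed) auto
      moreover have "g (a - b) \<otimes> g b = g a"
        using g_add[OF ab, of b] diff by simp
      ultimately have 1: "frag_of (Letter (g a)) - frag_of (Letter (g (a - b))) - frag_of (Letter (g b))
          \<in> word_relations H" by simp
      from additive_subset_diff[OF additive_word_relations
          additive_subset_diff[OF additive_word_relations conjunct2[OF diff(1)] conjunct2[OF diff(2)]] 1]
      have "frag_of (Letter (g (a - b))) - frag_extend (\<lambda>b. frag_of (Letter (\<epsilon> b))) (a - b) \<in> word_relations H"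
        by (simp add: frag_extend_diff algebra_simps)
      with ab show ?case by blast
    qed
    then show ?thesis by blast
  qed
  have "based_group r H E \<kappa>"
  proof unfold_locales
    show "E \<subseteq> carrier H"
      by (auto simp: E_def \<epsilon>_def intro!: g_closed)
    show "\<kappa> (x \<otimes> y) = \<kappa> x + \<kappa> y" if "x \<in> carrier H" "y \<in> carrier H" for x y
      using that by (simp add: \<kappa>_def f_mult frag_extend_add)
    show "\<kappa> e = frag_of e" if "e \<in> E" for e
      using that by (auto simp: E_def \<kappa>_def \<epsilon>_def fg)
    show "Poly_Mapping.keys (\<kappa> x) \<subseteq> E" if "x \<in> carrier H" for x
      unfolding \<kappa>_def using keys_frag_extend[of "\<lambda>b. frag_of (\<epsilon> b)" "f x"] f_closed[OF that]
      by (fastforce simp: E_def keys_frag_of)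
    show "frag_of (Letter x) - frag_extend (\<lambda>e. frag_of (Letter e)) (\<kappa> x) \<in> word_relations H"
      if "x \<in> carrier H" for x
      using expand[OF f_closed[OF that]] gf[OF that]
      by (simp add: \<kappa>_def frag_extend_frag_extend)
  qed (fact r)+
  then show thesis by (rule that)
qed

theorem theorem1:
  fixes H :: "('h, 'm) monoid_scheme" and B :: "'b set" and k :: nat
  assumes "comm_group H" and "H \<cong> free_Abelian_group B" and "k \<ge> 1"
  shows "split_surjection (tree_group H k) (D_group H k) (eta H k) \<and>
    (even k \<longrightarrow>
      kernel (tree_group H k) (D_group H k) (eta H k) = torsion_subgroup (tree_group H k)) \<and>
    (odd k \<longrightarrow>
      kernel (tree_group H k) (D_group H k) (eta H k) = odd_torsion_subgroup (tree_group H k)) \<and>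
    (\<forall>x \<in> kernel (tree_group H k) (D_group H k) (eta H k).
      x [^]\<^bsub>tree_group H k\<^esub> (k + 2) = \<one>\<^bsub>tree_group H k\<^esub>)"
proof -
  obtain r E \<kappa> where "based_group r H E \<kappa>"
    using based_group_exists[OF assms(1,2)] .
  then interpret based_quasi_lie_trees H k r E \<kappa>
    using assms(1) by (simp add: based_quasi_lie_trees_def quasi_lie_trees_def)
  show ?thesis by (rule eta_split_surjection)
qed

end
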